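(* Let $N\in\{2,3,4,5\}$. Let $x_N$ and $x_{N^2}$ be the Hauptmoduln listed in the context, and let $R,S'\in\mathbb{Q}[X]$ be the polynomials listed there, so that $x_N(\tau)=R(x_{N^2}(\tau))$ and $x_N(N\tau)=x_{N^2}(\tau)^N/S'(x_{N^2}(\tau))$. Then in a neighborhood of $x_{N^2}=0$ (i.e.\ of the cusp $\tau=i\infty$), $$h_{N^2}(x_{N^2})=h_N\bigl(R(x_{N^2})\bigr)=\bigl[S'(x_{N^2})/S'(0)\bigr]^{-\psi(N)/12}\,h_N\!\left(\frac{x_{N^2}^N}{S'(x_{N^2})}\right),$$ with $\psi(N)=N\prod_{p\mid N}(1+1/p)$ and the principal branch of the power.
   Context: Write $[k]$ for $\eta(k\tau)$, where $\eta(\tau)=q^{1/24}\prod_{n\ge1}(1-q^n)$, $q=e^{2\pi i\tau}$. The Hauptmoduln (generators of the function fields of the genus-zero curves $X_0(M)$, each with a simple zero at $\tau=i\infty$ and a simple pole at $\tau=0$) are: $x_2=2^{12}[2]^{24}/[1]^{24}$, $x_3=3^6[3]^{12}/[1]^{12}$, $x_4=2^8[4]^8/[1]^8$, $x_5=5^3[5]^6/[1]^6$, $x_9=3^3[9]^3/[1]^3$, $x_{16}=2^3[2][16]^2/([1]^2[8])$, $x_{25}=5[25]/[1]$. The relations are: $N=2$: $R(X)=X(X+16)$, $S'(X)=X+16$; $N=3$: $R(X)=X(X^2+9X+27)$, $S'(X)=X^2+9X+27$; $N=4$: $R(X)=X(X+4)(X^2+4X+8)$, $S'(X)=(X+2)(X^2+4X+8)$;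 $N=5$: $R(X)=X(X^4+5X^3+15X^2+25X+25)$, $S'(X)=X^4+5X^3+15X^2+25X+25$. For each $M\in\{2,3,4,5,9,16,25\}$ the Klein $j$-invariant is a rational function $j=P_M(x_M)/Q_M(x_M)$ with $P_M,Q_M$ coprime monic polynomials (e.g.\ $j=(x_2+16)^3/x_2$, $j=(x_3+3)^3(x_3+27)/x_3$, $j=(x_4^2+16x_4+16)^3/(x_4(x_4+16))$, $j=(x_5^2+10x_5+5)^3/x_5$), and $h_M$ is defined near $x_M=0$ by $h_M(x_M)=[P_M(x_M)/P_M(0)]^{-1/12}\,{}_2F_1\bigl(\tfrac1{12},\tfrac5{12};1;1728\,Q_M(x_M)/P_M(x_M)\bigr)$, principal branch equal to $1$ at $x_M=0$. *)

theory Defs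
  imports "HOL-Complex_Analysis.Complex_Analysis"
    "HOL-Computational_Algebra.Computational_Algebra"
begin

definition q_of :: "complex \<Rightarrow> complex" where
  "q_of \<tau> = exp (2 * of_real pi * \<i> * \<tau>)"

(* The branch of q^(1/24) is exp (2 pi i tau / 24). *)
definition dedekind_eta :: "complex \<Rightarrow> complex" where
  "dedekind_eta \<tau> = exp (2 * of_real pi * \<i> * \<tau> / 24) * (\<Prod>n. 1 - q_of \<tau> ^ Suc n)"

definition eisenstein_E4 :: "complex \<Rightarrow> complex" where
  "eisenstein_E4 \<tau> =
     1 + 240 * (\<Sum>n. of_nat (\<Sum>d | d dvd Suc n. d ^ 3) * q_of \<tau> ^ Suc n)"

(* j = E_4^3 / Delta with Delta = eta^24, so that j = 1/q + 744 + ... *)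
definition klein_j :: "complex \<Rightarrow> complex" where
  "klein_j \<tau> = eisenstein_E4 \<tau> ^ 3 / dedekind_eta \<tau> ^ 24"

(* Only the levels 2, 3, 4, 5, 9, 16, 25 are meaningful; elsewhere the value is a dummy. *)
definition hauptmodul :: "nat \<Rightarrow> complex \<Rightarrow> complex" where
  "hauptmodul M \<tau> = (let e = (\<lambda>k::nat. dedekind_eta (of_nat k * \<tau>)) in
     if M = 2 then 2 ^ 12 * e 2 ^ 24 / e 1 ^ 24
     else if M = 3 then 3 ^ 6 * e 3 ^ 12 / e 1 ^ 12
     else if M = 4 then 2 ^ 8 * e 4 ^ 8 / e 1 ^ 8
     else if M = 5 then 5 ^ 3 * e 5 ^ 6 / e 1 ^ 6
     else if M = 9 then 3 ^ 3 * e 9 ^ 3 / e 1 ^ 3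
     else if M = 16 then 2 ^ 3 * e 2 * e 16 ^ 2 / (e 1 ^ 2 * e 8)
     else if M = 25 then 5 * e 25 / e 1
     else 0)"

definition is_j_fraction :: "nat \<Rightarrow> complex poly \<Rightarrow> complex poly \<Rightarrow> bool" where
  "is_j_fraction M P Q \<longleftrightarrow>
     lead_coeff P = 1 \<and> lead_coeff Q = 1 \<and> coprime P Q \<and>
     (\<forall>\<tau>. Im \<tau> > 0 \<longrightarrow> poly Q (hauptmodul M \<tau>) \<noteq> 0 \<and>
        klein_j \<tau> = poly P (hauptmodul M \<tau>) / poly Q (hauptmodul M \<tau>))"

(* The pair (P_M, Q_M); a monic reduced fraction is determined by the function it represents. *)
definition j_fraction :: "nat \<Rightarrow> complex poly \<times> complex poly" where
  "j_fraction M = (THE (P, Q). is_j_fraction M P Q)"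

definition j_num :: "nat \<Rightarrow> complex poly" where
  "j_num M = fst (j_fraction M)"

definition j_den :: "nat \<Rightarrow> complex poly" where
  "j_den M = snd (j_fraction M)"

definition hyp2F1 :: "complex \<Rightarrow> complex \<Rightarrow> complex \<Rightarrow> complex \<Rightarrow> complex" where
  "hyp2F1 a b c z = eval_fps (fps_hypergeo [a, b] [c] 1) z"

definition h_fun :: "nat \<Rightarrow> complex \<Rightarrow> complex" where
  "h_fun M x = (poly (j_num M) x / poly (j_num M) 0) powr (- 1 / 12) *
     hyp2F1 (1 / 12) (5 / 12) 1 (1728 * poly (j_den M) x / poly (j_num M) x)"

definition R_poly :: "nat \<Rightarrow> complex poly" where
  "R_poly N =
     (if N = 2 then [:0, 1:] * [:16, 1:]
      else if N = 3 then [:0, 1:] * [:27, 9, 1:]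
      else if N = 4 then [:0, 1:] * [:4, 1:] * [:8, 4, 1:]
      else if N = 5 then [:0, 1:] * [:25, 25, 15, 5, 1:]
      else 0)"

(* S' is only a name here: the prime does not denote a derivative. *)
definition S'_poly :: "nat \<Rightarrow> complex poly" where
  "S'_poly N =
     (if N = 2 then [:16, 1:]
      else if N = 3 then [:27, 9, 1:]
      else if N = 4 then [:2, 1:] * [:8, 4, 1:]
      else if N = 5 then [:25, 25, 15, 5, 1:]
      else 0)"

definition dedekind_psi :: "nat \<Rightarrow> real" where
  "dedekind_psi N = real N * (\<Prod>p\<in>prime_factors N. 1 + 1 / real p)"

end

theory Submission
  imports Defs
begin

text \<open>
  A Liouville argument for the theta function gives the behaviour of \<open>\<eta>\<^sup>6\<close> under \<open>\<tau> \<mapsto> -1/\<tau>\<close>, and the fourth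
  Taylor coefficient of its logarithm gives that of \<open>E\<^sub>4\<close>. For \<open>p = 2, 3, 5\<close> the difference between \<open>j\<close>
  and the rational function of \<open>x\<^sub>p\<close>, multiplied with its translates under the cosets of \<open>\<Gamma>\<^sub>0(p)\<close>, is
  a modular function without poles that vanishes at the cusp, hence zero. Writing \<open>j(p\<tau>)\<close> once through
  \<open>x\<^sub>p(p\<tau>)\<close> and once through the Fricke image of \<open>x\<^sub>p(\<tau>)\<close> yields an algebraic equation between \<open>x\<^sub>p\<close> and \<open>x\<close>
  at level \<open>p\<^sup>2\<close>, and \<open>x\<^sub>p = R(x)\<close> is its only branch with the right behaviour at \<open>i\<infinity>\<close>;
  level 16 follows from level 4 by the duplication formula of a quotient of theta constants. So the fraction for \<open>j\<close>
  at level \<open>N\<^sup>2\<close> is the one at level \<open>N\<close> composed with \<open>R\<close>, which is the first equality.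

  For the second equality, \<open>h\<^sub>N\<close> is a pullback of the hypergeometric function and solves a linear
  differential equation of order two whose indicial equation at \<open>0\<close> is \<open>n\<^sup>2 = 0\<close>. Both sides solve the same
  such equation and agree at \<open>0\<close>.
\<close>

subsection \<open>Inversion of theta and eta\<close>

text \<open>Theta inversion determines only the cube of its constant, from the values at the three
  half-periods. Everything is therefore arranged around \<open>eta ^ 6\<close>: for p = 2, 3, 5 the
  Hauptmodul is a power m of \<open>eta6 (p * t) / eta6 t\<close> up to a constant, with m (p - 1) =
  4, so that the fourth root of unity picked up by \<open>eta ^ 6\<close> cancels. Modular
  transformations are used only for j and these three functions. The Hauptmoduln of levels 4, 9, 16
  and 25 enter through their behaviour at q = 0: each relation is an algebraic identity near the
  cusp, where the wrong factors have nonzero limits, and analytic continuation extends it. Level 4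
  is treated as 2^2, so both its fraction for j and its differential equation come from level 2.
  Since \<open>j_num\<close> and \<open>j_den\<close> are given by a definite description, an
  explicit fraction can be used only after a uniqueness proof. From then on the second equality is a
  matter of polynomial identities. Its differential equations are pinned down by the ramification of
  j over 0 and 1728, which leaves very few singular points.\<close>

definition qpoch :: "complex \<Rightarrow> complex \<Rightarrow> complex" where
  "qpoch w q = (\<Prod>n. 1 - w * q ^ n)"

section \<open>Infinite q-Pochhammer products in two variables\<close>

lemma abs_convergent_qpoch:
  fixes w q :: complex
  assumes "norm q < 1"
  shows "abs_convergent_prod (\<lambda>n. 1 - w * q ^ n)"
proof -
  have "summable (\<lambda>n. norm ((1 - w * q ^ n) - 1))"
    using assms by (simp add: norm_mult norm_power summable_mult)
  thus ?thesis by (rule summable_imp_abs_convergent_prod)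
qed

lemma convergent_qpoch: "norm q < 1 \<Longrightarrow> convergent_prod (\<lambda>n. 1 - w * q ^ n)" for w q :: complex
  by (intro abs_convergent_prod_imp_convergent_prod abs_convergent_qpoch)

lemma qpoch_eq_0_iff:
  assumes "norm q < 1"
  shows "qpoch w q = 0 \<longleftrightarrow> (\<exists>n. w * q ^ n = 1)"
proof -
  have "(\<lambda>n. 1 - w * q ^ n) has_prod qpoch w q"
    unfolding qpoch_def using convergent_qpoch[OF assms] by auto
  from has_prod_eq_0_iff[OF this] show ?thesis by auto
qed

lemma qpoch_rec:
  assumes "norm q < 1"
  shows "qpoch w q = (1 - w) * qpoch (w * q) q"
proof (cases "w = 1")
  case True
  have "qpoch w q = 0"
    unfolding qpoch_eq_0_iff[OF assms] using True by (intro exI[of _ 0]) auto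
  with True show ?thesis by simp
next
  case False
  have "qpoch (w * q) q = qpoch w q / (1 - w)"
    unfolding qpoch_def using prodinf_split_head[OF convergent_qpoch[OF assms], of w] False
    by (simp add: mult_ac)
  thus ?thesis using False by simp
qed

lemma qpoch_LIMSEQ:
  assumes "norm q < 1"
  shows "(\<lambda>m. \<Prod>n<m. 1 - w * q ^ n) \<longlonglongrightarrow> qpoch w q"
  unfolding qpoch_def
  by (intro has_prod_imp_tendsto' convergent_prod_has_prod convergent_qpoch assms)

lemma qpoch_0_left [simp]: "qpoch 0 q = 1"
  by (simp add: qpoch_def)

text \<open>Both arguments vary, so the majorant is built on a closed disc: by compactness norm f is
  at most some B and norm g at most some \<rho> < 1 there, and the M-test with B \<rho>^n makes the
  partial products converge uniformly.\<close>

lemma qpoch_holomorphic [holomorphic_intros]: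
  assumes f: "f holomorphic_on A" and g: "g holomorphic_on A" and A: "open A"
    and g1: "\<And>z. z \<in> A \<Longrightarrow> norm (g z) < 1"
  shows "(\<lambda>z. qpoch (f z) (g z)) holomorphic_on A"
proof -
  have "(\<lambda>z. qpoch (f z) (g z)) analytic_on A"
    unfolding analytic_on_def
  proof
    fix z assume z: "z \<in> A"
    obtain e where e: "e > 0" "cball z e \<subseteq> A"
      using A z open_contains_cball by blast
    have cf: "continuous_on (cball z e) f" and cg: "continuous_on (cball z e) g"
      using f g e holomorphic_on_imp_continuous_on holomorphic_on_subset by blast+
    have "compact (f ` cball z e)"
      using cf by (intro compact_continuous_image) auto
    then obtain B where B: "B > 0" "\<And>u. u \<in> cball z e \<Longrightarrow> norm (f u) \<le> B"
      using compact_imp_bounded bounded_pos by (metis image_eqI)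
    have "\<exists>u\<in>cball z e. \<forall>v\<in>cball z e. norm (g v) \<le> norm (g u)"
      using e by (intro continuous_attains_sup continuous_intros cg) auto
    then obtain u where u: "u \<in> cball z e" "\<And>v. v \<in> cball z e \<Longrightarrow> norm (g v) \<le> norm (g u)"
      by blast
    define \<rho> where "\<rho> = norm (g u)"
    have \<rho>: "0 \<le> \<rho>" "\<rho> < 1" using g1 u e by (auto simp: \<rho>_def)
    have uc: "uniformly_convergent_on (cball z e) (\<lambda>N x. \<Prod>n<N. 1 + - (f x * g x ^ n))"
    proof (rule uniformly_convergent_on_prod)
      show "continuous_on (cball z e) (\<lambda>x. - (f x * g x ^ n))" for n
        by (intro continuous_intros cf cg)
      show "uniformly_convergent_on (cball z e) (\<lambda>N x. \<Sum>n<N. norm (- (f x * g x ^ n)))"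
      proof (rule Weierstrass_m_test')
        show "norm (norm (- (f x * g x ^ n))) \<le> B * \<rho> ^ n" if "x \<in> cball z e" for n x
          using B(2)[OF that] u(2)[OF that] B(1)
          by (simp add: norm_mult norm_power \<rho>_def mult_mono power_mono)
        show "summable (\<lambda>n. B * \<rho> ^ n)" using \<rho> by (simp add: summable_mult)
      qed
    qed auto
    then obtain L where L: "uniform_limit (cball z e) (\<lambda>N x. \<Prod>n<N. 1 + - (f x * g x ^ n)) L sequentially"
      by (auto simp: uniformly_convergent_on_def)
    have L': "L x = qpoch (f x) (g x)" if "x \<in> cball z e" for x
    proof -
      have "norm (g x) < 1" using g1 e that by auto
      from qpoch_LIMSEQ[OF this, of "f x"] tendsto_uniform_limitI[OF L that]
      show ?thesis by (intro LIMSEQ_unique) auto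
    qed
    have "L holomorphic_on ball z e"
    proof (rule holomorphic_uniform_limit[OF _ L])
      have "continuous_on (cball z e) (\<lambda>x. \<Prod>n<N. 1 + - (f x * g x ^ n))
          \<and> (\<lambda>x. \<Prod>n<N. 1 + - (f x * g x ^ n)) holomorphic_on ball z e" for N
      proof
        show "continuous_on (cball z e) (\<lambda>x. \<Prod>n<N. 1 + - (f x * g x ^ n))"
          by (intro continuous_intros cf cg)
        have "f holomorphic_on ball z e" "g holomorphic_on ball z e"
          using f g e ball_subset_cball holomorphic_on_subset by (meson order_trans)+
        thus "(\<lambda>x. \<Prod>n<N. 1 + - (f x * g x ^ n)) holomorphic_on ball z e"
          by (intro holomorphic_intros)
      qed
      thus "\<forall>\<^sub>F N in sequentially. continuous_on (cball z e) (\<lambda>x. \<Prod>n<N. 1 + - (f x * g x ^ n))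
          \<and> (\<lambda>x. \<Prod>n<N. 1 + - (f x * g x ^ n)) holomorphic_on ball z e" by simp
    qed auto
    hence "(\<lambda>z. qpoch (f z) (g z)) holomorphic_on ball z e"
      by (rule holomorphic_transform) (simp add: L')
    thus "\<exists>e>0. (\<lambda>z. qpoch (f z) (g z)) holomorphic_on ball z e" using e(1) by (intro exI conjI)
  qed
  thus ?thesis by (rule analytic_imp_holomorphic)
qed

lemma qpoch_double:
  assumes "norm q < 1"
  shows "qpoch w q = qpoch w (q\<^sup>2) * qpoch (w * q) (q\<^sup>2)"
proof -
  have q2: "norm (q\<^sup>2) < 1" using assms by (simp add: norm_power power_less_one_iff)
  have 1: "(\<lambda>m. \<Prod>n<2*m. 1 - w * q ^ n) \<longlonglongrightarrow> qpoch w q"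
    using LIMSEQ_subseq_LIMSEQ[OF qpoch_LIMSEQ[OF assms, of w], of "\<lambda>m. 2 * m"]
    by (simp add: strict_mono_def o_def)
  have "(\<Prod>n<2*m. 1 - w * q ^ n) = (\<Prod>n<m. 1 - w * (q\<^sup>2) ^ n) * (\<Prod>n<m. 1 - w * q * (q\<^sup>2) ^ n)" for m
    by (induction m) (simp_all add: power_mult mult_ac power2_eq_square power_mult_distrib)
  with 1 have "(\<lambda>m. (\<Prod>n<m. 1 - w * (q\<^sup>2) ^ n) * (\<Prod>n<m. 1 - w * q * (q\<^sup>2) ^ n)) \<longlonglongrightarrow> qpoch w q"
    by simp
  moreover have "(\<lambda>m. (\<Prod>n<m. 1 - w * (q\<^sup>2) ^ n) * (\<Prod>n<m. 1 - w * q * (q\<^sup>2) ^ n))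
      \<longlonglongrightarrow> qpoch w (q\<^sup>2) * qpoch (w * q) (q\<^sup>2)"
    by (intro tendsto_mult qpoch_LIMSEQ q2)
  ultimately show ?thesis by (rule LIMSEQ_unique)
qed

lemma qpoch_mult_neg:
  assumes "norm q < 1"
  shows "qpoch w q * qpoch (-w) q = qpoch (w\<^sup>2) (q\<^sup>2)"
proof -
  have q2: "norm (q\<^sup>2) < 1" using assms by (simp add: norm_power power_less_one_iff)
  have "(\<lambda>m. (\<Prod>n<m. 1 - w * q ^ n) * (\<Prod>n<m. 1 - (-w) * q ^ n)) \<longlonglongrightarrow> qpoch w q * qpoch (-w) q"
    by (intro tendsto_mult qpoch_LIMSEQ assms)
  moreover have "(\<Prod>n<m. 1 - w * q ^ n) * (\<Prod>n<m. 1 - (-w) * q ^ n) = (\<Prod>n<m. 1 - w\<^sup>2 * (q\<^sup>2) ^ n)" for m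
    unfolding prod.distrib[symmetric]
    by (intro prod.cong refl) (simp add: algebra_simps power2_eq_square power_mult_distrib)
  ultimately have "(\<lambda>m. \<Prod>n<m. 1 - w\<^sup>2 * (q\<^sup>2) ^ n) \<longlonglongrightarrow> qpoch w q * qpoch (-w) q" by simp
  thus ?thesis using qpoch_LIMSEQ[OF q2] LIMSEQ_unique by blast
qed

lemma qpoch_self_nz:
  assumes "norm q < 1"
  shows "qpoch q q \<noteq> 0"
proof
  assume "qpoch q q = 0"
  then obtain n where "q * q ^ n = 1" using qpoch_eq_0_iff[OF assms] by blast
  hence "norm q ^ Suc n = 1" by (metis norm_one norm_power power_Suc)
  moreover have "norm q ^ Suc n < 1"
    using assms by (subst power_less_one_iff) auto
  ultimately show False by simp
qed

text \<open>Euler: \<open>qpoch (-q) q\<close> and \<open>qpoch q (q\<^sup>2)\<close> are inverse, since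
  \<open>qpoch q q * qpoch (-q) q = qpoch (q\<^sup>2) (q\<^sup>2)\<close> is the even part of \<open>qpoch q q\<close>.\<close>

lemma qpoch_euler:
  assumes "norm q < 1"
  shows "qpoch (-q) q * qpoch q (q\<^sup>2) = 1"
proof -
  have "qpoch q q \<noteq> 0" by (rule qpoch_self_nz[OF assms])
  moreover have "qpoch q q * (qpoch (-q) q * qpoch q (q\<^sup>2)) = qpoch q q"
    using qpoch_mult_neg[OF assms, of q] qpoch_double[OF assms, of q]
    by (simp add: power2_eq_square mult_ac)
  ultimately show ?thesis by simp
qed

section \<open>The exponential q = exp (2 pi i \<tau>)\<close>

lemma q_of_add: "q_of (a + b) = q_of a * q_of b"
  by (simp add: q_of_def distrib_left exp_add)

lemma q_of_diff: "q_of (a - b) = q_of a / q_of b"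
  by (simp add: q_of_def right_diff_distrib exp_diff)

lemma q_of_minus: "q_of (- a) = inverse (q_of a)"
  by (simp add: q_of_def exp_minus)

lemma q_of_nz [simp]: "q_of a \<noteq> 0"
  by (simp add: q_of_def)

lemma q_of_mult_nat: "q_of (of_nat n * a) = q_of a ^ n"
  by (simp add: q_of_def exp_of_nat_mult [symmetric] algebra_simps)

lemma q_of_eq_1_iff: "q_of a = 1 \<longleftrightarrow> a \<in> \<int>"
proof
  assume "q_of a = 1"
  then obtain n :: int where "Im a = 0" "2 * pi * Re a = of_int (2 * n) * pi"
    unfolding q_of_def exp_eq_1 by auto
  hence "a = of_int n" by (simp add: complex_eq_iff)
  thus "a \<in> \<int>" by simp
next
  assume "a \<in> \<int>"
  then obtain n where n: "a = of_int n" by (elim Ints_cases)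
  show "q_of a = 1" unfolding q_of_def exp_eq_1
    by (auto simp: n intro!: exI[of _ n])
qed

lemma norm_q_of: "norm (q_of a) = exp (- (2 * pi * Im a))"
  by (simp add: q_of_def)

lemma norm_q_of_less_1: "Im a > 0 \<Longrightarrow> norm (q_of a) < 1"
  by (simp add: norm_q_of)

lemma q_of_holomorphic [holomorphic_intros]:
  "f holomorphic_on A \<Longrightarrow> (\<lambda>z. q_of (f z)) holomorphic_on A"
  unfolding q_of_def by (intro holomorphic_intros)

text \<open>The value type is arbitrary because \<open>P\<close> may be a predicate: a
  quasi-periodic function has a periodic zero set. With \<tau> = 0 the lemma also covers functions
  with the single period 1.\<close>

lemma lattice_periodic:
  fixes P :: "complex \<Rightarrow> 'a"
  assumes "\<And>z. P (z + 1) = P z" "\<And>z. P (z + \<tau>) = P z"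
  shows "P (z + of_int m + of_int n * \<tau>) = P z"
proof -
  have 1: "P (z + of_nat k * w) = P z" if "\<And>z. P (z + w) = P z" for k w z
  proof (induction k)
    case (Suc k)
    have "P (z + of_nat (Suc k) * w) = P (z + of_nat k * w + w)" by (simp add: algebra_simps)
    thus ?case using Suc that by simp
  qed simp
  have 2: "P (z + of_int k * w) = P z" if w: "\<And>z. P (z + w) = P z" for k w z
  proof (cases "k \<ge> 0")
    case True
    thus ?thesis using 1[OF w, of z "nat k"] by simp
  next
    case False
    have "P (z + of_int k * w) = P (z + of_int k * w + of_nat (nat (- k)) * w)"
      by (rule 1[OF w, symmetric])
    thus ?thesis using False by (simp add: algebra_simps)
  qed
  show ?thesis using 2[OF assms(1), of z m] 2[OF assms(2)] by simp
qed

text \<open>The quotient \<open>f / g\<close> extends over the lattice, because \<open>g\<close> has a simple zero there,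
  to a doubly periodic entire function.\<close>

lemma quasi_periodic_proportional:
  assumes \<tau>: "Im \<tau> > 0" and f: "f holomorphic_on UNIV" and g: "g holomorphic_on UNIV"
    and f1: "\<And>z. f (z + 1) = a z * f z" and f\<tau>: "\<And>z. f (z + \<tau>) = b z * f z"
    and g1: "\<And>z. g (z + 1) = a z * g z" and g\<tau>: "\<And>z. g (z + \<tau>) = b z * g z"
    and ab: "\<And>z. a z \<noteq> 0" "\<And>z. b z \<noteq> 0"
    and g_zero: "\<And>z. g z = 0 \<Longrightarrow> \<exists>m n. z = of_int m + of_int n * \<tau>"
    and 0: "f 0 = 0" "g 0 = 0" and dg: "deriv g 0 \<noteq> 0"
  obtains c where "\<And>z. f z = c * g z"
proof -
  define h where "h z = (if g z = 0 then deriv f 0 / deriv g 0 else f z / g z)" for z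
  have h1: "h (z + 1) = h z" for z using ab(1)[of z] by (simp add: h_def f1 g1)
  have h\<tau>: "h (z + \<tau>) = h z" for z using ab(2)[of z] by (simp add: h_def f\<tau> g\<tau>)
  have shift: "h (z + of_int m + of_int n * \<tau>) = h z" for z m n
    by (rule lattice_periodic) (rule h1 h\<tau>)+
  \<comment> \<open>\<open>F\<close> and \<open>G\<close> are \<open>f\<close> and \<open>g\<close>
    with the zero at 0 divided out. Near 0 the function \<open>h\<close> equals
    \<open>F / G\<close>, and periodicity carries its differentiability to all other lattice
    points.\<close>
  define F where "F z = (if z = 0 then deriv f 0 else (f z - f 0) / (z - 0))" for z
  define G where "G z = (if z = 0 then deriv g 0 else (g z - g 0) / (z - 0))" for z
  have F: "F holomorphic_on UNIV" and G: "G holomorphic_on UNIV"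
    unfolding F_def G_def using f g by (intro pole_lemma_open open_UNIV; simp)+
  have h0: "h field_differentiable (at 0)"
  proof -
    have "isCont G 0"
      using holomorphic_on_imp_continuous_on[OF G] by (simp add: continuous_on_eq_continuous_at)
    moreover have "G 0 \<noteq> 0" using dg by (simp add: G_def)
    ultimately obtain e where e: "e > 0" "\<And>z. z \<in> ball 0 e \<Longrightarrow> G z \<noteq> 0"
      using continuous_at_avoid[of 0 G 0] by (auto simp: dist_commute)
    have "(\<lambda>z. F z / G z) holomorphic_on ball 0 e"
      by (intro holomorphic_intros holomorphic_on_subset[OF F] holomorphic_on_subset[OF G]) (use e in auto)
    moreover have "F z / G z = h z" if "z \<in> ball 0 e" for z
      using e(2)[OF that] 0 by (auto simp: h_def F_def G_def)
    ultimately have "h holomorphic_on ball 0 e" by (rule holomorphic_transform)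
    thus ?thesis using e by (auto intro: holomorphic_on_imp_differentiable_at)
  qed
  have "h field_differentiable (at z)" for z
  proof (cases "g z = 0")
    case True
    then obtain m n where mn: "z = of_int m + of_int n * \<tau>" using g_zero by blast
    have eq: "h = (\<lambda>u. h (u - z))"
    proof
      fix u show "h u = h (u - z)" using shift[of "u - z" m n] by (simp add: mn algebra_simps)
    qed
    have "(h \<circ> (\<lambda>u. u - z)) field_differentiable (at z)"
      by (rule field_differentiable_compose) (use h0 in \<open>auto intro!: derivative_intros field_differentiable_diff\<close>)
    thus ?thesis using eq by (simp add: o_def)
  next
    case False
    have "isCont g z"
      using holomorphic_on_imp_continuous_on[OF g] by (simp add: continuous_on_eq_continuous_at)
    then obtain e where e: "e > 0" "\<And>u. u \<in> ball z e \<Longrightarrow> g u \<noteq> 0"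
      using continuous_at_avoid[of z g 0] False by (auto simp: dist_commute)
    have "(\<lambda>u. f u / g u) holomorphic_on ball z e"
      by (intro holomorphic_intros holomorphic_on_subset[OF f] holomorphic_on_subset[OF g]) (use e in auto)
    moreover have "f u / g u = h u" if "u \<in> ball z e" for u
      using e(2)[OF that] by (auto simp: h_def)
    ultimately have "h holomorphic_on ball z e" by (rule holomorphic_transform)
    thus ?thesis using e by (auto intro: holomorphic_on_imp_differentiable_at)
  qed
  hence h: "h holomorphic_on UNIV" by (simp add: holomorphic_on_def)
  \<comment> \<open>This disc contains a representative of every class modulo the lattice, so
    \<open>h\<close> takes all its values on a compact set.\<close>
  have "bounded (h ` cball 0 (1 + Im \<tau>))"
    by (intro compact_imp_bounded compact_continuous_image holomorphic_on_imp_continuous_on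
        holomorphic_on_subset[OF h]) auto
  moreover have "range h \<subseteq> h ` cball 0 (1 + Im \<tau>)"
  proof safe
    fix z
    define n where "n = \<lfloor>Im z / Im \<tau>\<rfloor>"
    define m where "m = \<lfloor>Re (z - of_int n * \<tau>)\<rfloor>"
    define u where "u = z - of_int m - of_int n * \<tau>"
    have "of_int n \<le> Im z / Im \<tau>" "Im z / Im \<tau> < of_int n + 1"
      unfolding n_def by linarith+
    hence "\<bar>Im u\<bar> \<le> Im \<tau>" using \<tau> by (simp add: u_def field_simps)
    moreover have "\<bar>Re u\<bar> \<le> 1"
      using floor_correct[of "Re (z - of_int n * \<tau>)"] unfolding m_def[symmetric] by (simp add: u_def)
    ultimately have "u \<in> cball 0 (1 + Im \<tau>)" using cmod_le[of u] by simp
    moreover have "h z = h u" using shift[of u m n] by (simp add: u_def)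
    ultimately show "h z \<in> h ` cball 0 (1 + Im \<tau>)" by (intro image_eqI)
  qed
  ultimately have "bounded (range h)" using bounded_subset by blast
  then obtain c where c: "\<And>z. h z = c"
    using Liouville_theorem[OF h] by (auto simp: constant_on_def)
  have "f z = c * g z" for z
  proof (cases "g z = 0")
    case True
    then obtain m n where mn: "z = of_int m + of_int n * \<tau>" using g_zero by blast
    have "(f (0 + of_int m + of_int n * \<tau>) = 0) = (f 0 = 0)"
      by (rule lattice_periodic[of "\<lambda>z. f z = 0"]) (use ab in \<open>auto simp: f1 f\<tau>\<close>)
    thus ?thesis using True 0 mn by simp
  next
    case False
    thus ?thesis using c[of z] by (auto simp: h_def field_simps)
  qed
  thus ?thesis by (rule that)
qed

section \<open>Jacobi's theta function and its inversion\<close>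

text \<open>Jacobi's odd theta function in product form, divided by i q^(1/8)
  \<open>qpoch q q\<close>. In this normalisation the derivative at 0 contains
  \<open>qpoch q q ^ 2\<close>, which is how eta enters.\<close>

definition theta :: "complex \<Rightarrow> complex \<Rightarrow> complex" where
  "theta \<tau> z = exp (- (\<i> * pi * z)) * qpoch (q_of z) (q_of \<tau>) * qpoch (q_of \<tau> / q_of z) (q_of \<tau>)"

lemma theta_holomorphic:
  assumes "Im \<tau> > 0" "f holomorphic_on A" "open A"
  shows "(\<lambda>z. theta \<tau> (f z)) holomorphic_on A"
  unfolding theta_def
  by (intro holomorphic_intros assms) (use assms in \<open>auto simp: norm_q_of_less_1\<close>)

lemma theta_plus_1: "theta \<tau> (z + 1) = - theta \<tau> z"
proof -
  have "q_of 1 = 1" by (simp add: q_of_eq_1_iff)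
  moreover have "exp (- (\<i> * pi * (z + 1))) = - exp (- (\<i> * pi * z))"
    by (simp add: distrib_left exp_minus exp_diff)
  ultimately show ?thesis by (simp add: theta_def q_of_add)
qed

lemma theta_plus_tau:
  assumes "Im \<tau> > 0"
  shows "theta \<tau> (z + \<tau>) = - exp (- (\<i> * pi * (2 * z + \<tau>))) * theta \<tau> z"
proof -
  define w q where "w = q_of z" and "q = q_of \<tau>"
  have [simp]: "w \<noteq> 0" "q \<noteq> 0" by (simp_all add: w_def q_def)
  have q: "norm q < 1" using assms by (simp add: q_def norm_q_of_less_1)
  have w: "exp (- (\<i> * pi * (2 * z + \<tau>))) = exp (- (\<i> * pi * \<tau>)) / w"
    unfolding w_def divide_inverse q_of_minus[symmetric]
    unfolding q_of_def exp_add[symmetric]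
    by (rule arg_cong[of _ _ exp]) (simp add: algebra_simps)
  have "theta \<tau> (z + \<tau>) = exp (- (\<i> * pi * \<tau>)) * exp (- (\<i> * pi * z)) * qpoch (w * q) q * qpoch (1 / w) q"
    by (simp add: theta_def q_of_add w_def[symmetric] q_def[symmetric] distrib_left exp_diff exp_minus field_simps)
  also have "qpoch (1 / w) q = (1 - 1 / w) * qpoch (q / w) q"
    using qpoch_rec[OF q, of "1 / w"] by simp
  finally have 1: "theta \<tau> (z + \<tau>) =
      exp (- (\<i> * pi * \<tau>)) * exp (- (\<i> * pi * z)) * qpoch (w * q) q * ((1 - 1 / w) * qpoch (q / w) q)" .
  have 2: "theta \<tau> z = exp (- (\<i> * pi * z)) * ((1 - w) * qpoch (w * q) q) * qpoch (q / w) q"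
    unfolding theta_def w_def[symmetric] q_def[symmetric] using qpoch_rec[OF q, of w] by simp
  show ?thesis unfolding w 1 2 by (simp add: field_simps)
qed

lemma theta_0 [simp]: "Im \<tau> > 0 \<Longrightarrow> theta \<tau> 0 = 0"
  using qpoch_rec[of "q_of \<tau>" 1] by (simp add: theta_def q_of_def norm_q_of_less_1[unfolded q_of_def])

lemma theta_minus:
  assumes "Im \<tau> > 0"
  shows "theta \<tau> (- z) = - theta \<tau> z"
proof -
  define w q where "w = q_of z" and "q = q_of \<tau>"
  have [simp]: "w \<noteq> 0" "q \<noteq> 0" by (simp_all add: w_def q_def)
  have q: "norm q < 1" using assms by (simp add: q_def norm_q_of_less_1)
  have w: "exp (\<i> * pi * z) = w * exp (- (\<i> * pi * z))"
    by (simp add: w_def q_of_def exp_add[symmetric] algebra_simps)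
  have "theta \<tau> (- z) = exp (\<i> * pi * z) * qpoch (1 / w) q * qpoch (w * q) q"
    by (simp add: theta_def q_of_minus w_def[symmetric] q_def[symmetric] divide_inverse mult_ac)
  also have "qpoch (1 / w) q = (1 - 1 / w) * qpoch (q / w) q"
    using qpoch_rec[OF q, of "1 / w"] by simp
  finally have 1: "theta \<tau> (- z) = w * exp (- (\<i> * pi * z)) * ((1 - 1 / w) * qpoch (q / w) q) * qpoch (w * q) q"
    unfolding w .
  have 2: "theta \<tau> z = exp (- (\<i> * pi * z)) * ((1 - w) * qpoch (w * q) q) * qpoch (q / w) q"
    unfolding theta_def w_def[symmetric] q_def[symmetric] using qpoch_rec[OF q, of w] by simp
  show ?thesis unfolding 1 2 by (simp add: field_simps)
qed

lemma theta_zeros: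
  assumes "Im \<tau> > 0" "theta \<tau> z = 0"
  shows "\<exists>m n. z = of_int m + of_int n * \<tau>"
proof -
  have q: "norm (q_of \<tau>) < 1" using assms by (simp add: norm_q_of_less_1)
  have "qpoch (q_of z) (q_of \<tau>) = 0 \<or> qpoch (q_of \<tau> / q_of z) (q_of \<tau>) = 0"
    using assms(2) by (simp add: theta_def)
  then obtain n :: nat where "q_of z * q_of \<tau> ^ n = 1 \<or> q_of \<tau> / q_of z * q_of \<tau> ^ n = 1"
    unfolding qpoch_eq_0_iff[OF q] by blast
  hence "q_of (z + of_nat n * \<tau>) = 1 \<or> q_of (of_nat (Suc n) * \<tau> - z) = 1"
    by (simp add: q_of_add q_of_diff q_of_mult_nat del: of_nat_Suc)
  hence "z + of_nat n * \<tau> \<in> \<int> \<or> of_nat (Suc n) * \<tau> - z \<in> \<int>" by (simp only: q_of_eq_1_iff)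
  thus ?thesis
  proof
    assume "z + of_nat n * \<tau> \<in> \<int>"
    then obtain m where "z + of_nat n * \<tau> = of_int m" by (elim Ints_cases)
    thus ?thesis by (intro exI[of _ m] exI[of _ "- int n"]) (simp add: algebra_simps)
  next
    assume "of_nat (Suc n) * \<tau> - z \<in> \<int>"
    then obtain m where "of_nat (Suc n) * \<tau> - z = of_int m" by (elim Ints_cases)
    thus ?thesis by (intro exI[of _ "- m"] exI[of _ "int (Suc n)"]) (simp add: algebra_simps)
  qed
qed

lemma deriv_theta_0:
  assumes "Im \<tau> > 0"
  shows "(theta \<tau> has_field_derivative (- 2 * pi * \<i> * qpoch (q_of \<tau>) (q_of \<tau>) ^ 2)) (at 0)"
proof -
  define q where "q = q_of \<tau>"
  have q: "norm q < 1" using assms by (simp add: q_def norm_q_of_less_1)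
  define K where "K z = exp (- (\<i> * pi * z)) * qpoch (q_of z * q) q * qpoch (q / q_of z) q" for z
  have K: "K holomorphic_on UNIV"
    unfolding K_def by (intro holomorphic_intros) (use q in auto)
  have eq: "theta \<tau> = (\<lambda>z. (1 - q_of z) * K z)"
  proof
    fix z show "theta \<tau> z = (1 - q_of z) * K z"
      unfolding theta_def K_def q_def[symmetric] by (subst qpoch_rec[OF q, of "q_of z"]) simp
  qed
  have "(K has_field_derivative deriv K 0) (at 0)"
    by (rule holomorphic_derivI[OF K open_UNIV UNIV_I])
  moreover have "K 0 = qpoch q q ^ 2" by (simp add: K_def q_of_def power2_eq_square)
  moreover have "((\<lambda>z. 1 - q_of z) has_field_derivative - (2 * pi * \<i>)) (at 0)"
    unfolding q_of_def by (auto intro!: derivative_eq_intros)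
  ultimately have "((\<lambda>z. (1 - q_of z) * K z) has_field_derivative
      - (2 * pi * \<i>) * qpoch q q ^ 2 + deriv K 0 * (1 - q_of 0)) (at 0)"
    using DERIV_mult[of "\<lambda>z. 1 - q_of z" "- (2 * pi * \<i>)" 0 UNIV K "deriv K 0"] by simp
  thus ?thesis unfolding eq q_def[symmetric] by (simp add: q_of_def)
qed

lemma Im_inversion: "Im (- 1 / \<tau>) = Im \<tau> / (cmod \<tau>)\<^sup>2"
  by (simp add: Im_divide cmod_power2)

lemma Im_inversion_pos: "Im \<tau> > 0 \<Longrightarrow> Im (- 1 / \<tau>) > 0"
  unfolding Im_inversion by (intro divide_pos_pos) auto

lemma exp_half_pi_i [simp]: "exp (\<i> * pi / 2) = \<i>" "exp (- (\<i> * pi / 2)) = - \<i>"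
proof -
  show "exp (\<i> * pi / 2) = \<i>"
    using exp_Euler[of "of_real pi / 2"] by (simp add: cos_of_real sin_of_real)
  thus "exp (- (\<i> * pi / 2)) = - \<i>" by (simp add: exp_minus)
qed

text \<open>With q = r^2 the three values are elementary factors times the squares of
  \<open>qpoch (-q) q\<close>, \<open>qpoch r q\<close> and \<open>qpoch (-r) q\<close>, and the
  product of these three is 1 by Euler's identity. All infinite products disappear, which makes the
  constant of the inversion formula computable.\<close>

lemma theta_half_periods:
  assumes \<tau>: "Im \<tau> > 0"
  shows "theta \<tau> (1 / 2) * theta \<tau> (\<tau> / 2) * theta \<tau> ((1 + \<tau>) / 2) = - 2 * exp (- (\<i> * pi * \<tau>))"
proof -
  define r where "r = q_of (\<tau> / 2)"
  have r2: "q_of \<tau> = r\<^sup>2" using q_of_add[of "\<tau> / 2" "\<tau> / 2"] by (simp add: r_def power2_eq_square)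
  have r0: "r \<noteq> 0" by (simp add: r_def)
  have r: "norm r < 1" unfolding r_def using \<tau> by (intro norm_q_of_less_1) simp
  have r2': "norm (r\<^sup>2) < 1" using r2 \<tau> norm_q_of_less_1 by metis
  have half: "q_of (1 / 2) = - 1" by (simp add: q_of_def)
  have half': "q_of ((1 + \<tau>) / 2) = - r" by (simp add: add_divide_distrib q_of_add half r_def)
  have 1: "theta \<tau> (1 / 2) = - \<i> * (2 * qpoch (- r\<^sup>2) (r\<^sup>2) ^ 2)"
    using qpoch_rec[OF r2', of "-1"] by (simp add: theta_def half r2 power2_eq_square)
  have rr: "r\<^sup>2 / r = r" using r0 by (simp add: power2_eq_square)
  have 2: "theta \<tau> (\<tau> / 2) = exp (- (\<i> * pi * \<tau> / 2)) * qpoch r (r\<^sup>2) ^ 2"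
    by (simp add: theta_def r_def[symmetric] r2 rr power2_eq_square)
  have "exp (- (\<i> * pi * ((1 + \<tau>) / 2))) = exp (- (\<i> * pi / 2)) * exp (- (\<i> * pi * \<tau> / 2))"
    unfolding exp_add[symmetric] by (rule arg_cong[of _ _ exp]) (simp add: field_simps)
  hence 3: "theta \<tau> ((1 + \<tau>) / 2) = - \<i> * exp (- (\<i> * pi * \<tau> / 2)) * qpoch (- r) (r\<^sup>2) ^ 2"
    by (simp add: theta_def half' r2 rr power2_eq_square mult_ac)
  have e: "exp (- (\<i> * pi * \<tau> / 2)) * exp (- (\<i> * pi * \<tau> / 2)) = exp (- (\<i> * pi * \<tau>))"
    unfolding exp_add[symmetric] by (rule arg_cong[of _ _ exp]) (simp add: field_simps)
  have "qpoch (- r\<^sup>2) (r\<^sup>2) * (qpoch r (r\<^sup>2) * qpoch (- r) (r\<^sup>2)) = 1"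
    using qpoch_mult_neg[OF r2', of r] qpoch_euler[OF r2'] by simp
  moreover have "theta \<tau> (1 / 2) * theta \<tau> (\<tau> / 2) * theta \<tau> ((1 + \<tau>) / 2) =
      - 2 * (exp (- (\<i> * pi * \<tau> / 2)) * exp (- (\<i> * pi * \<tau> / 2))) *
      (qpoch (- r\<^sup>2) (r\<^sup>2) * (qpoch r (r\<^sup>2) * qpoch (- r) (r\<^sup>2))) ^ 2"
    unfolding 1 2 3 power_mult_distrib by (simp add: algebra_simps)
  ultimately show ?thesis by (simp add: e)
qed

text \<open>Under the two periods both sides of the last equation acquire the same factors, the
  Gaussian absorbing the difference, so they are proportional. The derivative at 0 relates c to
  \<open>qpoch q q ^ 2\<close>. The inversion permutes the half-periods, so multiplying the three
  equations there gives c^3, but not c itself.\<close>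

theorem theta_inversion:
  assumes \<tau>: "Im \<tau> > 0"
  obtains c where "c ^ 3 = \<i> * exp (\<i> * pi * (\<tau> + 1 / \<tau>) / 2)"
    "c * \<tau> * qpoch (q_of \<tau>) (q_of \<tau>) ^ 2 = qpoch (q_of (- 1 / \<tau>)) (q_of (- 1 / \<tau>)) ^ 2"
    "\<And>z. exp (- (\<i> * pi * z\<^sup>2 / \<tau>)) * theta (- 1 / \<tau>) (z / \<tau>) = c * theta \<tau> z"
proof -
  define \<sigma> where "\<sigma> = - 1 / \<tau>"
  have [simp]: "\<tau> \<noteq> 0" using \<tau> by auto
  have \<sigma>: "Im \<sigma> > 0" unfolding \<sigma>_def by (rule Im_inversion_pos[OF \<tau>])
  define E where "E z = exp (- (\<i> * pi * z\<^sup>2 / \<tau>))" for z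
  define G where "G z = E z * theta \<sigma> (z / \<tau>)" for z
  have hol: "theta \<tau> holomorphic_on UNIV"
    using theta_holomorphic[OF \<tau>, of "\<lambda>z. z" UNIV] by (simp add: holomorphic_intros)
  have G: "G holomorphic_on UNIV"
    unfolding G_def E_def by (intro holomorphic_intros theta_holomorphic \<sigma>) auto
  have G1: "G (z + 1) = - 1 * G z" for z
  proof -
    have "theta \<sigma> (z / \<tau>) = - exp (- (\<i> * pi * (2 * (z / \<tau> - \<sigma>) + \<sigma>))) * theta \<sigma> (z / \<tau> - \<sigma>)"
      using theta_plus_tau[OF \<sigma>, of "z / \<tau> - \<sigma>"] by simp
    moreover have "z / \<tau> - \<sigma> = (z + 1) / \<tau>" by (simp add: \<sigma>_def field_simps)
    ultimately have "G z = - (E z * exp (- (\<i> * pi * (2 * ((z + 1) / \<tau>) + \<sigma>)))) * theta \<sigma> ((z + 1) / \<tau>)"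
      by (simp add: G_def)
    also have "E z * exp (- (\<i> * pi * (2 * ((z + 1) / \<tau>) + \<sigma>))) = E (z + 1)"
      unfolding E_def exp_add[symmetric]
      by (rule arg_cong[of _ _ exp]) (simp add: \<sigma>_def field_simps power2_eq_square)
    finally show ?thesis by (simp add: G_def)
  qed
  have G\<tau>: "G (z + \<tau>) = - exp (- (\<i> * pi * (2 * z + \<tau>))) * G z" for z
  proof -
    have "E (z + \<tau>) = exp (- (\<i> * pi * (2 * z + \<tau>))) * E z"
      unfolding E_def exp_add[symmetric]
      by (rule arg_cong[of _ _ exp]) (simp add: field_simps power2_eq_square)
    thus ?thesis using theta_plus_1[of \<sigma> "z / \<tau>"] by (simp add: G_def add_divide_distrib)
  qed
  have q: "norm (q_of \<tau>) < 1" using \<tau> by (simp add: norm_q_of_less_1)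
  have d: "deriv (theta \<tau>) 0 = - 2 * pi * \<i> * qpoch (q_of \<tau>) (q_of \<tau>) ^ 2"
    by (intro DERIV_imp_deriv deriv_theta_0 \<tau>)
  obtain c where c: "\<And>z. G z = c * theta \<tau> z"
    by (rule quasi_periodic_proportional[OF \<tau> G hol G1 G\<tau>, of thesis])
      (use theta_plus_1 theta_plus_tau[OF \<tau>] theta_zeros[OF \<tau>] \<tau> \<sigma> qpoch_self_nz[OF q] in \<open>auto simp: d G_def\<close>)
  have 0: "exp (- (\<i> * pi * z\<^sup>2 / \<tau>)) * theta (- 1 / \<tau>) (z / \<tau>) = c * theta \<tau> z" for z
    using c[of z] by (simp add: G_def E_def \<sigma>_def)
  have "((\<lambda>z. E z * theta \<sigma> (z / \<tau>)) has_field_derivative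
      - 2 * pi * \<i> * qpoch (q_of \<sigma>) (q_of \<sigma>) ^ 2 / \<tau>) (at 0)"
    unfolding E_def using deriv_theta_0[OF \<sigma>] \<sigma>
    by (auto intro!: derivative_eq_intros DERIV_chain2[of "theta \<sigma>"])
  moreover have "((\<lambda>z. E z * theta \<sigma> (z / \<tau>)) has_field_derivative
      c * (- 2 * pi * \<i> * qpoch (q_of \<tau>) (q_of \<tau>) ^ 2)) (at 0)"
    using DERIV_cmult[OF deriv_theta_0[OF \<tau>], of c] c by (simp add: G_def)
  ultimately have "- 2 * pi * \<i> * qpoch (q_of \<sigma>) (q_of \<sigma>) ^ 2 / \<tau> =
      c * (- 2 * pi * \<i> * qpoch (q_of \<tau>) (q_of \<tau>) ^ 2)" by (rule DERIV_unique)
  hence 2: "c * \<tau> * qpoch (q_of \<tau>) (q_of \<tau>) ^ 2 = qpoch (q_of \<sigma>) (q_of \<sigma>) ^ 2"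
    by (simp add: field_simps)
  \<comment> \<open>Division by \<tau> sends the half-periods 1/2, \<tau>/2, (1 + \<tau>)/2 to
    -\<sigma>/2, 1/2, (1 - \<sigma>)/2. Oddness of theta yields one minus sign in the first case; in
    the third it cancels against the sign of the shift by 1.\<close>
  have "1 / 2 / \<tau> = - (\<sigma> / 2)" by (simp add: \<sigma>_def)
  hence g1: "c * theta \<tau> (1 / 2) = - (E (1 / 2) * theta \<sigma> (\<sigma> / 2))"
    using c[of "1 / 2"] theta_minus[OF \<sigma>, of "\<sigma> / 2"] by (simp only: G_def) simp
  have g2: "c * theta \<tau> (\<tau> / 2) = E (\<tau> / 2) * theta \<sigma> (1 / 2)"
    using c[of "\<tau> / 2"] by (simp add: G_def)
  have "theta \<sigma> (1 / 2 - \<sigma> / 2) = theta \<sigma> ((1 + \<sigma>) / 2)"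
    using theta_plus_1[of \<sigma> "- ((1 + \<sigma>) / 2)"] theta_minus[OF \<sigma>, of "(1 + \<sigma>) / 2"]
    by (simp add: field_simps)
  moreover have "(1 + \<tau>) / 2 / \<tau> = 1 / 2 - \<sigma> / 2" by (simp add: \<sigma>_def field_simps)
  ultimately have g3: "c * theta \<tau> ((1 + \<tau>) / 2) = E ((1 + \<tau>) / 2) * theta \<sigma> ((1 + \<sigma>) / 2)"
    using c[of "(1 + \<tau>) / 2"] by (simp add: G_def)
  have cancel: "x * u = - (y * v)" if "x * (- 2 * u) = - y * (- 2 * v)" for x y u v :: complex
    using that by algebra
  have "c ^ 3 * (theta \<tau> (1 / 2) * theta \<tau> (\<tau> / 2) * theta \<tau> ((1 + \<tau>) / 2)) =
     (c * theta \<tau> (1 / 2)) * (c * theta \<tau> (\<tau> / 2)) * (c * theta \<tau> ((1 + \<tau>) / 2))"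
    by (simp add: power3_eq_cube)
  also have "\<dots> = - (E (1 / 2) * E (\<tau> / 2) * E ((1 + \<tau>) / 2)) *
      (theta \<sigma> (1 / 2) * theta \<sigma> (\<sigma> / 2) * theta \<sigma> ((1 + \<sigma>) / 2))"
    unfolding g1 g2 g3 by simp
  finally have c3: "c ^ 3 * exp (- (\<i> * pi * \<tau>)) =
      - (E (1 / 2) * E (\<tau> / 2) * E ((1 + \<tau>) / 2) * exp (- (\<i> * pi * \<sigma>)))"
    unfolding theta_half_periods[OF \<tau>] theta_half_periods[OF \<sigma>] by (rule cancel)
  have "c ^ 3 = c ^ 3 * exp (- (\<i> * pi * \<tau>)) * exp (\<i> * pi * \<tau>)" by (simp add: exp_minus)
  also have "\<dots> = - (E (1 / 2) * E (\<tau> / 2) * E ((1 + \<tau>) / 2) * exp (- (\<i> * pi * \<sigma>)) * exp (\<i> * pi * \<tau>))"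
    unfolding c3 by simp
  also have "E (1 / 2) * E (\<tau> / 2) * E ((1 + \<tau>) / 2) * exp (- (\<i> * pi * \<sigma>)) * exp (\<i> * pi * \<tau>) =
      exp (- (\<i> * pi / 2)) * exp (\<i> * pi * (\<tau> + 1 / \<tau>) / 2)"
    unfolding E_def exp_add[symmetric]
    by (rule arg_cong[of _ _ exp]) (simp add: \<sigma>_def field_simps power2_eq_square)
  finally have 1: "c ^ 3 = \<i> * exp (\<i> * pi * (\<tau> + 1 / \<tau>) / 2)" by simp
  show thesis by (rule that[OF 1 2[unfolded \<sigma>_def] 0])
qed

section \<open>Inversion of the sixth power of eta\<close>

lemma dedekind_eta_altdef:
  "dedekind_eta \<tau> = exp (2 * of_real pi * \<i> * \<tau> / 24) * qpoch (q_of \<tau>) (q_of \<tau>)"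
  by (simp add: dedekind_eta_def qpoch_def)

text \<open>The sixth power contains the cube of \<open>qpoch q q ^ 2\<close>, so knowing c^3
  suffices and no cube root has to be chosen.\<close>

theorem dedekind_eta_inversion:
  assumes \<tau>: "Im \<tau> > 0"
  shows "dedekind_eta (- 1 / \<tau>) ^ 6 = \<i> * \<tau> ^ 3 * dedekind_eta \<tau> ^ 6"
proof -
  have [simp]: "\<tau> \<noteq> 0" using \<tau> by auto
  obtain c where c: "c ^ 3 = \<i> * exp (\<i> * pi * (\<tau> + 1 / \<tau>) / 2)"
    "c * \<tau> * qpoch (q_of \<tau>) (q_of \<tau>) ^ 2 = qpoch (q_of (- 1 / \<tau>)) (q_of (- 1 / \<tau>)) ^ 2"
    by (rule theta_inversion[OF \<tau>])
  have e6: "dedekind_eta t ^ 6 = exp (\<i> * pi * t / 2) * (qpoch (q_of t) (q_of t) ^ 2) ^ 3" for t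
    by (simp add: dedekind_eta_altdef power_mult_distrib power_mult[symmetric] exp_of_nat_mult[symmetric] field_simps)
  have "exp (\<i> * pi * (- 1 / \<tau>) / 2) * exp (\<i> * pi * (\<tau> + 1 / \<tau>) / 2) = exp (\<i> * pi * \<tau> / 2)"
    unfolding exp_add[symmetric] by (rule arg_cong[of _ _ exp]) (simp add: field_simps)
  thus ?thesis unfolding e6 c(2)[symmetric] power_mult_distrib c(1) by simp
qed

subsection \<open>Inversion of the Eisenstein series\<close>

text \<open>At \<open>n = 0\<close> the coefficient is \<open>inverse 0 = 0\<close>.\<close>

definition lambert :: "nat \<Rightarrow> complex \<Rightarrow> complex \<Rightarrow> complex" where
  "lambert j q w = (\<Sum>n. of_nat n ^ j * inverse (of_nat n * (1 - q ^ n)) * w ^ n)"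

lemma one_minus_power_nz:
  fixes q :: complex
  assumes "norm q < 1" "n > 0"
  shows "1 - q ^ n \<noteq> 0"
proof
  assume "1 - q ^ n = 0"
  hence "norm q ^ n = 1" by (metis norm_one norm_power right_minus_eq)
  thus False using assms by (metis less_irrefl norm_ge_zero power_less_one_iff)
qed

lemma lambert_summable:
  fixes q w :: complex
  assumes "norm q < 1" "norm w < 1"
  shows "summable (\<lambda>n. of_nat n ^ j * inverse (of_nat n * (1 - q ^ n)) * w ^ n)"
  using assms(2)
proof (induction j arbitrary: w)
  case 0
  have 1: "summable (\<lambda>n. inverse (1 - norm q) * norm w ^ n)"
    using 0 by (intro summable_mult summable_geometric) simp
  have 2: "norm (of_nat n ^ 0 * inverse (of_nat n * (1 - q ^ n)) * w ^ n) \<le> inverse (1 - norm q) * norm w ^ n" for n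
  proof (cases "n = 0")
    case True
    thus ?thesis using assms by simp
  next
    case False
    have "norm q ^ n \<le> norm q" using False assms power_decreasing[of 1 n "norm q"] by simp
    hence "1 - norm q \<le> norm (1 - q ^ n)"
      using norm_triangle_ineq2[of 1 "q ^ n"] by (simp add: norm_power)
    also have "\<dots> \<le> real n * norm (1 - q ^ n)"
      using False mult_right_mono[of 1 "real n" "norm (1 - q ^ n)"] by simp
    finally have "inverse (norm (of_nat n * (1 - q ^ n))) \<le> inverse (1 - norm q)"
      using assms by (intro le_imp_inverse_le) (simp_all add: norm_mult)
    hence "inverse (norm (of_nat n * (1 - q ^ n))) * norm w ^ n \<le> inverse (1 - norm q) * norm w ^ n"
      by (intro mult_right_mono) auto
    thus ?thesis by (simp only: norm_inverse norm_mult norm_power power_0 mult_1 norm_one)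
  qed
  show ?case by (rule summable_comparison_test'[OF 1 2])
next
  case (Suc j)
  define c where "c n = of_nat n ^ j * inverse (of_nat n * (1 - q ^ n))" for n
  have "summable (\<lambda>n. diffs c n * w ^ n)"
    by (rule termdiff_converges[OF Suc.prems]) (use Suc.IH in \<open>simp add: c_def\<close>)
  hence "summable (\<lambda>n. w * (diffs c n * w ^ n))" by (rule summable_mult)
  hence "summable (\<lambda>n. of_nat (Suc n) * c (Suc n) * w ^ Suc n)"
    by (simp add: diffs_def mult_ac)
  hence "summable (\<lambda>n. of_nat n * c n * w ^ n)" by (subst (asm) summable_Suc_iff)
  thus ?case by (simp add: c_def mult_ac)
qed

text \<open>The operator w d/dw multiplies the n-th term by n, so \<open>j\<close> counts how often
  it has been applied.\<close>

lemma lambert_deriv: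
  assumes "norm q < 1" "norm w < 1" "w \<noteq> 0"
  shows "(lambert j q has_field_derivative lambert (Suc j) q w / w) (at w)"
proof -
  define c where "c n = of_nat n ^ j * inverse (of_nat n * (1 - q ^ n))" for n
  have "((\<lambda>w. \<Sum>n. c n * w ^ n) has_field_derivative (\<Sum>n. diffs c n * w ^ n)) (at w)"
    by (rule termdiffs_strong'[OF _ assms(2)]) (use lambert_summable[OF assms(1)] in \<open>simp add: c_def\<close>)
  moreover have "(\<lambda>w. \<Sum>n. c n * w ^ n) = lambert j q" by (simp add: lambert_def c_def fun_eq_iff)
  moreover have "(\<Sum>n. diffs c n * w ^ n) = lambert (Suc j) q w / w"
  proof -
    have s: "summable (\<lambda>n. diffs c n * w ^ n)"
      by (rule termdiff_converges[OF assms(2)]) (use lambert_summable[OF assms(1)] in \<open>simp add: c_def\<close>)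
    have "lambert (Suc j) q w = (\<Sum>n. of_nat n * c n * w ^ n)"
      by (simp add: lambert_def c_def mult_ac)
    also have "\<dots> = (\<Sum>n. of_nat (Suc n) * c (Suc n) * w ^ Suc n)"
      using suminf_split_head[of "\<lambda>n. of_nat n * c n * w ^ n"] lambert_summable[OF assms(1,2), of "Suc j"]
      by (simp add: c_def mult_ac)
    also have "\<dots> = (\<Sum>n. w * (diffs c n * w ^ n))" by (simp add: diffs_def mult_ac)
    also have "\<dots> = w * (\<Sum>n. diffs c n * w ^ n)" using s by (rule suminf_mult)
    finally show ?thesis using assms by simp
  qed
  ultimately show ?thesis by (simp only:)
qed

text \<open>Both sides satisfy \<open>f w = (1 - w) * f (w * q)\<close>, so their quotient is invariant under
  \<open>w \<mapsto> w * q\<close> and equals its value at \<open>0\<close>.\<close>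

lemma qpoch_eq_exp_lambert:
  assumes q: "norm q < 1" and w: "norm w < 1"
  shows "qpoch w q = exp (- lambert 0 q w)"
proof -
  define r where "r w = qpoch w q * exp (lambert 0 q w)" for w
  have rec: "r w = r (w * q)" if w: "norm w < 1" for w
  proof -
    have wq: "norm (w * q) < 1"
      using w q mult_strict_mono'[of "norm w" 1 "norm q" 1] by (simp add: norm_mult)
    have "(\<lambda>n. of_nat n ^ 0 * inverse (of_nat n * (1 - q ^ n)) * w ^ n -
        of_nat n ^ 0 * inverse (of_nat n * (1 - q ^ n)) * (w * q) ^ n) sums
        (lambert 0 q w - lambert 0 q (w * q))"
      unfolding lambert_def by (intro sums_diff summable_sums lambert_summable q w wq)
    \<comment> \<open>The factor \<open>1 - q ^ n\<close> cancels and the series of - ln (1 - w)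
      remains; its term at n = 0 is 0 by division by zero.\<close>
    moreover have "of_nat n ^ 0 * inverse (of_nat n * (1 - q ^ n)) * w ^ n -
        of_nat n ^ 0 * inverse (of_nat n * (1 - q ^ n)) * (w * q) ^ n = w ^ n / of_nat n" for n
    proof (cases "n = 0")
      case False
      have "of_nat n ^ 0 * inverse (of_nat n * (1 - q ^ n)) * w ^ n -
          of_nat n ^ 0 * inverse (of_nat n * (1 - q ^ n)) * (w * q) ^ n =
          inverse (of_nat n * (1 - q ^ n)) * w ^ n * (1 - q ^ n)"
        by (simp add: algebra_simps power_mult_distrib)
      also have "\<dots> = w ^ n / of_nat n"
        using one_minus_power_nz[OF q, of n] False by (simp add: divide_inverse)
      finally show ?thesis .
    qed simp
    ultimately have "(\<lambda>n. w ^ n / of_nat n) sums (lambert 0 q w - lambert 0 q (w * q))" by simp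
    hence "(\<lambda>n. - (w ^ n / of_nat n)) sums - (lambert 0 q w - lambert 0 q (w * q))" by (rule sums_minus)
    moreover have "(\<lambda>n. - (w ^ n / of_nat n)) sums ln (1 - w)"
      using Ln_series'[of "- w"] w by simp
    ultimately have "ln (1 - w) = - (lambert 0 q w - lambert 0 q (w * q))" by (rule sums_unique2[symmetric])
    moreover have "1 - w \<noteq> 0" using w by auto
    ultimately have "1 - w = exp (- (lambert 0 q w - lambert 0 q (w * q)))" by (metis exp_Ln)
    hence "(1 - w) * exp (lambert 0 q w) = exp (lambert 0 q (w * q))"
      by (simp add: exp_diff)
    thus ?thesis unfolding r_def using qpoch_rec[OF q, of w] by (simp add: mult_ac)
  qed
  have wqn: "norm (w * q ^ n) < 1" for n
  proof -
    have "norm w * norm q ^ n \<le> norm w * 1"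
      using q by (intro mult_left_mono power_le_one) auto
    thus ?thesis using w by (simp add: norm_mult norm_power)
  qed
  have rn: "r (w * q ^ n) = r w" for n
    by (induction n) (use rec[OF wqn] in \<open>auto simp: mult_ac\<close>)
  have "(\<lambda>w. lambert 0 q w) holomorphic_on ball 0 1"
    unfolding lambert_def
    by (rule holomorphic_on_subset[of _ "ball 0 1"], rule power_series_holomorphic[of 0 1])
      (use lambert_summable[OF q, of _ 0] in \<open>auto simp: summable_sums lambert_def\<close>)
  hence "r holomorphic_on ball 0 1"
    unfolding r_def by (intro holomorphic_intros) (use q in auto)
  hence "isCont r 0"
    using holomorphic_on_imp_continuous_on continuous_on_eq_continuous_at[of "ball 0 1"] by fastforce
  moreover have "(\<lambda>n. w * q ^ n) \<longlonglongrightarrow> 0"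
    using tendsto_mult[OF tendsto_const LIMSEQ_power_zero[OF q], of w] by simp
  ultimately have "(\<lambda>n. r (w * q ^ n)) \<longlonglongrightarrow> r 0" by (rule isCont_tendsto_compose)
  hence "r w = r 0" unfolding rn by (simp add: LIMSEQ_const_iff)
  also have "r 0 = 1"
  proof -
    have "(\<Sum>n. inverse (of_nat n * (1 - q ^ n)) * 0 ^ n) = (\<Sum>n. (0::complex))"
      by (intro suminf_cong) (auto simp: power_0_left)
    thus ?thesis by (simp add: r_def lambert_def)
  qed
  finally show ?thesis by (simp add: r_def exp_minus field_simps)
qed

text \<open>Expanding q^n / (1 - q^n) as a geometric series gives the double series of n^3 q^(n m),
  which is regrouped by the product n m. The index is 4 and not 3 because \<open>lambert\<close>
  carries an extra factor 1/n.\<close>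

lemma lambert_divisor_sum:
  assumes q: "norm q < 1"
  shows "(\<lambda>n. of_nat (\<Sum>d | d dvd Suc n. d ^ 3) * q ^ Suc n) sums lambert 4 q q"
proof -
  define g where "g q n = of_nat (Suc n) ^ 3 * (q ^ Suc n / (1 - q ^ Suc n))" for q :: complex and n
  have g_term: "of_nat (Suc n) ^ 4 * inverse (of_nat (Suc n) * (1 - q ^ Suc n)) * q ^ Suc n = g q n"
    if "norm q < 1" for q n
  proof -
    have "of_nat (Suc n) ^ 4 * inverse (of_nat (Suc n)) = (of_nat (Suc n) ^ 3 :: complex)"
      by (simp add: power4_eq_xxxx power3_eq_cube del: of_nat_Suc)
    thus ?thesis by (simp add: g_def divide_inverse mult_ac del: of_nat_Suc power_Suc)
  qed
  have norm_g: "summable (\<lambda>n. norm (g q n))" if q: "norm q < 1" for q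
  proof -
    obtain x where x: "norm q < x" "x < 1" using q dense by blast
    have "norm q < norm (of_real x :: complex)" using x by simp
    from powser_insidea[OF lambert_summable[OF q, of "of_real x" 4] this]
    have "summable (\<lambda>n. norm (of_nat n ^ 4 * inverse (of_nat n * (1 - q ^ n)) * q ^ n))"
      using x norm_ge_zero[of q] by simp
    hence "summable (\<lambda>n. norm (of_nat (Suc n) ^ 4 * inverse (of_nat (Suc n) * (1 - q ^ Suc n)) * q ^ Suc n))"
      by (subst summable_Suc_iff)
    thus ?thesis by (simp only: g_term[OF q])
  qed
  have g_sums: "g q sums lambert 4 q q"
  proof -
    have "(\<lambda>n. of_nat n ^ 4 * inverse (of_nat n * (1 - q ^ n)) * q ^ n) sums lambert 4 q q"
      unfolding lambert_def by (intro summable_sums lambert_summable q)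
    hence "(\<lambda>n. of_nat (Suc n) ^ 4 * inverse (of_nat (Suc n) * (1 - q ^ Suc n)) * q ^ Suc n) sums lambert 4 q q"
      by (subst sums_Suc_iff) simp
    thus ?thesis by (simp only: g_term[OF q])
  qed
  define f where "f = (\<lambda>(n, m). of_nat (Suc n) ^ 3 * (q ^ Suc n) ^ Suc m)"
  have geo: "(\<lambda>m. x ^ Suc m) sums (x / (1 - x))" if "norm x < 1" for x :: "'a :: {real_normed_field}"
    using sums_mult[OF geometric_sums[OF that], of x] by simp
  have qn: "norm (q ^ Suc n) < 1" for n
    using q unfolding norm_power by (subst power_less_one_iff) auto
  have inner: "((\<lambda>m. f (n, m)) has_sum g q n) UNIV" for n
  proof (rule norm_summable_imp_has_sum)
    have "summable (\<lambda>m. norm (q ^ Suc n) ^ Suc m)"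
      using geo[of "norm (q ^ Suc n)"] qn by (auto simp: sums_iff)
    thus "summable (\<lambda>m. norm (f (n, m)))"
      unfolding f_def prod.case norm_mult norm_power by (rule summable_mult)
    show "(\<lambda>m. f (n, m)) sums g q n"
      unfolding f_def g_def prod.case using qn by (intro sums_mult geo)
  qed
  \<comment> \<open>The inner sums of the norms are the terms of the same Lambert series at the real
    point norm q, so absolute summability of the double series reduces to
    \<open>norm_g\<close>.\<close>
  have "(\<lambda>x. norm (f x)) summable_on Sigma UNIV (\<lambda>_. UNIV)"
  proof (rule summable_on_SigmaI)
    show "((\<lambda>m. norm (f (n, m))) has_sum norm (g (of_real (norm q)) n)) UNIV" for n
    proof (rule norm_summable_imp_has_sum)
      have *: "(\<lambda>m. norm (q ^ Suc n) ^ Suc m) sums (norm (q ^ Suc n) / (1 - norm (q ^ Suc n)))"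
        using geo[of "norm (q ^ Suc n)"] qn by simp
      have "norm (1 - of_real (norm q ^ Suc n) :: complex) = 1 - norm q ^ Suc n"
        using qn[of n] norm_of_real[of "1 - norm q ^ Suc n", where 'a = complex]
        by (simp only: of_real_diff of_real_1 norm_power)
      hence "norm (g (of_real (norm q)) n) = real (Suc n) ^ 3 * (norm (q ^ Suc n) / (1 - norm (q ^ Suc n)))"
        by (simp add: g_def norm_mult norm_divide norm_power del: power_Suc of_nat_Suc flip: of_real_power)
      thus "(\<lambda>m. norm (f (n, m))) sums norm (g (of_real (norm q)) n)"
        using sums_mult[OF *, of "real (Suc n) ^ 3"]
        by (simp add: f_def norm_mult norm_power del: power_Suc of_nat_Suc)
      show "summable (\<lambda>m. norm (norm (f (n, m))))"
        using sums_summable[OF sums_mult[OF *, of "real (Suc n) ^ 3"]]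
        by (simp add: f_def norm_mult norm_power del: power_Suc of_nat_Suc)
    qed
    show "(\<lambda>n. norm (g (of_real (norm q)) n)) summable_on UNIV"
      by (rule norm_summable_imp_summable_on) (use norm_g[of "of_real (norm q)"] q in simp)
  qed auto
  hence "f summable_on Sigma UNIV (\<lambda>_. UNIV)" by (rule abs_summable_summable)
  moreover have "(g q has_sum lambert 4 q q) UNIV"
    by (rule norm_summable_imp_has_sum[OF norm_g[OF q] g_sums])
  ultimately have F: "(f has_sum lambert 4 q q) (Sigma UNIV (\<lambda>_. UNIV))"
    by (intro has_sum_SigmaI[OF inner])
  \<comment> \<open>All indices are shifted by one: a divisor d of N + 1 corresponds to the pair (d,
    (N + 1) / d) of positive factors, stored as predecessors.\<close>
  define h where "h = (\<lambda>(N, d). (d - 1, Suc N div d - 1))"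
  have bij: "bij_betw h (Sigma UNIV (\<lambda>N. {d. d dvd Suc N})) (Sigma UNIV (\<lambda>_. UNIV))"
  proof (rule bij_betwI[where g = "\<lambda>(n, m). (Suc n * Suc m - 1, Suc n)"])
    show "h \<in> (SIGMA N:UNIV. {d. d dvd Suc N}) \<rightarrow> UNIV \<times> UNIV" by auto
    show "(\<lambda>(n, m). (Suc n * Suc m - 1, Suc n)) \<in> UNIV \<times> UNIV \<rightarrow> (SIGMA N:UNIV. {d. d dvd Suc N})"
      by (auto simp del: mult_Suc mult_Suc_right)
    fix x assume "x \<in> (SIGMA N:UNIV. {d. d dvd Suc N})"
    then obtain N d where x1: "x = (N, d)" "d dvd Suc N" by auto
    then obtain k where x: "x = (N, d)" "Suc N = d * k" by (auto simp: dvd_def)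
    hence "d > 0" "k > 0" by (metis Zero_not_Suc mult_is_0 not_gr_zero)+
    thus "(\<lambda>(n, m). (Suc n * Suc m - 1, Suc n)) (h x) = x"
      using x by (auto simp: h_def simp del: mult_Suc mult_Suc_right)
  next
    fix y :: "nat \<times> nat"
    obtain n m where y: "y = (n, m)" by force
    have "Suc (Suc n * Suc m - 1) = Suc n * Suc m" by simp
    thus "h ((\<lambda>(n, m). (Suc n * Suc m - 1, Suc n)) y) = y"
      by (simp add: h_def y del: mult_Suc mult_Suc_right)
  qed
  have "((\<lambda>x. f (h x)) has_sum lambert 4 q q) (Sigma UNIV (\<lambda>N. {d. d dvd Suc N}))"
    using F by (subst has_sum_reindex_bij_betw[OF bij])
  hence "((\<lambda>n. of_nat (\<Sum>d | d dvd Suc n. d ^ 3) * q ^ Suc n) has_sum lambert 4 q q) UNIV"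
  proof (rule has_sum_SigmaD)
    fix N
    have "((\<lambda>d. f (h (N, d))) has_sum (\<Sum>d | d dvd Suc N. f (h (N, d)))) {d. d dvd Suc N}"
      by (intro has_sum_finite) auto
    also have "(\<Sum>d | d dvd Suc N. f (h (N, d))) = (\<Sum>d | d dvd Suc N. of_nat (d ^ 3) * q ^ Suc N)"
    proof (rule sum.cong[OF refl])
      fix d assume "d \<in> {d. d dvd Suc N}"
      then obtain k where k: "Suc N = d * k" by (auto simp: dvd_def)
      hence "d > 0" "k > 0" by (metis Zero_not_Suc mult_is_0 not_gr_zero)+
      thus "f (h (N, d)) = of_nat (d ^ 3) * q ^ Suc N"
        unfolding k by (simp add: h_def f_def k power_mult del: power_Suc)
    qed
    also have "\<dots> = of_nat (\<Sum>d | d dvd Suc N. d ^ 3) * q ^ Suc N"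
      by (simp add: sum_distrib_right)
    finally show "((\<lambda>d. f (h (N, d))) has_sum of_nat (\<Sum>d | d dvd Suc N. d ^ 3) * q ^ Suc N) {d. d dvd Suc N}" .
  qed
  thus ?thesis by (rule has_sum_imp_sums)
qed

lemma eisenstein_E4_eq_lambert:
  "Im \<tau> > 0 \<Longrightarrow> eisenstein_E4 \<tau> = 1 + 240 * lambert 4 (q_of \<tau>) (q_of \<tau>)"
  unfolding eisenstein_E4_def
  by (subst sums_unique[OF lambert_divisor_sum, symmetric]) (simp_all add: norm_q_of_less_1)

section \<open>Logarithmic derivatives of theta\<close>

lemma higher_deriv_chain:
  assumes S: "open S" and d: "\<And>k z. z \<in> S \<Longrightarrow> (f k has_field_derivative f (Suc k) z) (at z)"
    and z: "z \<in> S"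
  shows "(deriv ^^ n) (f 0) z = f n z"
  using z
proof (induction n arbitrary: z)
  case (Suc n)
  have "eventually (\<lambda>w. w \<in> S) (nhds z)" using S Suc.prems eventually_nhds by blast
  hence "eventually (\<lambda>w. (deriv ^^ n) (f 0) w = f n w) (nhds z)"
    by eventually_elim (rule Suc.IH)
  hence "deriv ((deriv ^^ n) (f 0)) z = deriv (f n) z" by (rule deriv_cong_ev) simp
  also have "\<dots> = f (Suc n) z" using d[OF Suc.prems] by (rule DERIV_imp_deriv)
  finally show ?case by simp
qed simp

text \<open>The k-th z-derivative of minus the logarithm of theta \<tau> z / (- 2 i sin (pi z)),
  written in closed form for all k at once. At z = 0 and k = 4 both Lambert series become the one of
  E4.\<close>

definition log_theta :: "complex \<Rightarrow> nat \<Rightarrow> complex \<Rightarrow> complex" where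
  "log_theta \<tau> k z = (2 * pi * \<i>) ^ k *
     (lambert k (q_of \<tau>) (q_of (\<tau> + z)) + (- 1) ^ k * lambert k (q_of \<tau>) (q_of (\<tau> - z)))"

lemma log_theta_deriv:
  fixes z :: complex
  assumes "\<bar>Im z\<bar> < Im \<tau>"
  shows "(log_theta \<tau> k has_field_derivative log_theta \<tau> (Suc k) z) (at z)"
proof -
  have q: "norm (q_of \<tau>) < 1" "norm (q_of (\<tau> + z)) < 1" "norm (q_of (\<tau> - z)) < 1"
    using assms by (auto intro!: norm_q_of_less_1)
  have 1: "((\<lambda>z. q_of (\<tau> + z)) has_field_derivative 2 * pi * \<i> * q_of (\<tau> + z)) (at z)"
    unfolding q_of_def by (auto intro!: derivative_eq_intros)
  have 2: "((\<lambda>z. q_of (\<tau> - z)) has_field_derivative - (2 * pi * \<i>) * q_of (\<tau> - z)) (at z)"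
    unfolding q_of_def by (auto intro!: derivative_eq_intros)
  note d1 = DERIV_chain2[OF lambert_deriv[OF q(1,2), of k] 1]
  note d2 = DERIV_chain2[OF lambert_deriv[OF q(1,3), of k] 2]
  show ?thesis unfolding log_theta_def
    by (rule DERIV_cong[OF DERIV_cmult[OF DERIV_add[OF d1 DERIV_cmult[OF d2]]]])
      (simp_all add: field_simps)
qed

lemma theta_eq_exp_log_theta:
  fixes z :: complex
  assumes "\<bar>Im z\<bar> < Im \<tau>"
  shows "theta \<tau> z = - 2 * \<i> * sin (pi * z) * exp (- log_theta \<tau> 0 z)"
proof -
  have q: "norm (q_of \<tau>) < 1" "norm (q_of (\<tau> + z)) < 1" "norm (q_of (\<tau> - z)) < 1"
    using assms by (auto intro!: norm_q_of_less_1)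
  have "exp (- (\<i> * pi * z)) * (1 - q_of z) = exp (- (\<i> * pi * z)) - exp (\<i> * pi * z)"
    by (simp add: q_of_def right_diff_distrib exp_add[symmetric] algebra_simps)
  also have "\<dots> = - 2 * \<i> * sin (pi * z)" by (simp add: sin_exp_eq field_simps)
  finally have s: "exp (- (\<i> * pi * z)) * (1 - q_of z) = - 2 * \<i> * sin (pi * z)" .
  have "theta \<tau> z = (exp (- (\<i> * pi * z)) * (1 - q_of z)) *
      qpoch (q_of (\<tau> + z)) (q_of \<tau>) * qpoch (q_of (\<tau> - z)) (q_of \<tau>)"
    unfolding theta_def using qpoch_rec[OF q(1), of "q_of z"] by (simp add: q_of_add q_of_diff mult_ac)
  also have "\<dots> = - 2 * \<i> * sin (pi * z) * exp (- log_theta \<tau> 0 z)"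
    unfolding s qpoch_eq_exp_lambert[OF q(1,2)] qpoch_eq_exp_lambert[OF q(1,3)]
    by (simp add: log_theta_def exp_diff exp_minus field_simps)
  finally show ?thesis .
qed

text \<open>The logarithmic derivative of the theta inversion formula reads
  \<open>A' * B - A * B' + A * B * U = 0\<close> with \<open>A = sin (pi z / \<tau>)\<close> and \<open>B = sin (pi z)\<close>; its
  coefficient of \<open>z^5\<close> is the transformation law of the fourth Eisenstein series.\<close>

theorem eisenstein_E4_inversion:
  assumes \<tau>: "Im \<tau> > 0"
  shows "eisenstein_E4 (- 1 / \<tau>) = \<tau> ^ 4 * eisenstein_E4 \<tau>"
proof -
  define \<sigma> where "\<sigma> = - 1 / \<tau>"
  have [simp]: "\<tau> \<noteq> 0" using \<tau> by auto
  have \<sigma>: "Im \<sigma> > 0" unfolding \<sigma>_def by (rule Im_inversion_pos[OF \<tau>])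
  define S where "S = {z. \<bar>Im z\<bar> < Im \<tau>} \<inter> {z. \<bar>Im (z / \<tau>)\<bar> < Im \<sigma>}"
  have S: "open S" "0 \<in> S"
    using \<tau> \<sigma> unfolding S_def by (auto intro!: open_Int open_Collect_less continuous_intros)
  obtain c where c: "\<And>z. exp (- (\<i> * pi * z\<^sup>2 / \<tau>)) * theta \<sigma> (z / \<tau>) = c * theta \<tau> z"
    unfolding \<sigma>_def using theta_inversion[OF \<tau>] by metis
  define s where "s = 1 / \<tau>"
  define A where "A z = sin (pi * s * z)" for z :: complex
  define B where "B z = sin (pi * z)" for z :: complex
  define H where "H z = - (\<i> * pi * z\<^sup>2 / \<tau>) - log_theta \<sigma> 0 (z / \<tau>) + log_theta \<tau> 0 z" for z
  define p where "p k z = (if k = 0 then - (2 * \<i> * pi * z / \<tau>) else if k = 1 then - (2 * \<i> * pi / \<tau>) else 0)"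
    for k :: nat and z :: complex
  \<comment> \<open>\<open>f k\<close> is the derivative of order k + 1 of \<open>H\<close>, and exp
    H is what the theta inversion formula leaves after the two sines are split off.\<close>
  define f where "f k z = p k z - s ^ Suc k * log_theta \<sigma> (Suc k) (z / \<tau>) + log_theta \<tau> (Suc k) z" for k z
  have lt: "((\<lambda>z. log_theta \<sigma> k (z / \<tau>)) has_field_derivative s * log_theta \<sigma> (Suc k) (z / \<tau>)) (at z)"
    if "z \<in> S" for k z
  proof -
    have "((\<lambda>z. z / \<tau>) has_field_derivative s) (at z)"
      unfolding s_def by (auto intro!: derivative_eq_intros)
    from DERIV_chain2[OF log_theta_deriv this, of \<sigma> k] that show ?thesis by (simp add: S_def mult.commute)
  qed
  have f: "(f k has_field_derivative f (Suc k) z) (at z)" if z: "z \<in> S" for k z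
  proof -
    have 1: "(p k has_field_derivative p (Suc k) z) (at z)"
      unfolding p_def by (cases k) (auto intro!: derivative_eq_intros)
    have 2: "(log_theta \<tau> (Suc k) has_field_derivative log_theta \<tau> (Suc (Suc k)) z) (at z)"
      by (rule log_theta_deriv) (use z in \<open>simp add: S_def\<close>)
    show ?thesis unfolding f_def
      by (rule DERIV_cong[OF DERIV_add[OF DERIV_diff[OF 1 DERIV_cmult[OF lt[OF z]]] 2]]) simp
  qed
  have H: "(H has_field_derivative f 0 z) (at z)" if z: "z \<in> S" for z
  proof -
    have 1: "((\<lambda>z. - (\<i> * pi * z\<^sup>2 / \<tau>)) has_field_derivative p 0 z) (at z)"
      unfolding p_def by (auto intro!: derivative_eq_intros)
    have 2: "(log_theta \<tau> 0 has_field_derivative log_theta \<tau> (Suc 0) z) (at z)"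
      by (rule log_theta_deriv) (use z in \<open>simp add: S_def\<close>)
    show ?thesis unfolding f_def H_def
      by (rule DERIV_cong[OF DERIV_add[OF DERIV_diff[OF 1 lt[OF z]] 2]]) simp
  qed
  define A' where "A' z = pi * s * cos (pi * s * z)" for z :: complex
  define B' where "B' z = pi * cos (pi * z)" for z :: complex
  have A': "(A has_field_derivative A' z) (at z)" for z
    unfolding A_def A'_def by (auto intro!: derivative_eq_intros)
  have B': "(B has_field_derivative B' z) (at z)" for z
    unfolding B_def B'_def by (auto intro!: derivative_eq_intros)
  have AB: "A z * exp (H z) = c * B z" if z: "z \<in> S" for z
  proof -
    have t: "theta \<tau> z = - 2 * \<i> * B z * exp (- log_theta \<tau> 0 z)"
      using theta_eq_exp_log_theta[of z \<tau>] z by (simp add: S_def B_def)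
    have t': "theta \<sigma> (z / \<tau>) = - 2 * \<i> * A z * exp (- log_theta \<sigma> 0 (z / \<tau>))"
      using theta_eq_exp_log_theta[of "z / \<tau>" \<sigma>] z by (simp add: S_def A_def s_def)
    have e: "exp (H z) = exp (- (\<i> * pi * z\<^sup>2 / \<tau>)) * exp (- log_theta \<sigma> 0 (z / \<tau>)) * exp (log_theta \<tau> 0 z)"
      unfolding exp_add[symmetric] H_def by simp
    have e': "exp (- log_theta \<tau> 0 z) * exp (log_theta \<tau> 0 z) = 1" by (simp add: exp_minus)
    have "- 2 * \<i> * (A z * exp (H z)) =
        exp (- (\<i> * pi * z\<^sup>2 / \<tau>)) * theta \<sigma> (z / \<tau>) * exp (log_theta \<tau> 0 z)"
      unfolding e t' by simp
    also have "\<dots> = - 2 * \<i> * (c * B z) * (exp (- log_theta \<tau> 0 z) * exp (log_theta \<tau> 0 z))"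
      unfolding c t by simp
    finally show ?thesis unfolding e' by simp
  qed
  have id: "A' z * B z - A z * B' z + A z * B z * f 0 z = 0" if z: "z \<in> S" for z
  proof -
    have "((\<lambda>z. A z * exp (H z)) has_field_derivative (A' z * exp (H z) + (exp (H z) * f 0 z) * A z)) (at z)"
      by (intro DERIV_mult A' DERIV_chain2[OF DERIV_exp] H z)
    moreover have "((\<lambda>z. A z * exp (H z)) has_field_derivative c * B' z) (at z)"
    proof (rule has_field_derivative_transform_within_open[of "\<lambda>z. c * B z" _ _ S])
      show "((\<lambda>z. c * B z) has_field_derivative c * B' z) (at z)" by (intro DERIV_cmult B')
    qed (use S z AB in auto)
    ultimately have "A' z * exp (H z) + (exp (H z) * f 0 z) * A z = c * B' z" by (rule DERIV_unique)
    hence "(A' z * B z - A z * B' z + A z * B z * f 0 z) * exp (H z) = 0"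
      using AB[OF z] by algebra
    thus ?thesis by simp
  qed
  define U where "U = fps_expansion (f 0) 0"
  have "f 0 holomorphic_on S" using f S by (auto simp: holomorphic_on_open)
  hence U: "f 0 has_fps_expansion U"
    unfolding U_def using S by (intro has_fps_expansion_fps_expansion) auto
  have U3: "fps_nth U 3 = f 3 0 / 6"
    using higher_deriv_chain[of S f 0 3, OF S(1) f S(2)] by (simp add: U_def fps_expansion_def fact_numeral)
  define FA FB where "FA = fps_sin (pi * s)" and "FB = fps_sin (of_real pi :: complex)"
  define CA CB where "CA = fps_cos (pi * s)" and "CB = fps_cos (of_real pi :: complex)"
  have "(\<lambda>z. A' z * B z - A z * B' z + A z * B z * f 0 z) has_fps_expansion
      (fps_const (pi * s) * CA * FB - FA * (fps_const (of_real pi) * CB) + FA * FB * U)"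
    unfolding A_def B_def A'_def B'_def FA_def FB_def CA_def CB_def
    by (intro fps_expansion_intros U)
  moreover have "\<forall>\<^sub>F z in nhds 0. A' z * B z - A z * B' z + A z * B z * f 0 z = 0"
    using eventually_nhds S id by blast
  ultimately have "(\<lambda>z. 0) has_fps_expansion
      (fps_const (pi * s) * CA * FB - FA * (fps_const (of_real pi) * CB) + FA * FB * U)"
    by (subst (asm) has_fps_expansion_cong[OF _ refl, of _ "\<lambda>_. 0"])
  hence 0: "fps_const (pi * s) * CA * FB - FA * (fps_const (of_real pi) * CB) + FA * FB * U = 0"
    using fps_expansion_unique_complex has_fps_expansion_0 by blast
  have coeffs: "fps_nth (fps_sin a) 0 = 0" "fps_nth (fps_sin a) (Suc 0) = a" "fps_nth (fps_sin a) 2 = 0"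
    "fps_nth (fps_sin a) 3 = - (a ^ 3) / 6" "fps_nth (fps_sin a) 4 = 0" "fps_nth (fps_sin a) 5 = a ^ 5 / 120"
    "fps_nth (fps_cos a) 0 = 1" "fps_nth (fps_cos a) (Suc 0) = 0" "fps_nth (fps_cos a) 2 = - (a ^ 2) / 2"
    "fps_nth (fps_cos a) 3 = 0" "fps_nth (fps_cos a) 4 = a ^ 4 / 24" "fps_nth (fps_cos a) 5 = 0"
    "fps_nth (fps_sin a) (Suc (Suc 0)) = 0" "fps_nth (fps_cos a) (Suc (Suc 0)) = - (a * a) / 2" for a :: complex
    by (simp_all add: fps_sin_def fps_cos_def fact_numeral)
  have at5: "{0..5} = {0, Suc 0, 2, 3, 4, 5::nat}" "{0..4} = {0, Suc 0, 2, 3, 4::nat}"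
    "{0..3} = {0, Suc 0, 2, 3::nat}" "{0..2} = {0, Suc 0, 2::nat}" "{0..Suc 0} = {0, Suc 0}" by auto
  define a where "a = complex_of_real pi"
  \<comment> \<open>A B starts with z^2, so the coefficient of z^3 determines the linear coefficient
    of \<open>U\<close>. With that known, the coefficient of z^5 determines the cubic one, which is
    a difference of two values of \<open>lambert 4\<close>.\<close>
  have E3: "fps_nth (fps_const (pi * s) * CA * FB - FA * (fps_const (of_real pi) * CB) + FA * FB * U) 3 = 0"
   and E5: "fps_nth (fps_const (pi * s) * CA * FB - FA * (fps_const (of_real pi) * CB) + FA * FB * U) 5 = 0"
    unfolding 0 by simp_all
  have a0: "a \<noteq> 0" "s \<noteq> 0" by (simp_all add: a_def s_def)
  have s: "s * \<tau> = 1" by (simp add: s_def)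
  note expand = FA_def FB_def CA_def CB_def a_def[symmetric] fps_mult_nth at5 coeffs
  have E3': "36 * (a ^ 2 * s * fps_nth U 1) + 12 * (a ^ 4 * s * (1 - s ^ 2)) = 0"
    using E3 by (simp add: expand field_simps power2_eq_square power3_eq_cube power4_eq_xxxx)
  have E5': "a ^ 2 * s * fps_nth U 3 - a ^ 4 * s * (1 + s ^ 2) / 6 * fps_nth U 1 + a ^ 6 * s * (s ^ 4 - 1) / 30 = 0"
    using E5 by (simp add: expand field_simps) algebra
  have "a ^ 2 * s * (3 * fps_nth U 1 + a ^ 2 * (1 - s ^ 2)) = 0" using E3' by algebra
  hence "3 * fps_nth U 1 + a ^ 2 * (1 - s ^ 2) = 0" using a0 by (metis mult_eq_0_iff power_eq_0_iff)
  hence u1: "fps_nth U 1 = - (a ^ 2 * (1 - s ^ 2) / 3)" by (simp add: field_simps eq_neg_iff_add_eq_0)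
  have "a ^ 2 * s * (fps_nth U 3 + a ^ 4 * (1 - s ^ 4) / 45) = 0"
    using E5' unfolding u1 by (simp add: field_simps) algebra
  hence "fps_nth U 3 + a ^ 4 * (1 - s ^ 4) / 45 = 0" using a0 by (metis mult_eq_0_iff power_eq_0_iff)
  hence "fps_nth U 3 = - (a ^ 4 * (1 - s ^ 4) / 45)" by (simp only: eq_neg_iff_add_eq_0)
  moreover have lt4: "log_theta t 4 0 = 32 * a ^ 4 * lambert 4 (q_of t) (q_of t)" for t
    by (simp add: log_theta_def a_def power_mult_distrib)
  have "f 3 0 = 32 * a ^ 4 * (lambert 4 (q_of \<tau>) (q_of \<tau>) - s ^ 4 * lambert 4 (q_of \<sigma>) (q_of \<sigma>))"
    using lt4 by (simp add: f_def p_def numeral_eq_Suc[symmetric] algebra_simps)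
  ultimately have "32 * a ^ 4 * (lambert 4 (q_of \<tau>) (q_of \<tau>) - s ^ 4 * lambert 4 (q_of \<sigma>) (q_of \<sigma>)) / 6 =
      - (a ^ 4 * (1 - s ^ 4) / 45)" using U3 by simp
  \<comment> \<open>The constant of E4 appears here as 32 / 6 * 45 = 240.\<close>
  hence "a ^ 4 * (eisenstein_E4 \<tau> - s ^ 4 * eisenstein_E4 \<sigma>) = 0"
    unfolding eisenstein_E4_eq_lambert[OF \<tau>] eisenstein_E4_eq_lambert[OF \<sigma>] by algebra
  hence "eisenstein_E4 \<tau> = s ^ 4 * eisenstein_E4 \<sigma>" using a0 by simp
  hence "\<tau> ^ 4 * eisenstein_E4 \<tau> = (s * \<tau>) ^ 4 * eisenstein_E4 \<sigma>" by (simp add: power_mult_distrib)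
  thus ?thesis by (simp add: s \<sigma>_def)
qed

subsection \<open>Modular functions that vanish at the cusp\<close>

definition at_i_infinity :: "complex filter" where
  "at_i_infinity = filtercomap Im at_top"

lemma eventually_at_i_infinity:
  "eventually P at_i_infinity \<longleftrightarrow> (\<exists>Y. \<forall>t. Im t > Y \<longrightarrow> P t)"
  unfolding at_i_infinity_def eventually_filtercomap_at_top_dense by blast

lemma at_i_infinity_neq_bot [simp]: "at_i_infinity \<noteq> bot"
proof
  assume "at_i_infinity = bot"
  hence "eventually (\<lambda>_. False) at_i_infinity" by simp
  then obtain Y where "\<forall>t. \<not> Im t > Y" by (auto simp: eventually_at_i_infinity)
  hence "\<not> Im (Complex 0 (Y + 1)) > Y" by blast
  thus False by simp
qed

lemma eventually_upper_half: "eventually (\<lambda>t. Im t > 0) at_i_infinity"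
  unfolding eventually_at_i_infinity by blast

lemma open_upper_half: "open {t. Im t > 0}"
  by (intro open_Collect_less continuous_intros)

lemma connected_upper_half: "connected {t. Im t > 0}"
  by (intro convex_connected convex_halfspace_Im_gt)

lemma upper_half_periodic_int:
  assumes "\<And>t. Im t > 0 \<Longrightarrow> f (t + 1) = f t" "Im t > 0"
  shows "f (t + of_int n) = f t"
  using lattice_periodic[of "\<lambda>t. if Im t > 0 then f t else undefined" 0 t n 0] assms by simp

text \<open>If the real part is at most 1/2 in absolute value and the imaginary part is below 1/2,
  then the squared modulus is at most 1/2 and inversion at least doubles the imaginary part. Aiming
  only at height 1/2, below the usual fundamental domain, bounds the number of steps by counting
  doublings.\<close>

lemma modular_reduction:
  assumes T: "\<And>t. Im t > 0 \<Longrightarrow> f (t + 1) = f t" and S: "\<And>t. Im t > 0 \<Longrightarrow> f (- 1 / t) = f t"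
    and t: "Im t > 0"
  shows "\<exists>u. \<bar>Re u\<bar> \<le> 1 / 2 \<and> Im u \<ge> 1 / 2 \<and> f u = f t"
proof -
  have "\<exists>u. \<bar>Re u\<bar> \<le> 1 / 2 \<and> Im u \<ge> 1 / 2 \<and> f u = f t" if "Im t > 0" "2 ^ n * Im t \<ge> 1 / 2" for n t
    using that
  proof (induction n arbitrary: t)
    case (0 t)
    define u where "u = t + of_int (- round (Re t))"
    have "f u = f t" unfolding u_def by (rule upper_half_periodic_int[of f, OF T 0(1)])
    moreover have "\<bar>Re u\<bar> \<le> 1 / 2" using of_int_round_abs_le[of "Re t"] by (simp add: u_def abs_minus_commute)
    ultimately show ?case using 0 by (intro exI[of _ u]) (simp add: u_def)
  next
    case (Suc n t)
    define u where "u = t + of_int (- round (Re t))"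
    have fu: "f u = f t" unfolding u_def by (rule upper_half_periodic_int[of f, OF T Suc.prems(1)])
    have Re: "\<bar>Re u\<bar> \<le> 1 / 2" using of_int_round_abs_le[of "Re t"] by (simp add: u_def abs_minus_commute)
    have Im: "Im u = Im t" by (simp add: u_def)
    show ?case
    proof (cases "Im u \<ge> 1 / 2")
      case True
      thus ?thesis using fu Re by blast
    next
      case False
      have "\<bar>Re u\<bar>\<^sup>2 \<le> (1 / 2)\<^sup>2" "(Im u)\<^sup>2 \<le> (1 / 2)\<^sup>2"
        using Re False Im Suc.prems by (intro power_mono; simp)+
      hence n: "(cmod u)\<^sup>2 \<le> 1 / 2" unfolding cmod_power2 by (simp add: power2_eq_square)
      have "u \<noteq> 0" using Im Suc.prems by auto
      hence "Im u / (1 / 2) \<le> Im u / (cmod u)\<^sup>2"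
        using n Im Suc.prems by (intro divide_left_mono) auto
      hence I: "2 * Im t \<le> Im (- 1 / u)" unfolding Im_inversion using Im by simp
      have "1 / 2 \<le> 2 ^ n * (2 * Im t)" using Suc.prems by simp
      also have "\<dots> \<le> 2 ^ n * Im (- 1 / u)" by (intro mult_left_mono I) simp
      finally have "\<exists>v. \<bar>Re v\<bar> \<le> 1 / 2 \<and> Im v \<ge> 1 / 2 \<and> f v = f (- 1 / u)"
        using I Suc.prems by (intro Suc.IH) auto
      moreover have "f (- 1 / u) = f t" using S[of u] Im Suc.prems fu by simp
      ultimately show ?thesis by simp
    qed
  qed
  moreover obtain n where "1 / (2 * Im t) < 2 ^ n" using real_arch_pow[of 2] by force
  ultimately show ?thesis using t by (simp add: field_simps) (metis less_eq_real_def)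
qed

text \<open>A modular function without poles that vanishes at the cusp attains its maximum modulus.\<close>

lemma modular_function_zero:
  assumes hol: "f holomorphic_on {t. Im t > 0}"
    and T: "\<And>t. Im t > 0 \<Longrightarrow> f (t + 1) = f t" and S: "\<And>t. Im t > 0 \<Longrightarrow> f (- 1 / t) = f t"
    and lim: "(f \<longlongrightarrow> 0) at_i_infinity" and t: "Im t > 0"
  shows "f t = 0"
proof (rule ccontr)
  assume ft: "f t \<noteq> 0"
  have small: "\<exists>Y. \<forall>u. Im u > Y \<longrightarrow> norm (f u) < e" if "e > 0" for e
    using tendstoD[OF lim that] by (simp add: eventually_at_i_infinity)
  obtain Y where Y: "\<And>u. Im u > Y \<Longrightarrow> norm (f u) < norm (f t)" using small[of "norm (f t)"] ft by auto
  define K where "K = cbox (Complex (- 1 / 2) (1 / 2)) (Complex (1 / 2) Y)"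
  have K: "u \<in> K \<longleftrightarrow> \<bar>Re u\<bar> \<le> 1 / 2 \<and> Im u \<ge> 1 / 2 \<and> Im u \<le> Y" for u
    by (auto simp: K_def in_cbox_complex_iff)
  have red: "\<exists>u. f u = f v \<and> (u \<in> K \<or> norm (f u) < norm (f t))" if "Im v > 0" for v
    using modular_reduction[of f, OF T S that] Y unfolding K by (metis not_le)
  obtain t' where t': "t' \<in> K" "f t' = f t" using red[OF t] by (metis less_irrefl)
  have "\<exists>u\<in>K. \<forall>v\<in>K. norm (f v) \<le> norm (f u)"
  proof (intro continuous_attains_sup continuous_on_norm)
    show "continuous_on K f"
      by (rule continuous_on_subset[OF holomorphic_on_imp_continuous_on[OF hol]]) (auto simp: K)
  qed (use t' in \<open>auto simp: K_def\<close>)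
  then obtain u where u: "u \<in> K" "\<And>v. v \<in> K \<Longrightarrow> norm (f v) \<le> norm (f u)" by blast
  have "norm (f v) \<le> norm (f u)" if "Im v > 0" for v
    using red[OF that] u(2) t' by (metis less_imp_le order_trans)
  hence "f constant_on {t. Im t > 0}"
    using u K by (intro maximum_modulus_principle[OF hol open_upper_half connected_upper_half open_upper_half, of u]) auto
  then obtain c where c: "\<And>v. Im v > 0 \<Longrightarrow> f v = c" by (auto simp: constant_on_def)
  have "eventually (\<lambda>v. f v = c) at_i_infinity"
    using eventually_upper_half by eventually_elim (rule c)
  hence "((\<lambda>_. c) \<longlongrightarrow> 0) at_i_infinity" by (rule Lim_transform_eventually[OF lim])
  hence "c = 0" by (simp add: tendsto_const_iff)
  thus False using c[OF t] ft by simp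
qed

text \<open>Holomorphic functions on a connected open set have no zero divisors: where one factor is
  nonzero the remaining product vanishes on an open set, hence everywhere. This recovers a single
  factor from a vanishing product of translates.\<close>

lemma holomorphic_prod_zero:
  assumes S: "open S" "connected S" "S \<noteq> {}" and "finite I"
    and hol: "\<And>i. i \<in> I \<Longrightarrow> f i holomorphic_on S" and 0: "\<And>z. z \<in> S \<Longrightarrow> (\<Prod>i\<in>I. f i z) = 0"
  shows "\<exists>i\<in>I. \<forall>z\<in>S. f i z = 0"
  using assms(4-)
proof (induction I rule: finite_induct)
  case empty
  thus ?case using S by auto
next
  case (insert i I)
  show ?case
  proof (cases "\<forall>z\<in>S. f i z = 0")
    case False
    then obtain z0 where z0: "z0 \<in> S" "f i z0 \<noteq> 0" by blast
    have "isCont (f i) z0"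
      using insert.prems(1)[of i] S z0 by (auto simp: continuous_on_eq_continuous_at dest!: holomorphic_on_imp_continuous_on)
    then obtain e where e: "e > 0" "\<And>z. dist z0 z < e \<Longrightarrow> f i z \<noteq> 0"
      using continuous_at_avoid[of z0 "f i" 0] z0 by blast
    have prod_hol: "(\<lambda>z. \<Prod>i\<in>I. f i z) holomorphic_on S"
      by (intro holomorphic_on_prod) (use insert.prems in auto)
    have "(\<Prod>i\<in>I. f i z) = 0" if z: "z \<in> S" for z
    proof (rule analytic_continuation_open[of "S \<inter> ball z0 e" S "\<lambda>z. \<Prod>i\<in>I. f i z" "\<lambda>_. 0"])
      show "(\<Prod>i\<in>I. f i z) = 0" if "z \<in> S \<inter> ball z0 e" for z
        using insert.prems(2)[of z] insert.hyps e that by auto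
      show "S \<inter> ball z0 e \<noteq> {}" using z0 e by force
    qed (use S z prod_hol in \<open>auto\<close>)
    hence "\<exists>i\<in>I. \<forall>z\<in>S. f i z = 0" using insert.prems by (intro insert.IH) auto
    thus ?thesis by blast
  qed blast
qed

text \<open>Multiplying \<open>f\<close> by its translates under the coset representatives \<open>t \<mapsto> - 1 / (t + k)\<close> gives a
  function that is invariant under the full modular group.\<close>

lemma Gamma0_function_zero:
  assumes p: "p \<ge> 2" and hol: "f holomorphic_on {t. Im t > 0}"
    and T: "\<And>t. Im t > 0 \<Longrightarrow> f (t + 1) = f t"
    and Tp: "\<And>t. Im t > 0 \<Longrightarrow> f (- 1 / (t + of_nat p)) = f (- 1 / t)"
    and middle: "\<And>t k. 2 \<le> k \<Longrightarrow> k + 2 \<le> p \<Longrightarrow> Im t > 0 \<Longrightarrow> f (- 1 / (- 1 / t + of_nat k)) = f (- 1 / (t + of_nat k))"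
    and lim: "(f \<longlongrightarrow> 0) at_i_infinity"
    and bdd: "eventually (\<lambda>t. norm (f (- 1 / t)) \<le> B) at_i_infinity"
    and t: "Im t > 0"
  shows "f t = 0"
proof -
  define g where "g t = f (- 1 / t)" for t
  define F where "F t = f t * (\<Prod>k<p. g (t + of_nat k))" for t
  have SS: "- 1 / (- 1 / t) = t" for t :: complex by simp
  have holg: "(\<lambda>t. g (t + of_nat k)) holomorphic_on {t. Im t > 0}" for k
  proof -
    have "f \<circ> (\<lambda>t. - 1 / (t + of_nat k)) holomorphic_on {t. Im t > 0}"
    proof (rule holomorphic_on_compose_gen[OF _ hol])
      show "(\<lambda>t. - 1 / (t + of_nat k)) holomorphic_on {t. 0 < Im t}"
        by (intro holomorphic_intros) (auto simp: complex_eq_iff)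
    qed (use Im_inversion_pos in force)
    thus ?thesis by (simp add: o_def g_def)
  qed
  have gp: "g (t + of_nat p) = g t" if "Im t > 0" for t using Tp[OF that] by (simp add: g_def)
  have g1: "g (- 1 / t + 1) = g (t - 1)" if "Im t > 0" for t
  proof -
    have "t \<noteq> 0" "t \<noteq> 1" using that by auto
    hence "- 1 / (- 1 / t + 1) + 1 = - 1 / (t - 1)" by (simp add: divide_simps) (simp add: algebra_simps)?
    moreover have "Im (- 1 / t + 1) > 0" using Im_inversion_pos[OF that] by simp
    ultimately show ?thesis using T[of "- 1 / (- 1 / t + 1)"] Im_inversion_pos by (metis g_def)
  qed
  have g2: "g (- 1 / t - 1) = g (t + 1)" if "Im t > 0" for t
    using g1[of "- 1 / t"] Im_inversion_pos[OF that] by (simp add: SS)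
  \<comment> \<open>Inversion permutes the cosets by k \<mapsto> - 1 / k modulo p. It swaps 1 and p
    - 1; fixing the remaining k is the hypothesis \<open>middle\<close>, which is void for p = 2, 3
    and holds for p = 5 because 2^2 = - 1 modulo 5.\<close>
  define s where "s k = (if k = 1 then p - 1 else if k = p - 1 then 1 else k)" for k
  have s: "bij_betw s {1..<p} {1..<p}"
    by (rule bij_betwI[where g = s]) (use p in \<open>auto simp: s_def split: if_splits\<close>)
  have gs: "g (- 1 / t + of_nat k) = g (t + of_nat (s k))" if t: "Im t > 0" and k: "k \<in> {1..<p}" for t k
  proof -
    consider "k = 1" | "k = p - 1" "k \<noteq> 1" | "2 \<le> k" "k + 2 \<le> p" "k \<noteq> 1" "k \<noteq> p - 1" using k by fastforce
    thus ?thesis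
    proof cases
      case 1
      have "g (- 1 / t + of_nat k) = g (t - 1)" using g1[OF t] 1 by simp
      also have "\<dots> = g (t - 1 + of_nat p)" using gp[of "t - 1"] t by simp
      also have "t - 1 + of_nat p = t + of_nat (s k)" using 1 p by (simp add: s_def of_nat_diff)
      finally show ?thesis .
    next
      case 2
      have "- 1 / t + of_nat k = - 1 / t - 1 + of_nat p" using 2 p by (simp add: of_nat_diff)
      hence "g (- 1 / t + of_nat k) = g (- 1 / t - 1 + of_nat p)" by (simp only:)
      also have "\<dots> = g (- 1 / t - 1)" using gp[of "- 1 / t - 1"] Im_inversion_pos[OF t] by simp
      also have "\<dots> = g (t + 1)" by (rule g2[OF t])
      finally show ?thesis using 2 by (simp add: s_def)
    next
      case 3
      thus ?thesis using middle[OF 3(1,2) t] by (simp add: s_def g_def)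
    qed
  qed
  have F0: "F t = 0" if "Im t > 0" for t
  proof (rule modular_function_zero[OF _ _ _ _ that])
    show "F holomorphic_on {t. 0 < Im t}"
      unfolding F_def by (intro holomorphic_on_mult hol holomorphic_on_prod holg)
    show "F (t + 1) = F t" if t: "Im t > 0" for t
    proof -
      \<comment> \<open>The shift turns the factor \<open>g t\<close> into \<open>g (t + p)\<close>,
        which has the same value. The products are compared after multiplication by
        \<open>g t\<close>; if this is 0, both contain a zero factor, at k = p - 1 and at k =
        0.\<close>
      have "(\<Prod>k<p. g (t + 1 + of_nat k)) * g t = (\<Prod>k<Suc p. g (t + of_nat k))"
        unfolding prod.lessThan_Suc_shift by (simp add: add_ac)
      also have "\<dots> = (\<Prod>k<p. g (t + of_nat k)) * g t" using gp[OF t] by simp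
      finally have "(\<Prod>k<p. g (t + 1 + of_nat k)) * g t = (\<Prod>k<p. g (t + of_nat k)) * g t" .
      moreover have "(\<Prod>k<p. g (t + 1 + of_nat k)) = (\<Prod>k<p. g (t + of_nat k))" if "g t = 0"
      proof -
        have "g (t + 1 + of_nat (p - 1)) = 0" using gp[OF t] that p by (simp add: of_nat_diff)
        hence "(\<Prod>k<p. g (t + 1 + of_nat k)) = 0" using p by (intro prod_zero bexI[of _ "p - 1"]) auto
        moreover have "(\<Prod>k<p. g (t + of_nat k)) = 0" using p that by (intro prod_zero bexI[of _ 0]) auto
        ultimately show ?thesis by (simp only:)
      qed
      ultimately show ?thesis using T[OF t] by (auto simp: F_def)
    qed
    show "F (- 1 / t) = F t" if t: "Im t > 0" for t
    proof -
      have split: "(\<Prod>k<p. h k) = h 0 * (\<Prod>k\<in>{1..<p}. h k)" for h :: "nat \<Rightarrow> complex"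
        using p prod.atLeast_Suc_lessThan[of 0 p h] by (simp add: lessThan_atLeast0)
      have "(\<Prod>k\<in>{1..<p}. g (- 1 / t + of_nat k)) = (\<Prod>k\<in>{1..<p}. g (t + of_nat (s k)))"
        by (intro prod.cong refl gs t)
      also have "\<dots> = (\<Prod>k\<in>{1..<p}. g (t + of_nat k))"
        using prod.reindex_bij_betw[OF s, of "\<lambda>k. g (t + of_nat k)"] .
      finally have *: "(\<Prod>k\<in>{1..<p}. g (- 1 / t + of_nat k)) = (\<Prod>k\<in>{1..<p}. g (t + of_nat k))" .
      show ?thesis unfolding F_def split * by (simp add: g_def SS)
    qed
    show "(F \<longlongrightarrow> 0) at_i_infinity"
      unfolding F_def
    proof (rule lim_null_mult_right_bounded[OF lim])
      obtain Y where Y: "\<And>t. Im t > Y \<Longrightarrow> norm (g t) \<le> B"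
        using bdd by (auto simp: eventually_at_i_infinity g_def)
      have "norm (\<Prod>k<p. g (t + of_nat k)) \<le> B ^ p" if "Im t > Y" for t
      proof -
        have "norm (\<Prod>k<p. g (t + of_nat k)) = (\<Prod>k<p. norm (g (t + of_nat k)))" by (simp add: prod_norm)
        also have "\<dots> \<le> (\<Prod>k<p. B)" using that by (intro prod_mono conjI Y) auto
        finally show ?thesis by simp
      qed
      thus "\<forall>\<^sub>F t in at_i_infinity. norm (\<Prod>k<p. g (t + of_nat k)) \<le> B ^ p"
        by (auto simp: eventually_at_i_infinity)
    qed
  qed
  \<comment> \<open>Index p stands for \<open>f\<close> itself and i < p for the translates. If a
    translate vanishes identically, so does \<open>f\<close>, by evaluating that translate at - 1 /
    t - i.\<close>
  have "\<exists>i\<in>{..p}. \<forall>z\<in>{t. Im t > 0}. (if i = p then f z else g (z + of_nat i)) = 0"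
  proof (rule holomorphic_prod_zero[OF open_upper_half connected_upper_half])
    show "{t. Im t > 0} \<noteq> {}" using t by blast
    show "(\<lambda>z. if i = p then f z else g (z + of_nat i)) holomorphic_on {t. 0 < Im t}" for i
      using hol holg by (cases "i = p") simp_all
    fix z assume "z \<in> {t. Im t > 0}"
    hence "F z = 0" using F0 by auto
    moreover have "{..p} = insert p {..<p}" by auto
    ultimately show "(\<Prod>i\<le>p. if i = p then f z else g (z + of_nat i)) = 0"
      by (auto simp: F_def)
  qed simp
  then obtain i where i: "\<And>z. Im z > 0 \<Longrightarrow> (if i = p then f z else g (z + of_nat i)) = 0" by auto
  show ?thesis
  proof (cases "i = p")
    case True
    thus ?thesis using i[OF t] by simp
  next
    case False
    have "g (- 1 / t - of_nat i + of_nat i) = 0" using i[of "- 1 / t - of_nat i"] False Im_inversion_pos[OF t] by simp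
    thus ?thesis by (simp add: g_def SS)
  qed
qed

subsection \<open>The invariant at levels 2, 3 and 5\<close>

definition euler :: "complex \<Rightarrow> complex" where
  "euler q = qpoch q q"

lemma euler_nz: "norm q < 1 \<Longrightarrow> euler q \<noteq> 0"
  unfolding euler_def by (rule qpoch_self_nz)

lemma euler_0 [simp]: "euler 0 = 1"
  by (simp add: euler_def)

lemma euler_holomorphic [holomorphic_intros]:
  assumes "f holomorphic_on A" "open A" "\<And>z. z \<in> A \<Longrightarrow> norm (f z) < 1"
  shows "(\<lambda>z. euler (f z)) holomorphic_on A"
  unfolding euler_def by (intro holomorphic_intros assms)

lemma euler_tendsto: "(euler \<longlongrightarrow> 1) (nhds 0)"
proof -
  have "euler holomorphic_on ball 0 1"
    using euler_holomorphic[of "\<lambda>z. z" "ball 0 1"] by (simp add: holomorphic_intros)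
  hence "isCont euler 0"
    using holomorphic_on_imp_continuous_on continuous_on_eq_continuous_at[of "ball 0 1"] by fastforce
  thus ?thesis by (simp add: continuous_at tendsto_nhds_iff)
qed

definition E4q :: "complex \<Rightarrow> complex" where
  "E4q q = 1 + 240 * (\<Sum>n. of_nat (\<Sum>d | d dvd Suc n. d ^ 3) * q ^ Suc n)"

lemma eisenstein_E4_eq_E4q: "eisenstein_E4 \<tau> = E4q (q_of \<tau>)"
  by (simp add: eisenstein_E4_def E4q_def)

definition E4_coeff :: "nat \<Rightarrow> complex" where
  "E4_coeff n = (if n = 0 then 1 else 240 * of_nat (\<Sum>d | d dvd n. d ^ 3))"

lemma E4q_sums:
  assumes "norm q < 1"
  shows "(\<lambda>n. E4_coeff n * q ^ n) sums E4q q"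
proof -
  have "(\<lambda>n. 240 * (of_nat (\<Sum>d | d dvd Suc n. d ^ 3) * q ^ Suc n)) sums
      (240 * (\<Sum>n. of_nat (\<Sum>d | d dvd Suc n. d ^ 3) * q ^ Suc n))"
    using lambert_divisor_sum[OF assms] by (intro sums_mult summable_sums) (rule sums_summable)
  hence "(\<lambda>n. E4_coeff (Suc n) * q ^ Suc n) sums (E4q q - 1)"
    unfolding E4q_def E4_coeff_def by (simp only: mult.assoc if_False nat.distinct add_diff_cancel_left')
  hence "(\<lambda>n. E4_coeff (Suc n) * q ^ Suc n) sums (E4q q - E4_coeff 0 * q ^ 0)"
    by (simp add: E4_coeff_def)
  thus ?thesis by (subst (asm) sums_Suc_iff) simp
qed

lemma E4q_holomorphic: "E4q holomorphic_on ball 0 1"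
  by (rule power_series_holomorphic[of 0 1 E4_coeff]) (use E4q_sums in auto)

lemma E4q_has_fps_expansion: "E4q has_fps_expansion Abs_fps E4_coeff"
proof (rule has_fps_expansionI)
  have "eventually (\<lambda>u::complex. u \<in> ball 0 1) (nhds 0)"
    by (intro eventually_nhds_in_open) auto
  thus "\<forall>\<^sub>F u in nhds 0. (\<lambda>n. fps_nth (Abs_fps E4_coeff) n * u ^ n) sums E4q u"
    by eventually_elim (simp add: E4q_sums)
qed

text \<open>Congruence of power series modulo \<open>z ^ n\<close>, phrased for functions that are bounded near \<open>0\<close>.\<close>

definition cong0 :: "nat \<Rightarrow> (complex \<Rightarrow> complex) \<Rightarrow> (complex \<Rightarrow> complex) \<Rightarrow> bool" where
  "cong0 n f g \<longleftrightarrow> f \<in> O[at 0](\<lambda>_. 1) \<and> g \<in> O[at 0](\<lambda>_. 1) \<and> (\<lambda>z. f z - g z) \<in> O[at 0](\<lambda>z. z ^ n)"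

lemma cong0_trans: "cong0 n f g \<Longrightarrow> cong0 n g h \<Longrightarrow> cong0 n f h"
  unfolding cong0_def using sum_in_bigo(1)[of "\<lambda>z. f z - g z" _ "\<lambda>z. z ^ n" "\<lambda>z. g z - h z"] by auto

lemma cong0_add: "cong0 n f f' \<Longrightarrow> cong0 n g g' \<Longrightarrow> cong0 n (\<lambda>z. f z + g z) (\<lambda>z. f' z + g' z)"
  unfolding cong0_def
  using sum_in_bigo(1)[of "\<lambda>z. f z - f' z" _ "\<lambda>z. z ^ n" "\<lambda>z. g z - g' z"]
  by (auto intro: sum_in_bigo simp: algebra_simps)

lemma cong0_eventually_eq:
  assumes ev: "eventually (\<lambda>z. f z = f' z) (at 0)" and "cong0 n f' g"
  shows "cong0 n f g"
proof -
  have "eventually (\<lambda>z. f z - g z = f' z - g z) (at 0)" using ev by eventually_elim simp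
  from landau_o.big.in_cong[OF this] landau_o.big.in_cong[OF ev] assms(2) show ?thesis
    by (simp only: cong0_def)
qed

lemma cong0_mult:
  assumes "cong0 n f f'" "cong0 n g g'"
  shows "cong0 n (\<lambda>z. f z * g z) (\<lambda>z. f' z * g' z)"
proof -
  have "(\<lambda>z. (f z - f' z) * g z + f' z * (g z - g' z)) \<in> O[at 0](\<lambda>z. z ^ n)"
    using assms landau_o.big_mult[of "\<lambda>z. f z - f' z" _ "\<lambda>z. z ^ n" g "\<lambda>_. 1"]
      landau_o.big_mult[of f' _ "\<lambda>_. 1" "\<lambda>z. g z - g' z" "\<lambda>z. z ^ n"]
    unfolding cong0_def by (intro sum_in_bigo) auto
  moreover have "(\<lambda>z. f z * g z) \<in> O[at 0](\<lambda>_. 1)" "(\<lambda>z. f' z * g' z) \<in> O[at 0](\<lambda>_. 1)"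
    using assms landau_o.big_mult[of f _ "\<lambda>_. 1" g "\<lambda>_. 1"] landau_o.big_mult[of f' _ "\<lambda>_. 1" g' "\<lambda>_. 1"]
    by (auto simp: cong0_def)
  ultimately show ?thesis by (simp add: cong0_def algebra_simps)
qed

lemma cong0_power: "cong0 n f g \<Longrightarrow> cong0 n (\<lambda>z. f z ^ m) (\<lambda>z. g z ^ m)"
proof (induction m)
  case (Suc m)
  thus ?case using cong0_mult[of n f g "\<lambda>z. f z ^ m" "\<lambda>z. g z ^ m"] by simp
qed (simp add: cong0_def)

lemma bigo_1_of_tendsto: "(f \<longlongrightarrow> c) (at (0::complex)) \<Longrightarrow> f \<in> O[at 0](\<lambda>_. 1 :: complex)" for c :: complex
  by (rule bigoI_tendsto[of _ _ c]) auto

text \<open>In the applications to explicit polynomials the witness \<open>r\<close> is the exact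
  quotient of the difference by z^n; the long polynomials supplied in later proofs have this
  origin.\<close>

lemma cong0_poly:
  assumes "\<And>z. f z - g z = z ^ n * r z" "isCont f 0" "isCont g 0" "isCont r 0"
  shows "cong0 n f g"
proof -
  have "(\<lambda>z. z ^ n * r z) \<in> O[at 0](\<lambda>z. z ^ n)"
    using landau_o.big_mult[OF landau_o.big_refl[of "\<lambda>z. z ^ n" "at 0"] bigo_1_of_tendsto[of r "r 0"]] assms
    by (simp add: continuous_at)
  thus ?thesis using assms bigo_1_of_tendsto by (auto simp: cong0_def continuous_at)
qed

lemma cong0_refl: "isCont f 0 \<Longrightarrow> cong0 n f f"
  using bigo_1_of_tendsto[of f "f 0"] by (simp add: cong0_def continuous_at)

lemma cong0_inverse:
  assumes "cong0 n f g" "cong0 n (\<lambda>z. g z * k z) (\<lambda>_. 1)" "isCont k 0" "(f \<longlongrightarrow> c) (at 0)" "c \<noteq> 0"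
  shows "cong0 n (\<lambda>z. inverse (f z)) k"
proof -
  have 1: "((\<lambda>z. inverse (f z)) \<longlongrightarrow> inverse c) (at 0)" by (intro tendsto_inverse assms)
  hence "(\<lambda>z. inverse (f z)) \<in> O[at 0](\<lambda>_. 1)" by (rule bigo_1_of_tendsto)
  hence 2: "cong0 n (\<lambda>z. inverse (f z)) (\<lambda>z. inverse (f z))" by (simp add: cong0_def)
  have "cong0 n (\<lambda>z. f z * k z) (\<lambda>_. 1)"
    by (rule cong0_trans[OF cong0_mult[OF assms(1) cong0_refl[OF assms(3)]] assms(2)])
  from cong0_mult[OF 2 this] have "cong0 n (\<lambda>z. inverse (f z) * (f z * k z)) (\<lambda>z. inverse (f z))" by simp
  moreover have "eventually (\<lambda>z. f z \<noteq> 0) (at 0)" using assms(4,5) by (rule tendsto_imp_eventually_ne)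
  hence "eventually (\<lambda>z. inverse (f z) * (f z * k z) - inverse (f z) = k z - inverse (f z)) (at 0)"
    by eventually_elim simp
  ultimately have "(\<lambda>z. k z - inverse (f z)) \<in> O[at 0](\<lambda>z. z ^ n)"
    unfolding cong0_def by (simp only: landau_o.big.in_cong)
  thus ?thesis
    using 1 assms(3) bigo_1_of_tendsto landau_o.big.uminus_in_iff[of "\<lambda>z. k z - inverse (f z)"]
    by (auto simp: cong0_def continuous_at)
qed

lemma cong0_compose_power:
  assumes "cong0 1 f (\<lambda>_. c)" "n > 0"
  shows "cong0 n (\<lambda>z. f (z ^ n)) (\<lambda>_. c)"
proof -
  have lim: "filterlim (\<lambda>z::complex. z ^ n) (at 0) (at 0)"
    using assms(2) by (intro filterlim_atI tendsto_eq_intros) (auto simp: eventually_at_filter)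
  have "(\<lambda>z. f z - c) \<in> O[at 0](\<lambda>z. z)" "f \<in> O[at 0](\<lambda>_. 1)"
    using assms by (auto simp: cong0_def)
  from landau_o.big.compose[OF this(1) lim] landau_o.big.compose[OF this(2) lim]
  show ?thesis by (simp add: cong0_def)
qed

lemma cong0_of_fps:
  assumes "f has_fps_expansion F"
  shows "cong0 2 f (\<lambda>z. fps_nth F 0 + fps_nth F 1 * z)"
proof -
  have cont: "(f \<longlongrightarrow> fps_nth F 0) (at 0)"
    using has_fps_expansion_imp_tendsto_0[OF assms] by (rule tendsto_mono[rotated]) (simp add: at_within_def)
  define G where "G = F - (fps_const (fps_nth F 0) + fps_const (fps_nth F 1) * fps_X)"
  have G: "(\<lambda>z. f z - (fps_nth F 0 + fps_nth F 1 * z)) has_fps_expansion G"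
    unfolding G_def by (intro fps_expansion_intros assms)
  have "(\<lambda>z. f z - (fps_nth F 0 + fps_nth F 1 * z)) \<in> O[at 0](\<lambda>z. z ^ 2)"
  proof (cases "G = 0")
    case True
    hence "eventually (\<lambda>z. f z - (fps_nth F 0 + fps_nth F 1 * z) = 0) (nhds 0)" using G by (simp only: has_fps_expansion_0_iff)
    hence "eventually (\<lambda>z. f z - (fps_nth F 0 + fps_nth F 1 * z) = 0) (at 0)" by (simp add: eventually_at_filter eventually_mono)
    from landau_o.big.in_cong[OF this] show ?thesis by (simp only: zero_in_bigo)
  next
    case False
    have "fps_nth G k = 0" if "k < 2" for k using that by (auto simp: G_def less_Suc_eq numeral_2_eq_2)
    hence "2 \<le> subdegree G" using False by (intro subdegree_geI) auto
    hence "(\<lambda>x. if x = 0 then fps_nth G 2 else (f x - (fps_nth F 0 + fps_nth F 1 * x)) / x ^ 2) has_fps_expansion fps_shift 2 G"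
      by (intro has_fps_expansion_shift G refl)
    hence "((\<lambda>x. if x = 0 then fps_nth G 2 else (f x - (fps_nth F 0 + fps_nth F 1 * x)) / x ^ 2) \<longlongrightarrow> fps_nth (fps_shift 2 G) 0) (at 0)"
      by (rule tendsto_mono[OF _ has_fps_expansion_imp_tendsto_0, rotated]) (simp add: at_within_def)
    hence "((\<lambda>x. (f x - (fps_nth F 0 + fps_nth F 1 * x)) / x ^ 2) \<longlongrightarrow> fps_nth (fps_shift 2 G) 0) (at 0)"
      by (rule Lim_transform_eventually) (auto simp: eventually_at_filter)
    thus ?thesis by (rule bigoI_tendsto) (auto simp: eventually_at_filter)
  qed
  moreover have "((\<lambda>z. fps_nth F 0 + fps_nth F 1 * z) \<longlongrightarrow> fps_nth F 0) (at 0)" by (auto intro!: tendsto_eq_intros)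
  ultimately show ?thesis using bigo_1_of_tendsto[OF cont] bigo_1_of_tendsto by (auto simp: cong0_def)
qed

lemma cong0_E4q: "cong0 2 E4q (\<lambda>z. 1 + 240 * z)"
  using cong0_of_fps[OF E4q_has_fps_expansion] by (simp add: E4_coeff_def)

lemma cong0_mono: "cong0 n f g \<Longrightarrow> m \<le> n \<Longrightarrow> cong0 m f g"
proof -
  assume f: "cong0 n f g" and m: "m \<le> n"
  have "((\<lambda>z::complex. z ^ (n - m)) \<longlongrightarrow> 0 ^ (n - m)) (at 0)" by (intro tendsto_intros)
  hence "(\<lambda>z. z ^ m * z ^ (n - m)) \<in> O[at 0](\<lambda>z::complex. z ^ m * 1)"
    by (intro landau_o.big_mult bigo_1_of_tendsto) auto
  hence "(\<lambda>z. z ^ n) \<in> O[at 0](\<lambda>z::complex. z ^ m)" using m by (simp flip: power_add)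
  thus ?thesis using f landau_o.big_trans unfolding cong0_def by blast
qed

text \<open>The bound is uniform in q, so that w = q^n may move together with q. It comes from
  comparing the product with exp x for x = 2 norm w, the sum of the geometric majorant.\<close>

lemma norm_qpoch_minus_1_le:
  assumes "norm q \<le> 1 / 2" "norm w \<le> 1"
  shows "norm (qpoch w q - 1) \<le> 2 * exp 2 * norm w"
proof (rule tendsto_upperbound)
  have q: "norm q < 1" using assms by simp
  show "(\<lambda>m. norm ((\<Prod>n<m. 1 - w * q ^ n) - 1)) \<longlonglongrightarrow> norm (qpoch w q - 1)"
    by (intro tendsto_intros qpoch_LIMSEQ q)
  have "norm ((\<Prod>n<m. 1 - w * q ^ n) - 1) \<le> 2 * exp 2 * norm w" for m
  proof -
    define x where "x = 2 * norm w"
    have "norm ((\<Prod>n<m. 1 - w * q ^ n) - 1) \<le> (\<Prod>n<m. 1 + norm (- w * q ^ n)) - 1"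
      using norm_prod_minus1_le_prod_minus1[of "\<lambda>n. - w * q ^ n" "{..<m}"] by simp
    also have "\<dots> \<le> exp x - 1"
    proof -
      have "(\<Prod>n<m. 1 + norm (- w * q ^ n)) \<le> exp (\<Sum>n<m. norm (- w * q ^ n))"
      by (rule prod_le_exp_sum) simp
      moreover have "(\<Sum>n<m. norm (- w * q ^ n)) = norm w * (\<Sum>n<m. norm q ^ n)"
        by (simp add: norm_mult norm_power sum_distrib_left)
      moreover have "(\<Sum>n<m. norm q ^ n) \<le> (\<Sum>n<m. (1 / 2) ^ n)"
        by (intro sum_mono power_mono assms) auto
      moreover have "(\<Sum>n<m. (1 / 2 :: real) ^ n) \<le> 2"
        using geometric_sum[of "1 / 2 :: real" m] by simp
      ultimately have "(\<Sum>n<m. norm (- w * q ^ n)) \<le> x"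
        unfolding x_def by (simp add: mult.commute[of 2] mult_left_mono)
      hence "exp (\<Sum>n<m. norm (- w * q ^ n)) \<le> exp x" by simp
      thus ?thesis using \<open>(\<Prod>n<m. 1 + norm (- w * q ^ n)) \<le> exp (\<Sum>n<m. norm (- w * q ^ n))\<close> by linarith
    qed
    also have "exp x - 1 \<le> x * exp x"
      using mult_right_mono[OF exp_ge_add_one_self[of "- x"], of "exp x"] by (simp add: algebra_simps exp_minus)
    also have "\<dots> \<le> x * exp 2" using assms by (intro mult_left_mono) (auto simp: x_def)
    finally show ?thesis by (simp add: x_def mult_ac)
  qed
  thus "\<forall>\<^sub>F m in sequentially. norm ((\<Prod>n<m. 1 - w * q ^ n) - 1) \<le> 2 * exp 2 * norm w" by simp
qed simp

lemma cong0_qpoch_power: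
  assumes "n > 0"
  shows "cong0 n (\<lambda>q. qpoch (q ^ n) q) (\<lambda>_. 1)"
proof -
  have "(\<lambda>q. qpoch (q ^ n) q) holomorphic_on ball 0 1" by (intro holomorphic_intros) auto
  hence "isCont (\<lambda>q. qpoch (q ^ n) q) 0"
    using holomorphic_on_imp_continuous_on continuous_on_eq_continuous_at[of "ball 0 1"] by fastforce
  hence "(\<lambda>q. qpoch (q ^ n) q) \<in> O[at 0](\<lambda>_. 1)"
    by (intro bigo_1_of_tendsto) (auto simp: continuous_at)
  moreover have "(\<lambda>q. qpoch (q ^ n) q - 1) \<in> O[at 0](\<lambda>q. q ^ n)"
  proof (rule bigoI[of _ "2 * exp 2"])
    have "eventually (\<lambda>q::complex. q \<in> ball 0 (1 / 2)) (at 0)"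
      by (intro eventually_at_in_open') auto
    thus "\<forall>\<^sub>F q in at 0. norm (qpoch (q ^ n) q - 1) \<le> 2 * exp 2 * norm (q ^ n)"
      by eventually_elim (intro norm_qpoch_minus_1_le, auto simp: norm_power intro!: power_le_one)
  qed
  ultimately show ?thesis by (simp add: cong0_def)
qed

text \<open>These are the first terms of Euler's pentagonal series, found by splitting off four
  factors. Precision q^5 is exactly what level 5 requires.\<close>

lemma cong0_euler: "cong0 5 euler (\<lambda>q. 1 - q - q ^ 2)"
proof -
  have eq: "euler q = (1 - q) * (1 - q ^ 2) * (1 - q ^ 3) * (1 - q ^ 4) * qpoch (q ^ 5) q" if "norm q < 1" for q
    unfolding euler_def
    by (subst qpoch_rec[OF that, of q], subst qpoch_rec[OF that, of "q * q"],
        subst qpoch_rec[OF that, of "q * q * q"], subst qpoch_rec[OF that, of "q * q * q * q"])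
      (simp add: eval_nat_numeral mult_ac)
  have "eventually (\<lambda>q::complex. q \<in> ball 0 1) (at 0)" by (intro eventually_at_in_open') auto
  hence ev: "eventually (\<lambda>q. euler q = (1 - q) * (1 - q ^ 2) * (1 - q ^ 3) * (1 - q ^ 4) * qpoch (q ^ 5) q) (at 0)"
    by eventually_elim (simp add: eq)
  have "cong0 5 (\<lambda>q. (1 - q) * (1 - q ^ 2) * (1 - q ^ 3) * (1 - q ^ 4) * qpoch (q ^ 5) q)
      (\<lambda>q. (1 - q) * (1 - q ^ 2) * (1 - q ^ 3) * (1 - q ^ 4) * 1)"
    by (intro cong0_mult cong0_qpoch_power cong0_refl continuous_intros) auto
  moreover have "cong0 5 (\<lambda>q. (1 - q) * (1 - q ^ 2) * (1 - q ^ 3) * (1 - q ^ 4) * 1) (\<lambda>q. 1 - q - q ^ 2)"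
    by (rule cong0_poly[where r = "\<lambda>q. 2 - q ^ 3 - q ^ 4 + q ^ 5"])
      (simp add: algebra_simps eval_nat_numeral, intro continuous_intros, intro continuous_intros, intro continuous_intros)
  ultimately have "cong0 5 (\<lambda>q. (1 - q) * (1 - q ^ 2) * (1 - q ^ 3) * (1 - q ^ 4) * qpoch (q ^ 5) q) (\<lambda>q. 1 - q - q ^ 2)"
    by (rule cong0_trans)
  thus ?thesis by (rule cong0_eventually_eq[OF ev])
qed

lemma cong0_diff: "cong0 n f f' \<Longrightarrow> cong0 n g g' \<Longrightarrow> cong0 n (\<lambda>z. f z - g z) (\<lambda>z. f' z - g' z)"
  using cong0_add[of n f f' "\<lambda>z. - 1 * g z" "\<lambda>z. - 1 * g' z"] cong0_mult[of n "\<lambda>_. - 1" "\<lambda>_. - 1" g g']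
    cong0_refl[of "\<lambda>_. - 1" n] by simp

lemma cong0_sum: "(\<And>i. i \<in> I \<Longrightarrow> cong0 n (f i) (g i)) \<Longrightarrow> cong0 n (\<lambda>z. \<Sum>i\<in>I. f i z) (\<lambda>z. \<Sum>i\<in>I. g i z)"
proof (induction I rule: infinite_finite_induct)
  case (insert i I)
  hence "cong0 n (\<lambda>z. f i z + (\<Sum>i\<in>I. f i z)) (\<lambda>z. g i z + (\<Sum>i\<in>I. g i z))"
    by (intro cong0_add) auto
  thus ?case using insert by simp
qed (simp_all add: cong0_def)

lemma cong0_zeroI: "isCont r 0 \<Longrightarrow> cong0 n (\<lambda>z. z ^ n * r z) (\<lambda>_. 0)"
  by (rule cong0_poly) (auto intro!: continuous_intros)

lemma cong0_linear_mult:
  assumes "cong0 2 f (\<lambda>z. 1 + a * z)" "cong0 2 g (\<lambda>z. 1 + b * z)"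
  shows "cong0 2 (\<lambda>z. f z * g z) (\<lambda>z. 1 + (a + b) * z)"
proof (rule cong0_trans[OF cong0_mult[OF assms]])
  show "cong0 2 (\<lambda>z. (1 + a * z) * (1 + b * z)) (\<lambda>z. 1 + (a + b) * z)"
    by (rule cong0_poly[where r = "\<lambda>_. a * b"])
      (auto intro!: continuous_intros simp: algebra_simps power2_eq_square)
qed

lemma cong0_linear_power:
  assumes "cong0 2 f (\<lambda>z. 1 + a * z)"
  shows "cong0 2 (\<lambda>z. f z ^ n) (\<lambda>z. 1 + (of_nat n * a) * z)"
proof (induction n)
  case (Suc n)
  from cong0_linear_mult[OF assms Suc] show ?case by (simp add: algebra_simps)
qed (simp add: cong0_refl)

lemma cong0_linear_inverse:
  assumes "cong0 2 f (\<lambda>z. 1 + a * z)" "(f \<longlongrightarrow> 1) (at 0)"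
  shows "cong0 2 (\<lambda>z. inverse (f z)) (\<lambda>z. 1 + (- a) * z)"
proof (rule cong0_inverse[OF assms(1) _ _ assms(2)])
  show "cong0 2 (\<lambda>z. (1 + a * z) * (1 + (- a) * z)) (\<lambda>_. 1)"
    by (rule cong0_poly[where r = "\<lambda>_. - a * a"])
      (auto intro!: continuous_intros simp: algebra_simps power2_eq_square)
qed (auto intro!: continuous_intros)

lemma cong0_1_linear: "cong0 2 f (\<lambda>z. 1 + a * z) \<Longrightarrow> cong0 1 f (\<lambda>_. 1)"
  by (rule cong0_trans[OF cong0_mono], assumption, simp, rule cong0_poly[where r = "\<lambda>_. a"])
    (auto intro!: continuous_intros)

lemma cong0_2_euler: "cong0 2 euler (\<lambda>q. 1 + (- 1) * q)"
proof (rule cong0_trans[OF cong0_mono[OF cong0_euler]])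
  show "cong0 2 (\<lambda>q. 1 - q - q ^ 2) (\<lambda>q. 1 + (- 1) * q)"
    by (rule cong0_poly[where r = "\<lambda>_. - 1"]) (auto intro!: continuous_intros)
qed simp

text \<open>This is q j, which is regular at the cusp. The constant 744 is its linear coefficient, 3
  * 240 from E4^3 plus 24 from the inverse of the product.\<close>

definition jq :: "complex \<Rightarrow> complex" where
  "jq q = E4q q ^ 3 * inverse (euler q ^ 24)"

lemma cong0_jq: "cong0 2 jq (\<lambda>q. 1 + 744 * q)"
proof -
  have lim: "((\<lambda>q. euler q ^ 24) \<longlongrightarrow> 1) (at 0)"
    using tendsto_power[OF tendsto_mono[OF _ euler_tendsto], of "at 0" 24] by (simp add: at_within_def)
  have "cong0 2 (\<lambda>q. E4q q ^ 3) (\<lambda>q. 1 + 720 * q)"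
    using cong0_linear_power[OF cong0_E4q, of 3] by simp
  moreover have "cong0 2 (\<lambda>q. euler q ^ 24) (\<lambda>q. 1 + (- 24) * q)"
    using cong0_linear_power[OF cong0_2_euler, of 24] by simp
  from cong0_linear_inverse[OF this lim] have "cong0 2 (\<lambda>q. inverse (euler q ^ 24)) (\<lambda>q. 1 + 24 * q)" by simp
  ultimately have "cong0 2 (\<lambda>q. E4q q ^ 3 * inverse (euler q ^ 24)) (\<lambda>q. 1 + (720 + 24) * q)"
    by (rule cong0_linear_mult)
  thus ?thesis unfolding jq_def by simp
qed

lemma q_of_tendsto_0: "filterlim q_of (at 0) at_i_infinity"
proof (rule filterlim_atI)
  have "filterlim Im at_top at_i_infinity" unfolding at_i_infinity_def by (rule filterlim_filtercomap)
  hence "filterlim (\<lambda>t. 2 * pi * Im t) at_top at_i_infinity"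
    by (intro filterlim_tendsto_pos_mult_at_top[OF tendsto_const]) auto
  hence "((\<lambda>t. exp (- (2 * pi * Im t))) \<longlongrightarrow> 0) at_i_infinity"
    by (intro filterlim_compose[OF exp_at_bot] filterlim_compose[OF filterlim_uminus_at_bot_at_top])
  hence "((\<lambda>t. norm (q_of t)) \<longlongrightarrow> 0) at_i_infinity" by (simp add: norm_q_of)
  thus "(q_of \<longlongrightarrow> 0) at_i_infinity" by (rule tendsto_norm_zero_cancel)
qed simp

lemma q_of_scaled_tendsto_0:
  assumes "r > 0"
  shows "filterlim (\<lambda>t. q_of (of_real r * t)) (at 0) at_i_infinity"
proof (rule filterlim_compose[OF q_of_tendsto_0])
  show "filterlim (\<lambda>t. of_real r * t) at_i_infinity at_i_infinity"
    unfolding filterlim_iff eventually_at_i_infinity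
  proof safe
    fix P Y assume "\<forall>t. Y < Im t \<longrightarrow> P t"
    thus "\<exists>Y. \<forall>t. Y < Im t \<longrightarrow> P (of_real r * t)"
      using assms by (intro exI[of _ "Y / r"]) (auto simp: field_simps)
  qed
qed

section \<open>Transformation behaviour of j and of the prime level Hauptmoduln\<close>

definition eta6 :: "complex \<Rightarrow> complex" where
  "eta6 t = dedekind_eta t ^ 6"

lemma dedekind_eta_eq_euler:
  "dedekind_eta t = exp (2 * of_real pi * \<i> * t / 24) * euler (q_of t)"
  by (simp add: dedekind_eta_altdef euler_def)

lemma dedekind_eta_nz: "Im t > 0 \<Longrightarrow> dedekind_eta t \<noteq> 0"
  by (simp add: dedekind_eta_eq_euler euler_nz norm_q_of_less_1)

lemma dedekind_eta_holomorphic [holomorphic_intros]: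
  assumes "f holomorphic_on A" "open A" "\<And>z. z \<in> A \<Longrightarrow> Im (f z) > 0"
  shows "(\<lambda>z. dedekind_eta (f z)) holomorphic_on A"
  unfolding dedekind_eta_eq_euler
  by (intro holomorphic_intros assms) (use assms in \<open>auto intro: norm_q_of_less_1\<close>)

lemma eta6_eq_euler: "eta6 t = exp (\<i> * pi * t / 2) * euler (q_of t) ^ 6"
proof -
  have "exp (2 * of_real pi * \<i> * t / 24) ^ 6 = exp (\<i> * pi * t / 2)"
    unfolding exp_of_nat_mult[symmetric] by (rule arg_cong[of _ _ exp]) simp
  thus ?thesis by (simp add: eta6_def dedekind_eta_eq_euler power_mult_distrib)
qed

lemma eta6_nz: "Im t > 0 \<Longrightarrow> eta6 t \<noteq> 0"
  by (simp add: eta6_def dedekind_eta_nz)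

lemma eta6_plus_1: "eta6 (t + 1) = \<i> * eta6 t"
proof -
  have "q_of 1 = 1" by (simp add: q_of_eq_1_iff)
  moreover have "exp (\<i> * pi * (t + 1) / 2) = exp (\<i> * pi / 2) * exp (\<i> * pi * t / 2)"
    unfolding exp_add[symmetric] by (rule arg_cong[of _ _ exp]) (simp add: field_simps)
  ultimately show ?thesis by (simp add: eta6_eq_euler q_of_add)
qed

lemma eta6_plus_nat: "eta6 (t + of_nat n) = \<i> ^ n * eta6 t"
proof (induction n)
  case (Suc n)
  thus ?case using eta6_plus_1[of "t + of_nat n"] by (simp add: add_ac)
qed simp

lemma eta6_inversion: "Im t > 0 \<Longrightarrow> eta6 (- 1 / t) = \<i> * t ^ 3 * eta6 t"
  unfolding eta6_def by (rule dedekind_eta_inversion)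

lemma klein_j_eq_eta6: "klein_j t = eisenstein_E4 t ^ 3 / eta6 t ^ 4"
  by (simp add: klein_j_def eta6_def flip: power_mult)

lemma klein_j_plus_1: "klein_j (t + 1) = klein_j t"
proof -
  have "q_of 1 = 1" by (simp add: q_of_eq_1_iff)
  thus ?thesis by (simp add: klein_j_eq_eta6 eta6_plus_1 eisenstein_E4_eq_E4q q_of_add power_mult_distrib)
qed

lemma klein_j_inversion:
  assumes "Im t > 0"
  shows "klein_j (- 1 / t) = klein_j t"
proof -
  have "t \<noteq> 0" using assms by auto
  thus ?thesis
    by (simp add: klein_j_eq_eta6 eta6_inversion[OF assms, unfolded minus_divide_left[symmetric]]
        eisenstein_E4_inversion[OF assms, unfolded minus_divide_left[symmetric]] power_mult_distrib flip: power_mult)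
qed

lemma klein_j_eq_jq:
  "klein_j t = jq (q_of t) / q_of t"
proof -
  have "exp (\<i> * pi * t / 2) ^ 4 = q_of t"
    unfolding exp_of_nat_mult[symmetric] q_of_def by (rule arg_cong[of _ _ exp]) simp
  moreover have "(euler (q_of t) ^ 6) ^ 4 = euler (q_of t) ^ 24" by (simp flip: power_mult)
  ultimately have "eta6 t ^ 4 = q_of t * euler (q_of t) ^ 24" by (simp only: eta6_eq_euler power_mult_distrib)
  thus ?thesis by (simp add: klein_j_eq_eta6 eisenstein_E4_eq_E4q jq_def divide_inverse)
qed

lemma klein_j_holomorphic: "klein_j holomorphic_on {t. Im t > 0}"
proof -
  have "E4q \<circ> q_of holomorphic_on {t. Im t > 0}"
    by (rule holomorphic_on_compose_gen[OF _ E4q_holomorphic])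
      (auto intro!: holomorphic_intros norm_q_of_less_1)
  hence "(\<lambda>t. E4q (q_of t)) holomorphic_on {t. Im t > 0}" by (simp add: o_def)
  thus ?thesis unfolding klein_j_def[abs_def] eisenstein_E4_eq_E4q
    by (intro holomorphic_intros open_upper_half) (auto simp: dedekind_eta_nz)
qed

text \<open>One formula for x_2, x_3, x_5, with m = 4, 2, 1. The relation m (p - 1) = 4 makes the
  leading power of q equal to 1 and cancels the powers of i under t \<mapsto> t + 1.\<close>

definition hpt :: "nat \<Rightarrow> nat \<Rightarrow> complex \<Rightarrow> complex" where
  "hpt p m t = of_nat p ^ (3 * m) * (eta6 (of_nat p * t) / eta6 t) ^ m"

text \<open>The Hauptmodul seen from the other cusp, as the composition of \<open>hpt p m\<close>
  with t \<mapsto> - 1 / t. It has period p, so its local parameter is q^(1/p).\<close>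

definition hpt_cusp0 :: "nat \<Rightarrow> nat \<Rightarrow> complex \<Rightarrow> complex" where
  "hpt_cusp0 p m t = (eta6 (t / of_nat p) / eta6 t) ^ m"

lemma hpt_nz: "Im t > 0 \<Longrightarrow> p > 0 \<Longrightarrow> hpt p m t \<noteq> 0"
  by (simp add: hpt_def eta6_nz)

lemma hpt_inversion:
  assumes t: "Im t > 0" and p: "p > 0"
  shows "hpt p m (- 1 / t) = hpt_cusp0 p m t"
proof -
  have [simp]: "t \<noteq> 0" using t by auto
  have "eta6 (- 1 / (t / of_nat p)) = \<i> * (t / of_nat p) ^ 3 * eta6 (t / of_nat p)"
    using t p by (intro eta6_inversion) simp
  moreover have "- 1 / (t / of_nat p) = of_nat p * (- 1 / t)" by simp
  ultimately have "eta6 (of_nat p * (- 1 / t)) = \<i> * (t / of_nat p) ^ 3 * eta6 (t / of_nat p)" by (simp only:)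
  hence "hpt p m (- 1 / t) = of_nat p ^ (3 * m) *
      (\<i> * (t / of_nat p) ^ 3 * eta6 (t / of_nat p) / (\<i> * t ^ 3 * eta6 t)) ^ m"
    by (simp only: hpt_def eta6_inversion[OF t])
  also have "\<dots> = (of_nat p ^ 3 * (\<i> * (t / of_nat p) ^ 3 * eta6 (t / of_nat p) / (\<i> * t ^ 3 * eta6 t))) ^ m"
    by (simp only: power_mult_distrib power_mult)
  also have "of_nat p ^ 3 * (\<i> * (t / of_nat p) ^ 3 * eta6 (t / of_nat p) / (\<i> * t ^ 3 * eta6 t)) =
      eta6 (t / of_nat p) / eta6 t"
    using p eta6_nz[OF t] by (simp add: field_simps)
  finally show ?thesis by (simp add: hpt_cusp0_def)
qed

lemma i_power_level:
  assumes "m * (p - 1) = 4" "p > 0"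
  shows "(\<i> ^ p) ^ m = \<i> ^ m"
proof -
  have "p * m = m + 4" using assms by (metis Suc_diff_1 add.commute mult.commute mult_Suc_right)
  thus ?thesis by (simp add: power_add flip: power_mult)
qed

lemma hpt_plus_1:
  assumes "m * (p - 1) = 4" "p > 0" "Im t > 0"
  shows "hpt p m (t + 1) = hpt p m t"
  using eta6_plus_nat[of "of_nat p * t" p] i_power_level[OF assms(1,2)] eta6_plus_1[of t]
  by (simp add: hpt_def distrib_left power_divide power_mult_distrib)

lemma hpt_cusp0_plus:
  assumes "m * (p - 1) = 4" "p > 0" "Im t > 0"
  shows "hpt_cusp0 p m (t + of_nat p) = hpt_cusp0 p m t"
  using eta6_plus_nat[of t p] i_power_level[OF assms(1,2)] eta6_plus_1[of "t / of_nat p"] assms(2)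
  by (simp add: hpt_cusp0_def add_divide_distrib power_divide power_mult_distrib)

lemma hpt_eq_euler:
  assumes "m * (p - 1) = 4" "p > 0"
  shows "hpt p m t = of_nat p ^ (3 * m) * q_of t * (euler (q_of t ^ p) / euler (q_of t)) ^ (6 * m)"
proof -
  have "of_nat m * (of_nat p - 1) = (4 :: complex)"
    using assms by (metis of_nat_diff of_nat_mult of_nat_numeral of_nat_1 One_nat_def Suc_leI)
  hence e: "(exp (\<i> * pi * (of_nat p * t) / 2) / exp (\<i> * pi * t / 2)) ^ m = q_of t"
    unfolding exp_diff[symmetric] exp_of_nat_mult[symmetric] q_of_def
    by (intro arg_cong[of _ _ exp]) (simp add: field_simps, algebra)
  have "hpt p m t = of_nat p ^ (3 * m) * (exp (\<i> * pi * (of_nat p * t) / 2) / exp (\<i> * pi * t / 2)) ^ m *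
      ((euler (q_of t ^ p) / euler (q_of t)) ^ 6) ^ m"
    by (simp add: hpt_def eta6_eq_euler q_of_mult_nat power_divide power_mult_distrib)
  thus ?thesis unfolding e by (simp add: power_mult)
qed

lemma hpt_cusp0_eq_euler:
  assumes "m * (p - 1) = 4" "p > 0"
  shows "hpt_cusp0 p m (of_nat p * t) = (euler (q_of t) / euler (q_of t ^ p)) ^ (6 * m) / q_of t"
proof -
  have "hpt_cusp0 p m (of_nat p * t) = (eta6 t / eta6 (of_nat p * t)) ^ m"
    using assms by (simp add: hpt_cusp0_def)
  also have "\<dots> = of_nat p ^ (3 * m) / hpt p m t"
    using assms(2) by (simp add: hpt_def power_divide)
  also have "\<dots> = (euler (q_of t) / euler (q_of t ^ p)) ^ (6 * m) / q_of t"
    using assms(2) unfolding hpt_eq_euler[OF assms] by (simp add: power_divide)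
  finally show ?thesis .
qed

lemma hpt_holomorphic: "p > 0 \<Longrightarrow> hpt p m holomorphic_on {t. Im t > 0}"
  unfolding hpt_def[abs_def] eta6_def
  by (intro holomorphic_on_mult holomorphic_on_const holomorphic_on_power holomorphic_on_divide
      dedekind_eta_holomorphic holomorphic_on_ident open_upper_half) (auto simp: dedekind_eta_nz)

lemma isCont_of_holomorphic_ball: "f holomorphic_on ball 0 1 \<Longrightarrow> isCont f 0" for f :: "complex \<Rightarrow> complex"
  by (rule continuous_on_interior[OF holomorphic_on_imp_continuous_on]) auto

text \<open>The parameters describe \<open>j = c / x + (744 + 6 m) + x * (\<Sum>i<p. r i * x ^ i)\<close>.
  At the cusp \<open>i\<infinity>\<close> the difference vanishes because of the constant term \<open>744 + 6 m\<close>; at the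
  cusp \<open>0\<close> the hypothesis \<open>cusp0\<close> says that the difference has no pole.\<close>

theorem level_identity:
  assumes p: "p \<ge> 2" "m * (p - 1) = 4"
    and middle: "\<And>t k. 2 \<le> k \<Longrightarrow> k + 2 \<le> p \<Longrightarrow> Im t > 0 \<Longrightarrow>
        hpt_cusp0 p m (- 1 / t + of_nat k) = hpt_cusp0 p m (t + of_nat k)"
    and cusp0: "cong0 p (\<lambda>q. euler q ^ (6 * m) * (\<Sum>i<p. r i * (euler q ^ (6 * m)) ^ i * q ^ (p - 1 - i))) (\<lambda>_. 1)"
    and t: "Im t > 0"
  shows "klein_j t = of_nat p ^ (3 * m) / hpt p m t + (744 + 6 * of_nat m) + hpt p m t * (\<Sum>i<p. r i * hpt p m t ^ i)"
proof -
  define c :: complex where "c = of_nat p ^ (3 * m)"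
  define J where "J x = c / x + (744 + 6 * of_nat m) + x * (\<Sum>i<p. r i * x ^ i)" for x
  define f where "f t = klein_j t - J (hpt p m t)" for t
  have p0: "p > 0" using p by simp
  have c0: "c \<noteq> 0" using p0 by (simp add: c_def)
  have f_inv: "f (- 1 / t) = klein_j t - J (hpt_cusp0 p m t)" if "Im t > 0" for t
    unfolding f_def klein_j_inversion[OF that] hpt_inversion[OF that p0] ..
  have hol_e: "(\<lambda>q. euler q) holomorphic_on ball 0 1" "(\<lambda>q. euler (q ^ p)) holomorphic_on ball 0 1"
    using p0 by (auto intro!: holomorphic_intros simp: norm_power power_less_one_iff)
  have norm_qp: "norm (q ^ p) < 1" if "norm q < 1" for q :: complex
    using that p0 by (simp add: norm_power power_less_one_iff)
  define U where "U q = euler (q ^ p) ^ (6 * m)" for q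
  define V where "V q = euler q ^ (6 * m)" for q
  have hol_U: "U holomorphic_on ball 0 1" and hol_V: "V holomorphic_on ball 0 1"
    unfolding U_def V_def by (intro holomorphic_intros hol_e)+
  have U_nz: "U q \<noteq> 0" if "norm q < 1" for q using euler_nz[OF norm_qp[OF that]] by (simp add: U_def)
  have V_nz: "V q \<noteq> 0" if "norm q < 1" for q using euler_nz[OF that] by (simp add: V_def)
  have U0: "U 0 = 1" and V0: "V 0 = 1" using p0 by (simp_all add: U_def V_def power_0_left)
  have limU: "(U \<longlongrightarrow> 1) (at 0)" and limV: "(V \<longlongrightarrow> 1) (at 0)"
    using isCont_of_holomorphic_ball[OF hol_U] isCont_of_holomorphic_ball[OF hol_V] U0 V0
    by (simp_all add: continuous_at)
  have cU: "cong0 p U (\<lambda>_. 1)"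
    using cong0_power[OF cong0_compose_power[OF cong0_1_linear[OF cong0_2_euler] p0], of "6 * m"]
    by (simp add: U_def[abs_def])
  have cUi: "cong0 p (\<lambda>q. inverse (U q)) (\<lambda>_. 1)"
    by (rule cong0_inverse[OF cU _ _ limU]) (auto intro!: continuous_intros cong0_refl)
  have cV: "cong0 2 V (\<lambda>q. 1 + (- (6 * of_nat m)) * q)"
    using cong0_linear_power[OF cong0_2_euler, of "6 * m"] by (simp add: V_def[abs_def])
  have "\<exists>B. eventually (\<lambda>t. norm (f (- 1 / t)) \<le> B) at_i_infinity"
  proof -
    \<comment> \<open>With q = \<open>q_of (t / p)\<close> the Hauptmodul at the cusp 0 is W q / q
      and j is \<open>jq (q ^ p) / q ^ p\<close>. \<open>D\<close> is the difference multiplied by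
      q^p, so boundedness of the difference means that \<open>D\<close> is O(q^p).\<close>
    define W where "W q = V q * inverse (U q)" for q
    define D where "D q = jq (q ^ p) - (q ^ p * (c * q * inverse (W q) + (744 + 6 * of_nat m)) +
        W q * (\<Sum>i<p. r i * W q ^ i * q ^ (p - 1 - i)))" for q
    have hol_W: "W holomorphic_on ball 0 1"
      unfolding W_def by (intro holomorphic_intros hol_U hol_V) (auto simp: U_nz)
    have W_nz: "W q \<noteq> 0" if "norm q < 1" for q using V_nz[OF that] U_nz[OF that] by (simp add: W_def)
    have cVV: "cong0 p V V" by (intro cong0_refl isCont_of_holomorphic_ball hol_V)
    \<comment> \<open>\<open>U\<close> is 1 modulo q^p, so \<open>W\<close> may be replaced by
      \<open>V\<close>; this reduces the claim to the hypothesis \<open>cusp0\<close>, a congruence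
      for one power of the Euler product.\<close>
    have cW: "cong0 p W V" unfolding W_def using cong0_mult[OF cVV cUi] by simp
    have "cong0 p (\<lambda>q. W q * (\<Sum>i<p. r i * W q ^ i * q ^ (p - 1 - i))) (\<lambda>q. V q * (\<Sum>i<p. r i * V q ^ i * q ^ (p - 1 - i)))"
      by (intro cong0_mult cW cong0_sum cong0_power cong0_refl continuous_intros)
    from cong0_trans[OF this cusp0[folded V_def]]
    have "cong0 p (\<lambda>q. W q * (\<Sum>i<p. r i * W q ^ i * q ^ (p - 1 - i))) (\<lambda>_. 1)" .
    moreover have "cong0 p (\<lambda>q. q ^ p * (c * q * inverse (W q) + (744 + 6 * of_nat m))) (\<lambda>_. 0)"
      by (intro cong0_zeroI isCont_of_holomorphic_ball holomorphic_intros hol_W) (auto simp: W_nz)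
    moreover have "cong0 p (\<lambda>q. jq (q ^ p)) (\<lambda>_. 1)"
      by (rule cong0_compose_power[OF cong0_1_linear[OF cong0_jq] p0])
    ultimately have "cong0 p D (\<lambda>_. 1 - (0 + 1))"
      unfolding D_def by (intro cong0_diff cong0_add)
    hence "D \<in> O[at 0](\<lambda>q. q ^ p)" by (simp add: cong0_def)
    hence "(\<lambda>q. D q * inverse (q ^ p)) \<in> O[at 0](\<lambda>q. q ^ p * inverse (q ^ p))" by (intro landau_o.big_mult) auto
    moreover have "(\<lambda>q. q ^ p * inverse (q ^ p)) \<in> O[at 0](\<lambda>q::complex. 1 :: complex)"
      by (rule bigoI[of _ 1]) (auto simp: eventually_at_filter)
    ultimately have "(\<lambda>q. D q * inverse (q ^ p)) \<in> O[at 0](\<lambda>q. 1)" by (rule landau_o.big_trans)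
    then obtain B where B: "eventually (\<lambda>q. norm (D q * inverse (q ^ p)) \<le> B) (at 0)"
      by (elim landau_o.bigE) auto
    have "filterlim (\<lambda>t. q_of (of_real (1 / real p) * t)) (at 0) at_i_infinity"
      by (rule q_of_scaled_tendsto_0) (use p0 in simp)
    from eventually_compose_filterlim[OF B this]
    have "eventually (\<lambda>t. norm (D (q_of (of_real (1 / real p) * t)) * inverse (q_of (of_real (1 / real p) * t) ^ p)) \<le> B) at_i_infinity" .
    hence "eventually (\<lambda>t. norm (f (- 1 / t)) \<le> B) at_i_infinity"
      using eventually_upper_half
    proof eventually_elim
      case (elim t)
      define s where "s = of_real (1 / real p) * t"
      define q where "q = q_of s"
      have s: "of_nat p * s = t" "Im s > 0" using elim p0 by (simp_all add: s_def)
      have q: "norm q < 1" "q \<noteq> 0" using s by (simp_all add: q_def norm_q_of_less_1)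
      note nz = W_nz[OF q(1)] q(2) c0
      have h: "hpt_cusp0 p m t = W q / q"
        using hpt_cusp0_eq_euler[OF p(2) p0, of s]
        unfolding s(1) by (simp add: q_def U_def V_def W_def divide_inverse power_mult_distrib power_inverse mult_ac)
      have qt: "q_of t = q ^ p" unfolding s(1)[symmetric] q_def by (rule q_of_mult_nat)
      have "q ^ p * ((W q / q) * (\<Sum>i<p. r i * (W q / q) ^ i)) = W q * (\<Sum>i<p. r i * W q ^ i * q ^ (p - 1 - i))"
      proof -
        have "q ^ p * ((W q / q) * (r i * (W q / q) ^ i)) = W q * (r i * W q ^ i * q ^ (p - 1 - i))" if "i < p" for i
        proof -
          have "p = (p - 1 - i) + i + 1" using that by simp
          hence "q ^ p = q ^ (p - 1 - i) * q ^ i * q" by (metis power_add power_one_right)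
          thus ?thesis using q by (simp add: power_divide)
        qed
        thus ?thesis unfolding sum_distrib_left by (intro sum.cong) auto
      qed
      hence "D q = jq (q ^ p) - q ^ p * J (W q / q)"
        using nz unfolding D_def J_def by (simp add: distrib_left divide_inverse mult_ac)
      hence "D q * inverse (q ^ p) = f (- 1 / t)"
        using q unfolding f_inv[OF elim(2)] h klein_j_eq_jq qt by (simp add: field_simps)
      thus ?case using elim(1) unfolding s_def[symmetric] q_def[symmetric] by simp
    qed
    thus ?thesis ..
  qed
  then obtain B where B: "eventually (\<lambda>t. norm (f (- 1 / t)) \<le> B) at_i_infinity" ..
  show ?thesis
  proof -
    have "f t = 0"
    proof (rule Gamma0_function_zero[OF p(1), where f = f])
      show "f holomorphic_on {t. 0 < Im t}"
        unfolding f_def J_def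
        by (intro holomorphic_intros klein_j_holomorphic hpt_holomorphic p0) (auto simp: hpt_nz p0)
      show "f (t + 1) = f t" if "Im t > 0" for t
        unfolding f_def klein_j_plus_1 hpt_plus_1[OF p(2) p0 that] ..
      have jp: "klein_j (t + of_nat k) = klein_j t" for t k
      proof (induction k)
        case (Suc k)
        thus ?case using klein_j_plus_1[of "t + of_nat k"] by (simp add: add_ac)
      qed simp
      show "f (- 1 / (t + of_nat p)) = f (- 1 / t)" if "Im t > 0" for t
        using that f_inv[of t] f_inv[of "t + of_nat p"] hpt_cusp0_plus[OF p(2) p0 that] jp by simp
      show "f (- 1 / (- 1 / t + of_nat k)) = f (- 1 / (t + of_nat k))"
        if "2 \<le> k" "k + 2 \<le> p" "Im t > 0" for t k
      proof -
        have "Im (- 1 / t + of_nat k) > 0" "Im (t + of_nat k) > 0"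
          using Im_inversion_pos[OF that(3)] that(3) by simp_all
        thus ?thesis
          using f_inv[of "- 1 / t + of_nat k"] f_inv[of "t + of_nat k"] middle[OF that] klein_j_inversion[OF that(3)]
          by (simp only: jp)
      qed
      show "(f \<longlongrightarrow> 0) at_i_infinity"
      proof -
        \<comment> \<open>\<open>D\<close> is q times the difference. Since V / U = 1 - 6 m q + ...,
          the constant term 744 + 6 m leaves 744 q, the same as in \<open>jq\<close>; hence
          \<open>D\<close> is O(q^2) and the difference tends to 0.\<close>
        define D where "D q = jq q - (V q * inverse (U q) + (744 + 6 * of_nat m) * q +
            q ^ 2 * (c * (U q * inverse (V q)) * (\<Sum>i<p. r i * (c * q * (U q * inverse (V q))) ^ i)))" for q
        have "cong0 2 (\<lambda>q. V q * inverse (U q)) (\<lambda>q. 1 + (- (6 * of_nat m) + 0) * q)"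
          by (rule cong0_linear_mult[OF cV]) (use cong0_mono[OF cUi p(1)] in simp)
        moreover have "cong0 2 (\<lambda>q. (744 + 6 * of_nat m) * q) (\<lambda>q. (744 + 6 * of_nat m) * q)"
          by (intro cong0_refl continuous_intros)
        moreover have "cong0 2 (\<lambda>q. q ^ 2 * (c * (U q * inverse (V q)) * (\<Sum>i<p. r i * (c * q * (U q * inverse (V q))) ^ i))) (\<lambda>_. 0)"
          by (intro cong0_zeroI isCont_of_holomorphic_ball holomorphic_intros hol_U hol_V) (auto simp: V_nz)
        ultimately have "cong0 2 D (\<lambda>q. (1 + 744 * q) - ((1 + (- (6 * of_nat m) + 0) * q) + (744 + 6 * of_nat m) * q + 0))"
          unfolding D_def by (intro cong0_diff cong0_add cong0_jq)
        moreover have "(\<lambda>q::complex. (1 + 744 * q) - ((1 + (- (6 * of_nat m) + 0) * q) + (744 + 6 * of_nat m) * q + 0)) = (\<lambda>_. 0)"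
          by (simp add: fun_eq_iff algebra_simps)
        ultimately have "cong0 2 D (\<lambda>_. 0)" by (simp only:)
        hence "D \<in> O[at 0](\<lambda>q. q ^ 2)" by (simp add: cong0_def)
        hence "(\<lambda>q. D q * inverse q) \<in> O[at 0](\<lambda>q. q ^ 2 * inverse q)" by (intro landau_o.big_mult) auto
        also have "(\<lambda>q::complex. q ^ 2 * inverse q) = (\<lambda>q. q)" 
        proof
          show "q ^ 2 * inverse q = q" for q :: complex by (cases "q = 0") (simp_all add: power2_eq_square)
        qed
        finally have "(\<lambda>q. D q * inverse q) \<in> O[at 0](\<lambda>q. q)" .
        then obtain B where "eventually (\<lambda>q. norm (D q * inverse q) \<le> B * norm q) (at 0)"
          by (elim landau_o.bigE) auto
        moreover have "((\<lambda>q::complex. B * norm q) \<longlongrightarrow> 0) (at 0)" by (auto intro!: tendsto_eq_intros)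
        ultimately have "((\<lambda>q. D q * inverse q) \<longlongrightarrow> 0) (at 0)" by (rule Lim_null_comparison)
        hence "((\<lambda>t. D (q_of t) * inverse (q_of t)) \<longlongrightarrow> 0) at_i_infinity"
          by (rule filterlim_compose[OF _ q_of_tendsto_0])
        moreover have "eventually (\<lambda>t. D (q_of t) * inverse (q_of t) = f t) at_i_infinity"
          using eventually_upper_half
        proof eventually_elim
          case (elim t)
          define q where "q = q_of t"
          have q: "norm q < 1" "q \<noteq> 0" using elim by (simp_all add: q_def norm_q_of_less_1)
          note nz = U_nz[OF q(1)] V_nz[OF q(1)] q(2) c0
          have h: "hpt p m t = c * q * (U q * inverse (V q))"
            using hpt_eq_euler[OF p(2) p0, of t] by (simp add: c_def q_def U_def V_def divide_inverse power_mult_distrib power_inverse)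
          have "J (c * q * (U q * inverse (V q))) * q = V q * inverse (U q) + (744 + 6 * of_nat m) * q +
            q ^ 2 * (c * (U q * inverse (V q)) * (\<Sum>i<p. r i * (c * q * (U q * inverse (V q))) ^ i))"
            using nz unfolding J_def distrib_right
            by (intro arg_cong2[of _ _ _ _ "(+)"]) (simp_all add: field_simps power2_eq_square)
          hence "D q = jq q - J (hpt p m t) * q" unfolding D_def h by simp
          thus ?case using nz unfolding f_def klein_j_eq_jq q_def[symmetric] by (simp add: field_simps)
        qed
        ultimately show ?thesis by (rule Lim_transform_eventually)
      qed
    qed (rule B, rule t)
    thus ?thesis by (simp add: f_def J_def c_def)
  qed
qed

section \<open>The explicit rational functions\<close>

lemma klein_j_level2:
  assumes "Im t > 0"
  shows "klein_j t = (hpt 2 4 t + 16) ^ 3 / hpt 2 4 t"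
proof -
  \<comment> \<open>(x + 16)^3 / x = 4096 / x + 768 + x (48 + x), where 768 = 744 + 6 * 4.\<close>
  define r where "r i = (if i = 0 then 48 else 1 :: complex)" for i :: nat
  have V: "cong0 2 (\<lambda>q. euler q ^ (6 * 4)) (\<lambda>q. 1 + (- 24) * q)"
    using cong0_linear_power[OF cong0_2_euler, of 24] by simp
  have "cong0 2 (\<lambda>q. euler q ^ (6 * 4) * (48 * q + euler q ^ (6 * 4))) (\<lambda>q. (1 + (- 24) * q) * (48 * q + (1 + (- 24) * q)))"
    by (intro cong0_mult cong0_add V cong0_refl continuous_intros)
  moreover have "cong0 2 (\<lambda>q. (1 + (- 24) * q) * (48 * q + (1 + (- 24) * q))) (\<lambda>_. 1)"
    by (rule cong0_poly[where r = "\<lambda>_. - 576"]) (algebra, (intro continuous_intros)+)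
  ultimately have *: "cong0 2 (\<lambda>q. euler q ^ (6 * 4) * (48 * q + euler q ^ (6 * 4))) (\<lambda>_. 1)"
    by (rule cong0_trans)
  have "klein_j t = of_nat 2 ^ (3 * 4) / hpt 2 4 t + (744 + 6 * of_nat 4) + hpt 2 4 t * (\<Sum>i<2. r i * hpt 2 4 t ^ i)"
    by (rule level_identity[OF _ _ _ _ assms]) (use * in \<open>simp_all add: numeral_2_eq_2 r_def\<close>)
  also have "(\<Sum>i<2. r i * hpt 2 4 t ^ i) = 48 + hpt 2 4 t" by (simp add: r_def lessThan_nat_numeral)
  finally show ?thesis using hpt_nz[OF assms, of 2 4] by (simp add: field_simps power3_eq_cube)
qed

lemma cong0_5_euler6: "cong0 5 (\<lambda>q. euler q ^ 6) (\<lambda>q. 1 - 6 * q + 9 * q ^ 2 + 10 * q ^ 3 - 30 * q ^ 4)"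
  by (rule cong0_trans[OF cong0_power[OF cong0_euler]],
      rule cong0_poly[where r = "\<lambda>q. 0 - 6 + 41 * q + 6 * q ^ 2 - 30 * q ^ 3 - 10 * q ^ 4 + 9 * q ^ 5 + 6 * q ^ 6 + q ^ 7"])
    (algebra, (intro continuous_intros)+)

lemma klein_j_level3:
  assumes "Im t > 0"
  shows "klein_j t = (hpt 3 2 t + 3) ^ 3 * (hpt 3 2 t + 27) / hpt 3 2 t"
proof -
  \<comment> \<open>(x + 3)^3 (x + 27) / x = 729 / x + 756 + x (270 + 36 x + x^2). The polynomial
    \<open>T\<close> below is the twelfth power of the Euler product modulo q^3.\<close>
  define r where "r i = (if i = 0 then 270 else if i = 1 then 36 else 1 :: complex)" for i :: nat
  define T where "T q = 1 - 12 * q + 54 * q ^ 2" for q :: complex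
  have T: "isCont T 0" unfolding T_def by (intro continuous_intros)
  have "cong0 3 (\<lambda>q. (euler q ^ 6) ^ 2) (\<lambda>q. (1 - 6 * q + 9 * q ^ 2 + 10 * q ^ 3 - 30 * q ^ 4) ^ 2)"
    by (intro cong0_power cong0_mono[OF cong0_5_euler6]) simp
  moreover have "cong0 3 (\<lambda>q. (1 - 6 * q + 9 * q ^ 2 + 10 * q ^ 3 - 30 * q ^ 4) ^ 2) T"
    by (rule cong0_poly[where r = "\<lambda>q. 0 - 88 - 99 * q + 540 * q ^ 2 - 440 * q ^ 3 - 600 * q ^ 4 + 900 * q ^ 5"]) (unfold T_def, algebra, (intro continuous_intros)+)
  ultimately have V: "cong0 3 (\<lambda>q. euler q ^ (6 * 2)) T"
    unfolding power_mult by (rule cong0_trans)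
  have "cong0 3 (\<lambda>q. euler q ^ (6 * 2) * (270 * q ^ 2 + 36 * euler q ^ (6 * 2) * q + (euler q ^ (6 * 2)) ^ 2))
      (\<lambda>q. T q * (270 * q ^ 2 + 36 * T q * q + T q ^ 2))"
    by (intro cong0_mult cong0_add cong0_power V cong0_refl continuous_intros)
  moreover have "cong0 3 (\<lambda>q. T q * (270 * q ^ 2 + 36 * T q * q + T q ^ 2)) (\<lambda>_. 1)"
    by (rule cong0_poly[where r = "\<lambda>q. 216 + 157464 * q ^ 3"]) (unfold T_def, algebra, (intro continuous_intros)+)
  ultimately have *: "cong0 3 (\<lambda>q. euler q ^ (6 * 2) * (270 * q ^ 2 + 36 * euler q ^ (6 * 2) * q + (euler q ^ (6 * 2)) ^ 2)) (\<lambda>_. 1)"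
    by (rule cong0_trans)
  have "klein_j t = of_nat 3 ^ (3 * 2) / hpt 3 2 t + (744 + 6 * of_nat 2) + hpt 3 2 t * (\<Sum>i<3. r i * hpt 3 2 t ^ i)"
    by (rule level_identity[OF _ _ _ _ assms]) (use * in \<open>simp_all add: numeral_3_eq_3 r_def numeral_2_eq_2 add.assoc\<close>)
  thus ?thesis using hpt_nz[OF assms, of 3 2]
    by (simp add: numeral_3_eq_3 r_def field_simps)
qed

text \<open>Since n^2 = - 1 modulo 5, the point (- 1 / t + n) / 5 is reached from s = (t + n) / 5 by
  three inversions interleaved with shifts by n and - n. Each shift multiplies \<open>eta6\<close>
  by - 1, and the three automorphy factors combine because u v s = - t. The residue 3 is covered by
  n = - 2.\<close>

lemma hpt_cusp0_5_middle:
  assumes t: "Im t > 0" and n: "n ^ 2 = (4 :: complex)"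
  shows "hpt_cusp0 5 1 (- 1 / t + n) = hpt_cusp0 5 1 (t + n)"
proof -
  have nn: "n = 2 \<or> n = - 2" using n power2_eq_iff[of n 2] by simp
  have In: "Im n = 0" using nn by auto
  have shift: "eta6 (z + n) = - eta6 z" "eta6 (z - n) = - eta6 z" for z
    using eta6_plus_nat[of z 2] eta6_plus_nat[of "z - 2" 2] nn by auto
  define s where "s = (t + n) / 5"
  define v where "v = - 1 / s + n"
  define u where "u = - 1 / v - n"
  have s: "Im s > 0" using t In by (simp add: s_def)
  have v: "Im v > 0" using Im_inversion_pos[OF s] In by (simp add: v_def)
  have u: "Im u > 0" using Im_inversion_pos[OF v] In by (simp add: u_def)
  have nz: "t \<noteq> 0" "s \<noteq> 0" "v \<noteq> 0" "u \<noteq> 0" using t s v u by auto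
  have vs: "v * s = n * s - 1" using nz by (simp add: v_def field_simps)
  have uv: "u * v = - 1 - n * v" using nz by (simp add: u_def field_simps)
  have s5: "5 * s = t + n" by (simp add: s_def)
  have uvs: "u * v * s = - t" using vs uv s5 n by algebra
  have "- 1 / u = (v * s) / t"
    using nz uvs by (simp add: field_simps)
  also have "\<dots> = (- 1 / t + n) / 5"
    using nz vs s5 n by (simp add: field_simps) algebra
  finally have eq: "- 1 / u = (- 1 / t + n) / 5" .
  have 1: "eta6 ((- 1 / t + n) / 5) = \<i> * u ^ 3 * eta6 u" using eta6_inversion[OF u] unfolding eq .
  have 2: "eta6 u = - (\<i> * v ^ 3 * eta6 v)" unfolding u_def shift eta6_inversion[OF v] ..
  have 3: "eta6 v = - (\<i> * s ^ 3 * eta6 s)" unfolding v_def shift eta6_inversion[OF s] ..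
  have "eta6 ((- 1 / t + n) / 5) = - \<i> * (u * v * s) ^ 3 * eta6 s"
    unfolding 1 2 3 using i_squared by algebra
  hence 4: "eta6 ((- 1 / t + n) / 5) = \<i> * t ^ 3 * eta6 s" unfolding uvs by simp
  have 5: "eta6 (- 1 / t + n) = - (\<i> * t ^ 3 * eta6 t)" unfolding shift eta6_inversion[OF t] ..
  have "hpt_cusp0 5 1 (- 1 / t + n) = (\<i> * t ^ 3 * eta6 s) / (- (\<i> * t ^ 3 * eta6 t))"
    by (simp only: hpt_cusp0_def power_one_right of_nat_numeral 4 5)
  also have "\<dots> = eta6 s / - eta6 t" using nz by simp
  finally show ?thesis by (simp add: hpt_cusp0_def shift s_def)
qed

lemma klein_j_level5:
  assumes "Im t > 0"
  shows "klein_j t = (hpt 5 1 t ^ 2 + 10 * hpt 5 1 t + 5) ^ 3 / hpt 5 1 t"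
proof -
  define r where "r i = (if i = 0 then 1575 else if i = 1 then 1300 else if i = 2 then 315 else if i = 3 then 30 else 1 :: complex)" for i :: nat
  define T where "T q = 1 - 6 * q + 9 * q ^ 2 + 10 * q ^ 3 - 30 * q ^ 4" for q :: complex
  have T: "isCont T 0" unfolding T_def by (intro continuous_intros)
  have V: "cong0 5 (\<lambda>q. euler q ^ (6 * 1)) T" using cong0_5_euler6 by (simp add: T_def[abs_def])
  have sum5: "(\<Sum>i<5. g i) = g 0 + g 1 + g 2 + g 3 + g 4" for g :: "nat \<Rightarrow> complex"
    by (simp add: eval_nat_numeral)
  have "cong0 5 (\<lambda>q. euler q ^ (6 * 1) * (\<Sum>i<5. r i * (euler q ^ (6 * 1)) ^ i * q ^ (5 - 1 - i)))
      (\<lambda>q. T q * (\<Sum>i<5. r i * T q ^ i * q ^ (5 - 1 - i)))"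
    by (intro cong0_mult cong0_sum cong0_power V cong0_refl continuous_intros)
  moreover have "cong0 5 (\<lambda>q. T q * (\<Sum>i<5. r i * T q ^ i * q ^ (5 - 1 - i))) (\<lambda>_. 1)"
    unfolding sum5
    by (rule cong0_poly[where r = "\<lambda>q. 0 - 36 - 1500 * q ^ 2 - 3150 * q ^ 3 - 12550 * q ^ 4 + 132699 * q ^ 5 - 40950 * q ^ 6 - 596650 * q ^ 7 - 519000 * q ^ 8 - 1224000 * q ^ 9 + 11170000 * q ^ 10 + 4980000 * q ^ 11 - 39600000 * q ^ 12 + 9450000 * q ^ 13 + 40500000 * q ^ 14 - 24300000 * q ^ 15"])
      (simp add: r_def T_def, algebra, (intro continuous_intros T)+)
  ultimately have *: "cong0 5 (\<lambda>q. euler q ^ (6 * 1) * (\<Sum>i<5. r i * (euler q ^ (6 * 1)) ^ i * q ^ (5 - 1 - i))) (\<lambda>_. 1)"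
    by (rule cong0_trans)
  have middle: "hpt_cusp0 5 1 (- 1 / t + of_nat k) = hpt_cusp0 5 1 (t + of_nat k)"
    if "2 \<le> k" "k + 2 \<le> 5" "Im t > 0" for k t
  proof -
    have "k = 2 \<or> k = 3" using that by auto
    moreover have 3: "hpt_cusp0 5 1 (z + 3) = hpt_cusp0 5 1 (z + (- 2))" if "Im z > 0" for z
      using hpt_cusp0_plus[of 1 5 "z - 2"] that by (simp add: add.commute)
    have "hpt_cusp0 5 1 (- 1 / t + 3) = hpt_cusp0 5 1 (t + 3)"
      unfolding 3[OF that(3)] 3[OF Im_inversion_pos[OF that(3)]] by (rule hpt_cusp0_5_middle[OF that(3)]) simp
    moreover have "hpt_cusp0 5 1 (- 1 / t + 2) = hpt_cusp0 5 1 (t + 2)"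
      by (rule hpt_cusp0_5_middle[OF that(3)]) simp
    ultimately show ?thesis by auto
  qed
  have "klein_j t = of_nat 5 ^ (3 * 1) / hpt 5 1 t + (744 + 6 * of_nat 1) + hpt 5 1 t * (\<Sum>i<5. r i * hpt 5 1 t ^ i)"
    by (rule level_identity[OF _ _ middle * assms]) simp_all
  moreover have "125 / x + 750 + x * (1575 + 1300 * x + 315 * x ^ 2 + 30 * x ^ 3 + x ^ 4) = (x ^ 2 + 10 * x + 5) ^ 3 / x"
    if "x \<noteq> 0" for x :: complex
  proof -
    have "(x ^ 2 + 10 * x + 5) ^ 3 = 125 + 750 * x + x * (x * (1575 + 1300 * x + 315 * x ^ 2 + 30 * x ^ 3 + x ^ 4))"
      by algebra
    thus ?thesis using that by (simp add: add_divide_distrib)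
  qed
  ultimately show ?thesis using hpt_nz[OF assms, of 5 1] by (simp add: sum5 r_def)
qed

subsection \<open>Relations between Hauptmoduln\<close>

lemma upper_half_eqI:
  assumes "f holomorphic_on {t. Im t > 0}" "g holomorphic_on {t. Im t > 0}"
    and ev: "eventually (\<lambda>t. f t = g t) at_i_infinity" and t: "Im t > 0"
  shows "f t = g t"
proof -
  obtain Y where Y: "\<And>t. Im t > Y \<Longrightarrow> f t = g t" using ev by (auto simp: eventually_at_i_infinity)
  define Y' where "Y' = max Y 0"
  show ?thesis
  proof (rule analytic_continuation_open[of "{t. Im t > Y'}" "{t. Im t > 0}" f g])
    show "open {t. Im t > Y'}" by (intro open_Collect_less continuous_intros)
    have "Im (Complex 0 (Y' + 1)) > Y'" by simp
    thus "{t. Im t > Y'} \<noteq> {}" by blast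
  qed (use assms Y open_upper_half connected_upper_half in \<open>auto simp: Y'_def\<close>)
qed

section \<open>Eta quotients near the cusp\<close>

definition euler_at :: "nat \<Rightarrow> complex \<Rightarrow> complex" where
  "euler_at k t = euler (q_of t ^ k)"

lemma euler_at_nz: "Im t > 0 \<Longrightarrow> k > 0 \<Longrightarrow> euler_at k t \<noteq> 0"
  unfolding euler_at_def q_of_mult_nat[symmetric] by (intro euler_nz norm_q_of_less_1) simp

lemma euler_at_mult: "euler_at k (of_nat n * t) = euler_at (n * k) t"
  by (simp add: euler_at_def q_of_mult_nat power_mult)

lemma q_of_tendsto [tendsto_intros]: "(q_of \<longlongrightarrow> 0) at_i_infinity"
  using q_of_tendsto_0 by (simp add: filterlim_at)

lemma euler_at_tendsto: "k > 0 \<Longrightarrow> (euler_at k \<longlongrightarrow> 1) at_i_infinity"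
  unfolding euler_at_def[abs_def]
  by (rule filterlim_compose[OF euler_tendsto]) (auto intro!: tendsto_eq_intros)

lemma dedekind_eta_nat_mult:
  "dedekind_eta (of_nat k * t) = exp (2 * of_real pi * \<i> * t / 24) ^ k * euler_at k t"
proof -
  have "exp (2 * of_real pi * \<i> * (of_nat k * t) / 24) = exp (2 * of_real pi * \<i> * t / 24) ^ k"
    unfolding exp_of_nat_mult[symmetric] by (rule arg_cong[of _ _ exp]) simp
  thus ?thesis by (simp add: dedekind_eta_eq_euler euler_at_def q_of_mult_nat)
qed

lemma q_of_eq_power_24: "q_of t = exp (2 * of_real pi * \<i> * t / 24) ^ 24"
  unfolding q_of_def exp_of_nat_mult[symmetric] by (rule arg_cong[of _ _ exp]) simp

lemma hauptmodul_2: "hauptmodul 2 t = hpt 2 4 t"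
  by (simp add: hauptmodul_def hpt_def eta6_def power_divide flip: power_mult)

lemma hauptmodul_3: "hauptmodul 3 t = hpt 3 2 t"
  by (simp add: hauptmodul_def hpt_def eta6_def power_divide flip: power_mult)

lemma hauptmodul_5: "hauptmodul 5 t = hpt 5 1 t"
  by (simp add: hauptmodul_def hpt_def eta6_def power_divide)

lemma hauptmodul_eq_euler_at:
  shows "hauptmodul 2 t = 4096 * q_of t * (euler_at 2 t / euler_at 1 t) ^ 24" (is ?A)
    and "hauptmodul 3 t = 729 * q_of t * (euler_at 3 t / euler_at 1 t) ^ 12" (is ?B)
    and "hauptmodul 4 t = 256 * q_of t * (euler_at 4 t / euler_at 1 t) ^ 8" (is ?C)
    and "hauptmodul 5 t = 125 * q_of t * (euler_at 5 t / euler_at 1 t) ^ 6" (is ?D)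
    and "hauptmodul 9 t = 27 * q_of t * (euler_at 9 t / euler_at 1 t) ^ 3" (is ?E)
    and "hauptmodul 16 t = 8 * q_of t * (euler_at 2 t * euler_at 16 t ^ 2 / (euler_at 1 t ^ 2 * euler_at 8 t))" (is ?F)
    and "hauptmodul 25 t = 5 * q_of t * (euler_at 25 t / euler_at 1 t)" (is ?G)
proof -
  define z where "z = exp (2 * of_real pi * \<i> * t / 24)"
  have z: "z \<noteq> 0" by (simp add: z_def)
  have q: "q_of t = z ^ 24" unfolding z_def by (rule q_of_eq_power_24)
  have e: "dedekind_eta (of_nat k * t) = z ^ k * euler_at k t" for k
    unfolding z_def by (rule dedekind_eta_nat_mult)
  note simps = hauptmodul_def Let_def e q power_mult_distrib power_divide power_mult[symmetric]
  have pw: "c * (z ^ (a + b) * x) / (z ^ a * y) = c * z ^ b * (x / y)" for a b c x y using z by (simp add: power_add)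
  show ?A using pw[of 4096 24 24] by (simp add: simps del: of_nat_numeral)
  show ?B using pw[of 729 12 24] by (simp add: simps del: of_nat_numeral)
  show ?C using pw[of 256 8 24] by (simp add: simps del: of_nat_numeral)
  show ?D using pw[of 125 6 24] by (simp add: simps del: of_nat_numeral)
  show ?E using pw[of 27 3 24] by (simp add: simps del: of_nat_numeral)
  show ?G using pw[of 5 1 24] by (simp add: simps del: of_nat_numeral)
  have "8 * (A * x) * (B * y) / (C * u * (D * v)) = 8 * Z * (x * y / (u * v))"
    if "A * B = Z * (C * D)" "C \<noteq> 0" "D \<noteq> 0" for A B C D Z x y u v :: complex
  proof -
    have n: "8 * (A * x) * (B * y) = 8 * Z * (x * y) * (C * D)" using that(1) by algebra
    show ?thesis unfolding n using that(2,3) by simp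
  qed
  from this[of "z ^ 2" "z ^ 32" "z ^ 24" "z ^ 2" "z ^ 8"] z show ?F
    by (simp add: simps del: of_nat_numeral flip: power_add)
qed

lemma hauptmodul_nz: "M \<in> {2, 3, 4, 5, 9, 16, 25} \<Longrightarrow> Im t > 0 \<Longrightarrow> hauptmodul M t \<noteq> 0"
  by (auto simp: hauptmodul_eq_euler_at euler_at_nz)

lemma hauptmodul_tendsto_0:
  assumes "M \<in> {2, 3, 4, 5, 9, 16, 25}"
  shows "(hauptmodul M \<longlongrightarrow> 0) at_i_infinity"
proof -
  note [tendsto_intros] = euler_at_tendsto
  show ?thesis
    using assms unfolding hauptmodul_eq_euler_at[abs_def] insert_iff empty_iff
    by (elim disjE; simp only: hauptmodul_eq_euler_at[abs_def]) (auto intro!: tendsto_eq_intros)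
qed

lemma euler_at_holomorphic:
  assumes "k > 0"
  shows "euler_at k holomorphic_on {t. Im t > 0}"
proof -
  have "norm (q_of t ^ k) < 1" if "Im t > 0" for t
    unfolding q_of_mult_nat[symmetric] using that assms by (intro norm_q_of_less_1) simp
  thus ?thesis unfolding euler_at_def[abs_def] by (intro holomorphic_intros open_upper_half) auto
qed

lemma hauptmodul_holomorphic:
  assumes "M \<in> {2, 3, 4, 5, 9, 16, 25}"
  shows "hauptmodul M holomorphic_on {t. Im t > 0}"
  using assms unfolding insert_iff empty_iff
  by (elim disjE; simp only: hauptmodul_eq_euler_at[abs_def])
    (auto intro!: holomorphic_on_mult holomorphic_on_const holomorphic_on_power holomorphic_on_divide
      euler_at_holomorphic q_of_holomorphic holomorphic_on_ident simp: euler_at_nz)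

text \<open>By invariance j (p t) = j (- 1 / (p t)), and the Fricke involution t \<mapsto> - 1 / (p
  t) sends x_p to p^(3 m) / x_p.\<close>

lemma klein_j_fricke:
  assumes t: "Im t > 0" and p: "p > 0" and J: "\<And>t. Im t > 0 \<Longrightarrow> klein_j t = J (hpt p m t)"
  shows "klein_j (of_nat p * t) = J (of_nat p ^ (3 * m) / hpt p m t)"
proof -
  have t': "Im (of_nat p * t) > 0" using t p by simp
  have "klein_j (of_nat p * t) = J (hpt p m (- 1 / (of_nat p * t)))"
    using klein_j_inversion[OF t'] J[OF Im_inversion_pos[OF t']] by simp
  also have "hpt p m (- 1 / (of_nat p * t)) = hpt_cusp0 p m (of_nat p * t)"
    by (rule hpt_inversion[OF t' p])
  also have "\<dots> = of_nat p ^ (3 * m) / hpt p m t"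
    using p by (simp add: hpt_cusp0_def hpt_def power_divide)
  finally show ?thesis .
qed

lemma cubes_eq_imp_eq:
  fixes u v :: complex
  assumes "u ^ 3 = v ^ 3" "u ^ 2 + u * v + v ^ 2 \<noteq> 0"
  shows "u = v"
proof -
  have "(u - v) * (u ^ 2 + u * v + v ^ 2) = 0" using assms(1) by algebra
  thus ?thesis using assms(2) by simp
qed

lemma R_identity_2_eventually:
  "eventually (\<lambda>t. hauptmodul 2 t = hauptmodul 4 t * (hauptmodul 4 t + 16)) at_i_infinity"
proof -
  note [tendsto_intros] = euler_at_tendsto
  have lim: "((\<lambda>t. hauptmodul 4 t - 16) \<longlongrightarrow> - 16) at_i_infinity"
    using hauptmodul_tendsto_0[of 4] by (auto intro!: tendsto_eq_intros)
  \<comment> \<open>\<open>U\<close> and \<open>V\<close> are the two quantities whose cubes turn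
    out equal, divided by q. Both tend to 65536, so their cubes can agree near the cusp only if they
    agree themselves.\<close>
  define U where "U t = (hauptmodul 2 t + 256) * (256 * (euler_at 4 t / euler_at 1 t) ^ 8)" for t
  define V where "V t = hauptmodul 4 t ^ 2 * (256 * (euler_at 4 t / euler_at 1 t) ^ 8) + 16 * (4096 * (euler_at 2 t / euler_at 1 t) ^ 24)" for t
  have "((\<lambda>t. U t ^ 2 + U t * V t + V t ^ 2) \<longlongrightarrow> 3 * 65536 ^ 2) at_i_infinity"
    unfolding U_def V_def using hauptmodul_tendsto_0[of 4] hauptmodul_tendsto_0[of 2]
    by (auto intro!: tendsto_eq_intros)
  hence "eventually (\<lambda>t. U t ^ 2 + U t * V t + V t ^ 2 \<noteq> 0) at_i_infinity"
    by (rule tendsto_imp_eventually_ne) simp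
  moreover have "eventually (\<lambda>t. hauptmodul 4 t - 16 \<noteq> 0) at_i_infinity"
    using lim by (rule tendsto_imp_eventually_ne) simp
  ultimately show ?thesis using eventually_upper_half
  proof eventually_elim
    case (elim t)
    define a b X where "a = hauptmodul 2 t" and "b = hauptmodul 2 (2 * t)" and "X = hauptmodul 4 t"
    have t2: "Im (2 * t) > 0" using elim by simp
    have nz: "a \<noteq> 0" "b \<noteq> 0" "X \<noteq> 0" using hauptmodul_nz elim(3) t2 by (simp_all add: a_def b_def X_def)
    \<comment> \<open>In x_p(t) x_p(p t) the middle eta function cancels, leaving a power of the
      level p^2 quotient; the exponent is p + 1. This eliminates b.\<close>
    have ab: "a * b = X ^ 3"
      using dedekind_eta_nz[of "2 * t"] t2
      by (simp add: a_def b_def X_def hauptmodul_def power_divide power_mult_distrib flip: power_mult)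
    have "(b + 16) ^ 3 / b = (4096 / a + 16) ^ 3 / (4096 / a)"
      using klein_j_fricke[OF elim(3), of 2 "\<lambda>x. (x + 16) ^ 3 / x" 4] klein_j_level2 klein_j_level2[OF t2]
      by (simp add: a_def b_def hauptmodul_2)
    hence "(b + 16) ^ 3 * a ^ 2 = (a + 256) ^ 3 * b"
      using nz by (simp add: field_simps) algebra
    hence "((a + 256) * X) ^ 3 * b * a ^ 3 = (X ^ 3 + 16 * a) ^ 3 * b * a ^ 3"
      using ab by algebra
    hence "((a + 256) * X) ^ 3 = (X ^ 3 + 16 * a) ^ 3" using nz by simp
    moreover have "(a + 256) * X = q_of t * U t" "X ^ 3 + 16 * a = q_of t * V t"
      unfolding U_def V_def a_def X_def
      by (simp_all add: hauptmodul_eq_euler_at power2_eq_square power3_eq_cube distrib_left mult_ac)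
    ultimately have "(q_of t * U t) ^ 3 = (q_of t * V t) ^ 3" by (simp only:)
    hence "U t ^ 3 = V t ^ 3" by (simp add: power_mult_distrib)
    hence "U t = V t" using elim(1) by (rule cubes_eq_imp_eq)
    hence "(a + 256) * X = X ^ 3 + 16 * a"
      using \<open>(a + 256) * X = q_of t * U t\<close> \<open>X ^ 3 + 16 * a = q_of t * V t\<close> by (simp only:)
    hence "(X - 16) * (a - X * (X + 16)) = 0" by algebra
    thus ?case using elim(2) by (simp add: a_def X_def)
  qed
qed

lemma R_identity_2:
  "Im t > 0 \<Longrightarrow> hauptmodul 2 t = hauptmodul 4 t * (hauptmodul 4 t + 16)"
  by (rule upper_half_eqI[OF _ _ R_identity_2_eventually]) (intro holomorphic_intros hauptmodul_holomorphic; simp)+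

lemma R_identity_3_eventually:
  "eventually (\<lambda>t. hauptmodul 3 t = hauptmodul 9 t * (hauptmodul 9 t ^ 2 + 9 * hauptmodul 9 t + 27)) at_i_infinity"
proof -
  note [tendsto_intros] = euler_at_tendsto
  define c where "c t = 27 * (euler_at 3 t / euler_at 1 t) ^ 12 / (euler_at 9 t / euler_at 1 t) ^ 3" for t
  \<comment> \<open>With a = c X the modular equation is divisible by X^4, and \<open>C\<close> is
    the cofactor of c - (X^2 + 9 X + 27). At the cusp c = 27 and X = 0, where \<open>C\<close> is -
    4 * 3^15.\<close>
  define C where "C c X = (0 - 14348907 + 4782969 * X - 1062882 * X ^ 2 + 177147 * X ^ 3 - 19683 * X ^ 4 + 729 * X ^ 6 - 243 * X ^ 7 + 54 * X ^ 8 - 9 * X ^ 9 + X ^ 10) + (0 - 531441 - 354294 * X + 98415 * X ^ 2 - 13122 * X ^ 3 + 486 * X ^ 5 - 135 * X ^ 6 + 18 * X ^ 7 + X ^ 8) * c + (0 - 19683 - 6561 * X - 729 * X ^ 2 + 27 * X ^ 4 + 9 * X ^ 5 + X ^ 6) * c ^ 2 + (0 - 729 + X ^ 4) * c ^ 3" for c X :: complex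
  have "((\<lambda>t. C (c t) (hauptmodul 9 t)) \<longlongrightarrow> - 57395628) at_i_infinity"
    unfolding C_def c_def using hauptmodul_tendsto_0[of 9] by (auto intro!: tendsto_eq_intros)
  hence "eventually (\<lambda>t. C (c t) (hauptmodul 9 t) \<noteq> 0) at_i_infinity"
    by (rule tendsto_imp_eventually_ne) simp
  thus ?thesis using eventually_upper_half
  proof eventually_elim
    case (elim t)
    define a b X where "a = hauptmodul 3 t" and "b = hauptmodul 3 (3 * t)" and "X = hauptmodul 9 t"
    have t3: "Im (3 * t) > 0" using elim by simp
    have nz: "a \<noteq> 0" "b \<noteq> 0" "X \<noteq> 0" using hauptmodul_nz elim(2) t3 by (simp_all add: a_def b_def X_def)
    have ab: "a * b = X ^ 4"
      using dedekind_eta_nz[of "3 * t"] t3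
      by (simp add: a_def b_def X_def hauptmodul_def power_divide power_mult_distrib flip: power_mult)
    have a: "a = c t * X"
      using euler_at_nz[OF elim(2)] by (simp add: a_def X_def c_def hauptmodul_eq_euler_at)
    have "(b + 3) ^ 3 * (b + 27) / b = (729 / a + 3) ^ 3 * (729 / a + 27) / (729 / a)"
      using klein_j_fricke[OF elim(2), of 3 "\<lambda>x. (x + 3) ^ 3 * (x + 27) / x" 2] klein_j_level3 klein_j_level3[OF t3]
      by (simp add: a_def b_def hauptmodul_3)
    hence "(b + 3) ^ 3 * (b + 27) * a ^ 3 = (a + 243) ^ 3 * (a + 27) * b"
      using nz by (simp add: field_simps) algebra
    hence "(X ^ 4 + 3 * a) ^ 3 * (X ^ 4 + 27 * a) * (b * a ^ 4) = (a + 243) ^ 3 * (a + 27) * X ^ 4 * (b * a ^ 4)"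
      using ab by algebra
    hence "(X ^ 4 + 3 * a) ^ 3 * (X ^ 4 + 27 * a) = (a + 243) ^ 3 * (a + 27) * X ^ 4" using nz by simp
    hence "X ^ 4 * ((c t - (X ^ 2 + 9 * X + 27)) * C (c t) X) = 0"
      unfolding a C_def by algebra
    thus ?case using nz elim(1) a by (simp add: a_def X_def)
  qed
qed

lemma R_identity_3:
  "Im t > 0 \<Longrightarrow> hauptmodul 3 t = hauptmodul 9 t * (hauptmodul 9 t ^ 2 + 9 * hauptmodul 9 t + 27)"
  by (rule upper_half_eqI[OF _ _ R_identity_3_eventually]) (intro holomorphic_intros hauptmodul_holomorphic; simp)+

lemma R_identity_5_eventually:
  "eventually (\<lambda>t. hauptmodul 5 t = hauptmodul 25 t *
    (hauptmodul 25 t ^ 4 + 5 * hauptmodul 25 t ^ 3 + 15 * hauptmodul 25 t ^ 2 + 25 * hauptmodul 25 t + 25)) at_i_infinity"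
proof -
  note [tendsto_intros] = euler_at_tendsto
  define c where "c t = 25 * (euler_at 5 t / euler_at 1 t) ^ 6 / (euler_at 25 t / euler_at 1 t)" for t
  define U where "U c X = X ^ 2 * c ^ 2 + 250 * X * c + 3125" for c X :: complex
  define V where "V c X = X ^ 10 + 10 * X ^ 5 * c + 5 * c ^ 2" for c X :: complex
  \<comment> \<open>The modular equation again becomes an equality of cubes, and U - V splits as c -
    (X^4 + 5 X^3 + 15 X^2 + 25 X + 25) times \<open>W\<close>. At the cusp c = 25 and X = 0, which
    gives - 250.\<close>
  define W where "W c X = (X ^ 2 - 5) * (c + (X ^ 4 - 5 * X ^ 3 + 15 * X ^ 2 - 25 * X + 25))" for c X :: complex
  define UV where "UV c X = U c X ^ 2 + U c X * V c X + V c X ^ 2" for c X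
  have "((\<lambda>t. UV (c t) (hauptmodul 25 t)) \<longlongrightarrow> 3 * 3125 ^ 2) at_i_infinity"
    unfolding UV_def U_def V_def c_def using hauptmodul_tendsto_0[of 25] by (auto intro!: tendsto_eq_intros)
  hence "eventually (\<lambda>t. UV (c t) (hauptmodul 25 t) \<noteq> 0) at_i_infinity"
    by (rule tendsto_imp_eventually_ne) simp
  moreover have "((\<lambda>t. W (c t) (hauptmodul 25 t)) \<longlongrightarrow> - 250) at_i_infinity"
    unfolding W_def c_def using hauptmodul_tendsto_0[of 25] by (auto intro!: tendsto_eq_intros)
  hence "eventually (\<lambda>t. W (c t) (hauptmodul 25 t) \<noteq> 0) at_i_infinity"
    by (rule tendsto_imp_eventually_ne) simp
  ultimately show ?thesis using eventually_upper_half
  proof eventually_elim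
    case (elim t)
    define a b X where "a = hauptmodul 5 t" and "b = hauptmodul 5 (5 * t)" and "X = hauptmodul 25 t"
    have t5: "Im (5 * t) > 0" using elim by simp
    have nz: "a \<noteq> 0" "b \<noteq> 0" "X \<noteq> 0" using hauptmodul_nz elim(3) t5 by (simp_all add: a_def b_def X_def)
    have ab: "a * b = X ^ 6"
      using dedekind_eta_nz[of "5 * t"] t5
      by (simp add: a_def b_def X_def hauptmodul_def power_divide power_mult_distrib flip: power_mult)
    have a: "a = c t * X"
      using euler_at_nz[OF elim(3)] by (simp add: a_def X_def c_def hauptmodul_eq_euler_at)
    have "(b ^ 2 + 10 * b + 5) ^ 3 / b = ((125 / a) ^ 2 + 10 * (125 / a) + 5) ^ 3 / (125 / a)"
      using klein_j_fricke[OF elim(3), of 5 "\<lambda>x. (x ^ 2 + 10 * x + 5) ^ 3 / x" 1] klein_j_level5 klein_j_level5[OF t5]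
      by (simp add: a_def b_def hauptmodul_5)
    also have "((125 / a) ^ 2 + 10 * (125 / a) + 5) = 5 * (a ^ 2 + 250 * a + 3125) / a ^ 2"
      using nz by (simp add: field_simps power2_eq_square)
    also have "\<dots> ^ 3 / (125 / a) = (a ^ 2 + 250 * a + 3125) ^ 3 * a / a ^ 6"
    proof -
      have "(5 * K / a ^ 2) ^ 3 / (125 / a) = K ^ 3 * a / a ^ 6" for K
        by (simp add: power_divide power_mult_distrib flip: power_mult)
      thus ?thesis .
    qed
    finally have "(b ^ 2 + 10 * b + 5) ^ 3 * a ^ 6 = (a ^ 2 + 250 * a + 3125) ^ 3 * a * b"
      using nz by (simp add: divide_eq_eq eq_divide_eq mult_ac)
    moreover have "(b ^ 2 + 10 * b + 5) ^ 3 * a ^ 6 = ((a * b) ^ 2 + 10 * (a * b) * a + 5 * a ^ 2) ^ 3" by algebra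
    ultimately have "(X ^ 12 + 10 * X ^ 6 * a + 5 * a ^ 2) ^ 3 = (a ^ 2 + 250 * a + 3125) ^ 3 * X ^ 6"
      unfolding mult.assoc ab by (simp flip: power_mult add: mult.assoc)
    moreover have "X ^ 12 + 10 * X ^ 6 * a + 5 * a ^ 2 = X ^ 2 * V (c t) X" unfolding a V_def by algebra
    moreover have "a ^ 2 + 250 * a + 3125 = U (c t) X" unfolding a U_def by algebra
    ultimately have "(X ^ 2 * V (c t) X) ^ 3 = U (c t) X ^ 3 * X ^ 6" by (simp only:)
    hence "U (c t) X ^ 3 = V (c t) X ^ 3" using nz by (simp add: power_mult_distrib flip: power_mult)
    hence "U (c t) X = V (c t) X"
      by (rule cubes_eq_imp_eq) (use elim(1) in \<open>simp add: UV_def X_def\<close>)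
    hence "(c t - (X ^ 4 + 5 * X ^ 3 + 15 * X ^ 2 + 25 * X + 25)) * W (c t) X = 0"
      unfolding U_def V_def W_def by algebra
    thus ?case using elim(2) a by (simp add: a_def X_def)
  qed
qed

lemma R_identity_5:
  "Im t > 0 \<Longrightarrow> hauptmodul 5 t = hauptmodul 25 t *
    (hauptmodul 25 t ^ 4 + 5 * hauptmodul 25 t ^ 3 + 15 * hauptmodul 25 t ^ 2 + 25 * hauptmodul 25 t + 25)"
  by (rule upper_half_eqI[OF _ _ R_identity_5_eventually]) (intro holomorphic_intros hauptmodul_holomorphic; simp)+

text \<open>This is \<open>\<phi>(q) / \<phi>(-q)\<close> with the theta constant \<open>\<phi>(q) = \<Sum>n\<in>\<int>. q ^ n\<^sup>2\<close>.\<close>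

definition phi_quot :: "complex \<Rightarrow> complex" where
  "phi_quot t = euler_at 2 t ^ 6 / (euler_at 1 t ^ 4 * euler_at 4 t ^ 2)"

lemma phi_quot_holomorphic: "phi_quot holomorphic_on {t. Im t > 0}"
  unfolding phi_quot_def[abs_def]
  by (intro holomorphic_intros euler_at_holomorphic) (auto simp: euler_at_nz)

lemma phi_quot_double: "phi_quot (2 * t) = euler_at 4 t ^ 6 / (euler_at 2 t ^ 4 * euler_at 8 t ^ 2)"
  using euler_at_mult[of _ 2 t] by (simp add: phi_quot_def)

lemma phi_quot_double_holomorphic: "(\<lambda>t. phi_quot (2 * t)) holomorphic_on {t. Im t > 0}"
  unfolding phi_quot_double
  by (intro holomorphic_intros euler_at_holomorphic) (auto simp: euler_at_nz)

text \<open>Dividing x_2 = x_4 (x_4 + 16) by x_4 leaves an eta quotient, 16 times the fourth power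
  of \<open>phi_quot\<close>. The result is Jacobi's quartic relation between the three theta
  constants.\<close>

lemma phi_quot_power4:
  assumes "Im t > 0"
  shows "phi_quot t ^ 4 - 1 = 16 * q_of t * (euler_at 4 t / euler_at 1 t) ^ 8"
proof -
  define X where "X = hauptmodul 4 t"
  have nz: "euler_at 1 t \<noteq> 0" "euler_at 2 t \<noteq> 0" "euler_at 4 t \<noteq> 0" "q_of t \<noteq> 0"
    using euler_at_nz[OF assms] by simp_all
  have "X * (X + 16) = hauptmodul 2 t" using R_identity_2[OF assms] by (simp add: X_def)
  also have "\<dots> = X * (16 * phi_quot t ^ 4)"
    using nz by (simp add: X_def hauptmodul_eq_euler_at phi_quot_def power_divide power_mult_distrib
        field_simps flip: power_mult power_add)
  finally have "X + 16 = 16 * phi_quot t ^ 4" using hauptmodul_nz[of 4 t] assms by (simp add: X_def)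
  moreover have "X = 256 * q_of t * (euler_at 4 t / euler_at 1 t) ^ 8" by (simp only: X_def hauptmodul_eq_euler_at)
  ultimately show ?thesis by algebra
qed

lemma squares_eq_imp_eq:
  fixes u v :: complex
  assumes "u ^ 2 = v ^ 2" "u + v \<noteq> 0"
  shows "u = v"
  using assms by (metis add.commute power2_eq_iff right_minus_eq diff_minus_eq_add add.right_inverse)

lemma phi_quot_tendsto:
  "(phi_quot \<longlongrightarrow> 1) at_i_infinity" "((\<lambda>t. phi_quot (2 * t)) \<longlongrightarrow> 1) at_i_infinity"
proof -
  note [tendsto_intros] = euler_at_tendsto
  show "(phi_quot \<longlongrightarrow> 1) at_i_infinity"
    unfolding phi_quot_def[abs_def] by (auto intro!: tendsto_eq_intros)
  show "((\<lambda>t. phi_quot (2 * t)) \<longlongrightarrow> 1) at_i_infinity"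
    unfolding phi_quot_double by (auto intro!: tendsto_eq_intros)
qed

text \<open>This is \<phi>(q)^2 + \<phi>(-q)^2 = 2 \<phi>(q^2)^2 in terms of quotients. Combining
  the quartic relations at t and 2 t makes the square of the square of the claim provable; two
  square roots follow, with signs fixed by the limits at the cusp.\<close>

lemma phi_quot_duplication:
  assumes "Im t > 0"
  shows "phi_quot t ^ 2 + 1 = 2 * phi_quot t * phi_quot (2 * t) ^ 2"
proof (rule upper_half_eqI[OF _ _ _ assms])
  show "(\<lambda>t. phi_quot t ^ 2 + 1) holomorphic_on {t. Im t > 0}"
    "(\<lambda>t. 2 * phi_quot t * phi_quot (2 * t) ^ 2) holomorphic_on {t. Im t > 0}"
    by (intro holomorphic_intros phi_quot_holomorphic phi_quot_double_holomorphic)+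
  note [tendsto_intros] = phi_quot_tendsto
  have "((\<lambda>t. (phi_quot t ^ 4 + 1) + phi_quot t ^ 2 * (4 * phi_quot (2 * t) ^ 4 - 2)) \<longlongrightarrow> 4) at_i_infinity"
    by (auto intro!: tendsto_eq_intros)
  hence "eventually (\<lambda>t. (phi_quot t ^ 4 + 1) + phi_quot t ^ 2 * (4 * phi_quot (2 * t) ^ 4 - 2) \<noteq> 0) at_i_infinity"
    by (rule tendsto_imp_eventually_ne) simp
  moreover have "((\<lambda>t. (phi_quot t ^ 2 + 1) + 2 * phi_quot t * phi_quot (2 * t) ^ 2) \<longlongrightarrow> 4) at_i_infinity"
    by (auto intro!: tendsto_eq_intros)
  hence "eventually (\<lambda>t. (phi_quot t ^ 2 + 1) + 2 * phi_quot t * phi_quot (2 * t) ^ 2 \<noteq> 0) at_i_infinity"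
    by (rule tendsto_imp_eventually_ne) simp
  ultimately show "eventually (\<lambda>t. phi_quot t ^ 2 + 1 = 2 * phi_quot t * phi_quot (2 * t) ^ 2) at_i_infinity"
    using eventually_upper_half
  proof eventually_elim
    case (elim t)
    define u v where "u = phi_quot t" and "v = phi_quot (2 * t)"
    have nz: "euler_at 1 t \<noteq> 0" "euler_at 2 t \<noteq> 0" "euler_at 4 t \<noteq> 0" "euler_at 8 t \<noteq> 0"
      using euler_at_nz[OF elim(3)] by simp_all
    have "Im (2 * t) > 0" using elim by simp
    from phi_quot_power4[OF this] have v: "v ^ 4 - 1 = 16 * q_of t ^ 2 * (euler_at 8 t / euler_at 2 t) ^ 8"
      using euler_at_mult[of _ 2 t] q_of_mult_nat[of 2 t] by (simp add: v_def)
    have "(u ^ 4 - 1) ^ 2 = 16 * (u ^ 4 * v ^ 4) * (v ^ 4 - 1)"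
      unfolding v unfolding u_def v_def phi_quot_power4[OF elim(3)] unfolding phi_quot_double unfolding phi_quot_def
      using nz by (simp add: power_divide power_mult_distrib field_simps flip: power_mult power_add)
    hence "(u ^ 4 + 1) ^ 2 = (u ^ 2 * (4 * v ^ 4 - 2)) ^ 2" by algebra
    hence "u ^ 4 + 1 = u ^ 2 * (4 * v ^ 4 - 2)"
      by (rule squares_eq_imp_eq) (use elim(1) in \<open>simp add: u_def v_def\<close>)
    hence "(u ^ 2 + 1) ^ 2 = (2 * u * v ^ 2) ^ 2" by algebra
    hence "u ^ 2 + 1 = 2 * u * v ^ 2"
      by (rule squares_eq_imp_eq) (use elim(2) in \<open>simp add: u_def v_def\<close>)
    thus ?case by (simp add: u_def v_def)
  qed
qed

lemma R_identity_4_eventually: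
  "eventually (\<lambda>t. hauptmodul 4 t = hauptmodul 16 t * (hauptmodul 16 t + 4) * (hauptmodul 16 t ^ 2 + 4 * hauptmodul 16 t + 8)) at_i_infinity"
proof -
  note [tendsto_intros] = phi_quot_tendsto euler_at_tendsto
  define u where "u = phi_quot"
  define v where "v t = phi_quot (2 * t)" for t
  \<comment> \<open>If the square root below had the wrong sign, q^2 A t would be 0; likewise q B t
    would be 0 for the second square root. Both \<open>A\<close> and \<open>B\<close> tend to
    32.\<close>
  define A where "A t = 16 * (euler_at 8 t / euler_at 2 t) ^ 8 + 8 * v t * (euler_at 16 t / euler_at 4 t) ^ 4 * (v t ^ 2 + 1)" for t
  define X where "X t = euler_at 2 t * euler_at 16 t ^ 2 / (euler_at 1 t ^ 2 * euler_at 8 t)" for t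
  define B where "B t = 16 * (euler_at 4 t / euler_at 1 t) ^ 8 + 4 * X t * (u t ^ 3 + u t ^ 2 + u t + 1)" for t
  have "(A \<longlongrightarrow> 32) at_i_infinity"
    unfolding A_def v_def by (auto intro!: tendsto_eq_intros)
  hence "eventually (\<lambda>t. A t \<noteq> 0) at_i_infinity" by (rule tendsto_imp_eventually_ne) simp
  moreover have "(B \<longlongrightarrow> 32) at_i_infinity"
    unfolding B_def X_def u_def by (auto intro!: tendsto_eq_intros)
  hence "eventually (\<lambda>t. B t \<noteq> 0) at_i_infinity" by (rule tendsto_imp_eventually_ne) simp
  ultimately show ?thesis using eventually_upper_half
  proof eventually_elim
    case (elim t)
    define q where "q = q_of t"
    define Y where "Y = (euler_at 16 t / euler_at 4 t) ^ 4"
    have nz: "euler_at 1 t \<noteq> 0" "euler_at 2 t \<noteq> 0" "euler_at 4 t \<noteq> 0" "euler_at 8 t \<noteq> 0" "q \<noteq> 0"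
      using euler_at_nz[OF elim(3)] by (simp_all add: q_def)
    have t2: "Im (2 * t) > 0" and t4: "Im (4 * t) > 0" using elim by simp_all
    have "phi_quot (4 * t) ^ 4 - 1 = 16 * q ^ 4 * Y ^ 2"
      using phi_quot_power4[OF t4] euler_at_mult[of _ 4 t] q_of_mult_nat[of 4 t]
      by (simp add: q_def Y_def flip: power_mult)
    moreover have "v t ^ 2 + 1 = 2 * v t * phi_quot (4 * t) ^ 2"
      using phi_quot_duplication[OF t2] by (simp add: v_def)
    \<comment> \<open>With w = \<open>phi_quot (4 * t)\<close>, (v^2 - 1)^2 = (v^2 + 1)^2 - 4 v^2 =
      4 v^2 (w^4 - 1), and w^4 - 1 is a square. The same device one level lower gives x_16 = 2 (u -
      1), against x_4 = 16 (u^4 - 1).\<close>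
    ultimately have "(v t ^ 2 - 1) ^ 2 = (8 * v t * q ^ 2 * Y) ^ 2" by algebra
    moreover have v4: "v t ^ 4 - 1 = 16 * q ^ 2 * (euler_at 8 t / euler_at 2 t) ^ 8"
      using phi_quot_power4[OF t2] euler_at_mult[of _ 2 t] q_of_mult_nat[of 2 t] by (simp add: v_def q_def)
    have "v t ^ 2 - 1 + 8 * v t * q ^ 2 * Y \<noteq> 0"
    proof
      assume "v t ^ 2 - 1 + 8 * v t * q ^ 2 * Y = 0"
      hence "q ^ 2 * A t = 0" unfolding A_def Y_def[symmetric] using v4 by algebra
      thus False using nz elim(1) by simp
    qed
    ultimately have v: "v t ^ 2 - 1 = 8 * v t * q ^ 2 * Y" by (rule squares_eq_imp_eq)
    have "u t * v t * Y = X t ^ 2"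
      unfolding u_def v_def X_def Y_def phi_quot_double unfolding phi_quot_def
      using nz by (simp add: power_divide power_mult_distrib field_simps flip: power_mult power_add)
    moreover have "u t ^ 2 + 1 = 2 * u t * v t ^ 2"
      using phi_quot_duplication[OF elim(3)] by (simp add: u_def v_def)
    ultimately have "(u t - 1) ^ 2 = (4 * q * X t) ^ 2" using v by algebra
    moreover have u4: "u t ^ 4 - 1 = 16 * q * (euler_at 4 t / euler_at 1 t) ^ 8"
      using phi_quot_power4[OF elim(3)] by (simp add: u_def q_def)
    have "u t - 1 + 4 * q * X t \<noteq> 0"
    proof
      assume "u t - 1 + 4 * q * X t = 0"
      hence "q * B t = 0" unfolding B_def using u4 by algebra
      thus False using nz elim(2) by simp
    qed
    ultimately have "u t - 1 = 4 * q * X t" by (rule squares_eq_imp_eq)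
    moreover have "hauptmodul 16 t = 8 * q * X t" by (simp add: hauptmodul_eq_euler_at X_def q_def)
    ultimately have "hauptmodul 16 t = 2 * (u t - 1)" by simp
    moreover have "hauptmodul 4 t = 16 * (u t ^ 4 - 1)" unfolding u4 by (simp add: hauptmodul_eq_euler_at q_def)
    ultimately show ?case by algebra
  qed
qed

lemma R_identity_4:
  "Im t > 0 \<Longrightarrow> hauptmodul 4 t = hauptmodul 16 t * (hauptmodul 16 t + 4) * (hauptmodul 16 t ^ 2 + 4 * hauptmodul 16 t + 8)"
  by (rule upper_half_eqI[OF _ _ R_identity_4_eventually]) (intro holomorphic_intros hauptmodul_holomorphic; simp)+

section \<open>The reduced fractions for j\<close>

lemma hauptmodul_eq_R_poly:
  assumes "N \<in> {2, 3, 4, 5}" "Im t > 0"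
  shows "hauptmodul N t = poly (R_poly N) (hauptmodul (N\<^sup>2) t)"
proof -
  have "N = 2 \<or> N = 3 \<or> N = 4 \<or> N = 5" using assms by simp
  thus ?thesis
    using R_identity_2[OF assms(2)] R_identity_3[OF assms(2)] R_identity_4[OF assms(2)] R_identity_5[OF assms(2)]
    by (elim disjE) (simp_all add: R_poly_def algebra_simps eval_nat_numeral)
qed

text \<open>The values are never 0 but tend to 0 at the cusp.\<close>

lemma infinite_hauptmodul_image:
  assumes "M \<in> {2, 3, 4, 5, 9, 16, 25}"
  shows "infinite (hauptmodul M ` {t. Im t > 0})"
proof
  let ?S = "hauptmodul M ` {t. Im t > 0}"
  assume "finite ?S"
  hence "open (- ?S)" by (simp add: finite_imp_closed open_Compl)
  moreover have "0 \<in> - ?S" using hauptmodul_nz[OF assms] by force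
  ultimately have "eventually (\<lambda>t. hauptmodul M t \<in> - ?S) at_i_infinity"
    using hauptmodul_tendsto_0[OF assms] topological_tendstoD by blast
  with eventually_upper_half have "eventually (\<lambda>_. False) at_i_infinity"
    by eventually_elim auto
  thus False by simp
qed

lemma monic_dvd_antisym:
  fixes P P' :: "complex poly"
  assumes "P dvd P'" "P' dvd P" "lead_coeff P = 1" "lead_coeff P' = 1"
  shows "P = P'"
proof -
  obtain k where k: "P' = P * k" using assms(1) by (elim dvdE)
  have nz: "P \<noteq> 0" "P' \<noteq> 0" using assms(3,4) by auto
  have "degree P' = degree P + degree k" using k nz by (auto intro: degree_mult_eq)
  moreover have "degree P' \<le> degree P" using assms(2) nz by (intro dvd_imp_degree_le)
  ultimately obtain a where a: "k = [:a:]" by (auto elim: degree_eq_zeroE)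
  have "a = 1" using assms(3,4) by (simp add: k a split: if_splits)
  thus ?thesis using k a by simp
qed

text \<open>Euclid's lemma by induction on the degree: a root of P is not a root of Q, hence is one
  of R, and the same linear factor splits off P and R.\<close>

lemma coprime_dvd_mult_complex_poly:
  fixes P Q R :: "complex poly"
  assumes "coprime P Q" "P dvd R * Q" "P \<noteq> 0"
  shows "P dvd R"
  using assms
proof (induction "degree P" arbitrary: P R)
  case 0
  thus ?case by (metis is_unit_iff_degree unit_imp_dvd)
next
  case (Suc n)
  have "\<not> constant (poly P)" using Suc.hyps(2) by (simp add: constant_degree)
  then obtain z where z: "poly P z = 0" using fundamental_theorem_of_algebra by blast
  define d where "d = [:- z, 1:]"
  have d: "degree d = 1" "d \<noteq> 0" by (simp_all add: d_def)
  obtain P1 where P1: "P = d * P1" using z by (auto simp: poly_eq_0_iff_dvd d_def elim: dvdE)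
  have "poly Q z \<noteq> 0"
  proof
    assume "poly Q z = 0"
    hence "is_unit d" using z Suc.prems(1) coprime_common_divisor[of P Q d] by (simp add: poly_eq_0_iff_dvd d_def)
    thus False using d by (simp add: is_unit_iff_degree)
  qed
  moreover obtain w where "R * Q = P * w" using Suc.prems(2) by (elim dvdE)
  hence "poly (R * Q) z = 0" using z by simp
  ultimately have "poly R z = 0" by simp
  then obtain R1 where R1: "R = d * R1" by (auto simp: poly_eq_0_iff_dvd d_def elim: dvdE)
  have "P1 dvd R1"
  proof (rule Suc.hyps(1))
    show "P1 \<noteq> 0" using Suc.prems(3) P1 by auto
    hence "degree P = 1 + degree P1" unfolding P1 using d by (subst degree_mult_eq) auto
    thus "n = degree P1" using Suc.hyps(2) by simp
    show "coprime P1 Q" by (rule coprime_divisors[OF _ dvd_refl Suc.prems(1)]) (simp add: P1)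
    show "P1 dvd R1 * Q" using Suc.prems(2) d(2) unfolding P1 R1 by (simp add: mult.assoc)
  qed
  thus ?case unfolding P1 R1 by simp
qed

text \<open>Two fractions agree at infinitely many values of the Hauptmodul, so they are equal as
  rational functions; coprimality and monic leading coefficients do the rest. This gives access to
  the definite description in \<open>j_fraction\<close>.\<close>

lemma is_j_fraction_unique:
  assumes M: "M \<in> {2, 3, 4, 5, 9, 16, 25}" and 1: "is_j_fraction M P Q" and 2: "is_j_fraction M P' Q'"
  shows "P = P' \<and> Q = Q'"
proof -
  have "hauptmodul M ` {t. Im t > 0} \<subseteq> {x. poly (P * Q' - P' * Q) x = 0}"
  proof safe
    fix t assume t: "Im t > 0"
    have "poly Q (hauptmodul M t) \<noteq> 0" "poly Q' (hauptmodul M t) \<noteq> 0"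
      "poly P (hauptmodul M t) / poly Q (hauptmodul M t) = poly P' (hauptmodul M t) / poly Q' (hauptmodul M t)"
      using 1 2 t unfolding is_j_fraction_def by metis+
    thus "poly (P * Q' - P' * Q) (hauptmodul M t) = 0" by (simp add: field_simps)
  qed
  hence "infinite {x. poly (P * Q' - P' * Q) x = 0}"
    using infinite_hauptmodul_image[OF M] infinite_super by blast
  hence "P * Q' - P' * Q = 0" using poly_roots_finite by blast
  hence eq: "P * Q' = P' * Q" by simp
  have nz: "P \<noteq> 0" "P' \<noteq> 0" using 1 2 by (auto simp: is_j_fraction_def)
  have "P dvd P' * Q" by (metis dvd_triv_left eq)
  hence "P dvd P'" using 1 nz by (intro coprime_dvd_mult_complex_poly[of P Q P']) (simp_all add: is_j_fraction_def)
  moreover have "P' dvd P * Q'" by (metis dvd_triv_left eq)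
  hence "P' dvd P" using 2 nz by (intro coprime_dvd_mult_complex_poly[of P' Q' P]) (simp_all add: is_j_fraction_def)
  ultimately have "P = P'" using 1 2 by (intro monic_dvd_antisym) (simp_all add: is_j_fraction_def)
  thus ?thesis using eq nz by simp
qed

lemma j_fraction_eqI:
  assumes "M \<in> {2, 3, 4, 5, 9, 16, 25}" "is_j_fraction M P Q"
  shows "j_num M = P" "j_den M = Q"
proof -
  have "j_fraction M = (P, Q)"
    unfolding j_fraction_def
  proof (rule the_equality)
    fix PQ assume PQ: "case PQ of (P, Q) \<Rightarrow> is_j_fraction M P Q"
    obtain P' Q' where eq: "PQ = (P', Q')" by (cases PQ)
    have "is_j_fraction M P' Q'" using PQ eq by simp
    from is_j_fraction_unique[OF assms(1) this assms(2)] show "PQ = (P, Q)" by (simp add: eq)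
  qed (use assms in simp)
  thus "j_num M = P" "j_den M = Q" by (simp_all add: j_num_def j_den_def)
qed

lemma coprime_pCons_0_1:
  fixes P :: "complex poly"
  assumes "poly P 0 \<noteq> 0"
  shows "coprime P [:0, 1:]"
proof (rule coprimeI)
  fix c assume c: "c dvd P" "c dvd [:0, 1:]"
  obtain a R where P: "P = pCons a R" by (cases P)
  have "c dvd P - [:0, 1:] * R" by (intro dvd_diff c(1) dvd_mult2 c(2))
  also have "P - [:0, 1:] * R = [:a:]" by (simp add: P)
  finally have "c dvd [:a:]" .
  moreover have "is_unit [:a:]" using assms by (simp add: P is_unit_const_poly_iff dvd_field_iff)
  ultimately show "is_unit c" by (rule dvd_unit_imp_unit)
qed

lemma is_j_fraction_base:
  "is_j_fraction 2 ([:16, 1:] ^ 3) [:0, 1:]"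
  "is_j_fraction 3 ([:3, 1:] ^ 3 * [:27, 1:]) [:0, 1:]"
  "is_j_fraction 5 ([:5, 10, 1:] ^ 3) [:0, 1:]"
proof -
  have P3: "poly ([:3, 1:] ^ 3 * [:27, 1:]) x = (x + 3) ^ 3 * (x + 27)" for x :: complex
    unfolding poly_mult poly_power by (simp add: add.commute)
  have P5: "poly ([:5, 10, 1:] ^ 3) x = (x ^ 2 + 10 * x + 5) ^ 3" for x :: complex
    unfolding poly_power by (simp add: algebra_simps power2_eq_square)
  show "is_j_fraction 2 ([:16, 1:] ^ 3) [:0, 1:]"
    unfolding is_j_fraction_def
    by (auto simp: lead_coeff_power hauptmodul_2 hpt_nz klein_j_level2 poly_power add.commute intro!: coprime_pCons_0_1)
  show "is_j_fraction 3 ([:3, 1:] ^ 3 * [:27, 1:]) [:0, 1:]"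
    unfolding is_j_fraction_def lead_coeff_mult lead_coeff_power P3 hauptmodul_3
    by (auto simp: hpt_nz klein_j_level3 intro!: coprime_pCons_0_1)
  show "is_j_fraction 5 ([:5, 10, 1:] ^ 3) [:0, 1:]"
    unfolding is_j_fraction_def lead_coeff_power P5 hauptmodul_5
    using klein_j_level5 by (auto simp: hpt_nz intro!: coprime_pCons_0_1)
qed

text \<open>A nonconstant common factor would have a root z, and then R(z) would be a common root of
  P and Q.\<close>

lemma coprime_pcompose:
  fixes P Q R :: "complex poly"
  assumes "coprime P Q" "pcompose P R \<noteq> 0"
  shows "coprime (pcompose P R) (pcompose Q R)"
proof (rule coprimeI)
  fix c assume c: "c dvd pcompose P R" "c dvd pcompose Q R"
  have "c \<noteq> 0" using c assms by auto
  show "is_unit c"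
  proof (rule ccontr)
    assume "\<not> is_unit c"
    hence "degree c \<noteq> 0" using \<open>c \<noteq> 0\<close> is_unit_iff_degree by blast
    then obtain z where "poly c z = 0"
      using fundamental_theorem_of_algebra[of c] by (auto simp: constant_degree)
    hence "poly P (poly R z) = 0" "poly Q (poly R z) = 0"
      using c by (auto simp: poly_pcompose[symmetric] elim!: dvdE simp del: poly_pcompose)
    hence "[:- poly R z, 1:] dvd P" "[:- poly R z, 1:] dvd Q" by (simp_all add: poly_eq_0_iff_dvd)
    hence "is_unit [:- poly R z, 1:]" using assms(1) coprime_common_divisor by blast
    thus False by (simp add: is_unit_iff_degree)
  qed
qed

lemma is_j_fraction_pcompose:
  assumes "is_j_fraction N P Q" "lead_coeff R = 1" "degree R > 0"
    and "\<And>t. Im t > 0 \<Longrightarrow> hauptmodul N t = poly R (hauptmodul M t)"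
  shows "is_j_fraction M (pcompose P R) (pcompose Q R)"
proof -
  have "lead_coeff (pcompose P R) = 1" "lead_coeff (pcompose Q R) = 1"
    using assms by (simp_all add: lead_coeff_comp is_j_fraction_def)
  moreover from this have "coprime (pcompose P R) (pcompose Q R)"
    using assms(1) by (intro coprime_pcompose) (auto simp: is_j_fraction_def)
  ultimately show ?thesis using assms(1,4) by (auto simp: is_j_fraction_def poly_pcompose)
qed

lemma R_poly_monic: "N \<in> {2, 3, 4, 5} \<Longrightarrow> lead_coeff (R_poly N) = 1 \<and> degree (R_poly N) > 0 \<and> poly (R_poly N) 0 = 0"
  by (auto simp: R_poly_def)

lemma is_j_fraction_4: "is_j_fraction 4 (pcompose ([:16, 1:] ^ 3) (R_poly 2)) (pcompose [:0, 1:] (R_poly 2))"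
  using is_j_fraction_pcompose[OF is_j_fraction_base(1), of "R_poly 2" 4] R_poly_monic[of 2] hauptmodul_eq_R_poly[of 2]
  by simp

lemma is_j_fraction_exists: "N \<in> {2, 3, 4, 5} \<Longrightarrow> \<exists>P Q. is_j_fraction N P Q"
  using is_j_fraction_base is_j_fraction_4 by auto

text \<open>Because R vanishes at 0, the normalising values P(0) agree as well, and the two sides
  are the same expression for every x, branch cuts included.\<close>

lemma h_fun_square_level:
  assumes N: "N \<in> {2, 3, 4, 5}"
  shows "h_fun (N\<^sup>2) x = h_fun N (poly (R_poly N) x)"
proof -
  obtain P Q where PQ: "is_j_fraction N P Q" using is_j_fraction_exists[OF N] by blast
  have N': "N \<in> {2, 3, 4, 5, 9, 16, 25}" "N\<^sup>2 \<in> {2, 3, 4, 5, 9, 16, 25}" using N by auto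
  have "is_j_fraction (N\<^sup>2) (pcompose P (R_poly N)) (pcompose Q (R_poly N))"
    by (rule is_j_fraction_pcompose[OF PQ]) (use R_poly_monic[OF N] hauptmodul_eq_R_poly[OF N] in auto)
  hence "j_num (N\<^sup>2) = pcompose (j_num N) (R_poly N)" "j_den (N\<^sup>2) = pcompose (j_den N) (R_poly N)"
    using j_fraction_eqI[OF N'(1) PQ] j_fraction_eqI[OF N'(2)] by simp_all
  thus ?thesis using R_poly_monic[OF N] by (simp add: h_fun_def poly_pcompose)
qed

subsection \<open>The differential equation\<close>

text \<open>The factor x in front of the second derivative makes 0 a singular point; both exponents
  there are 0 when a and b agree at 0 with a nonzero value.\<close>

definition ode :: "complex poly \<Rightarrow> complex poly \<Rightarrow> complex poly \<Rightarrow> (complex \<Rightarrow> complex) \<Rightarrow> bool" where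
  "ode a b c f \<longleftrightarrow> (\<exists>f1 f2. \<forall>\<^sub>F x in nhds 0.
     (f has_field_derivative f1 x) (at x) \<and> (f1 has_field_derivative f2 x) (at x) \<and>
     x * poly a x * f2 x + poly b x * f1 x + poly c x * f x = 0)"

lemma ode_diff:
  assumes "ode a b c f" "ode a b c g"
  shows "ode a b c (\<lambda>x. f x - g x)"
proof -
  obtain f1 f2 where f: "\<forall>\<^sub>F x in nhds 0. (f has_field_derivative f1 x) (at x) \<and> (f1 has_field_derivative f2 x) (at x) \<and>
     x * poly a x * f2 x + poly b x * f1 x + poly c x * f x = 0" using assms(1) by (auto simp: ode_def)
  obtain g1 g2 where g: "\<forall>\<^sub>F x in nhds 0. (g has_field_derivative g1 x) (at x) \<and> (g1 has_field_derivative g2 x) (at x) \<and>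
     x * poly a x * g2 x + poly b x * g1 x + poly c x * g x = 0" using assms(2) by (auto simp: ode_def)
  from f g have "\<forall>\<^sub>F x in nhds 0. ((\<lambda>x. f x - g x) has_field_derivative f1 x - g1 x) (at x) \<and>
      ((\<lambda>x. f1 x - g1 x) has_field_derivative f2 x - g2 x) (at x) \<and>
      x * poly a x * (f2 x - g2 x) + poly b x * (f1 x - g1 x) + poly c x * (f x - g x) = 0"
  proof eventually_elim
    case (elim x)
    have "x * poly a x * (f2 x - g2 x) + poly b x * (f1 x - g1 x) + poly c x * (f x - g x) = 0"
      using elim by algebra
    thus ?case using elim by (auto intro: DERIV_diff)
  qed
  thus ?thesis unfolding ode_def by (intro exI[of _ "\<lambda>x. f1 x - g1 x"] exI[of _ "\<lambda>x. f2 x - g2 x"])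
qed

text \<open>The indicial equation at the regular singular point \<open>0\<close> is \<open>n\<^sup>2 = 0\<close>, so a solution \<open>x ^ n * g x\<close>
  with \<open>g 0 \<noteq> 0\<close> has \<open>n = 0\<close>.\<close>

lemma ode_zero:
  assumes f: "ode a b c f" and "f 0 = 0" and ab: "poly a 0 = poly b 0" "poly a 0 \<noteq> 0"
  shows "\<forall>\<^sub>F x in nhds 0. f x = 0"
proof -
  obtain f1 f2 where "\<forall>\<^sub>F x in nhds 0. (f has_field_derivative f1 x) (at x) \<and> (f1 has_field_derivative f2 x) (at x) \<and>
     x * poly a x * f2 x + poly b x * f1 x + poly c x * f x = 0" using f by (auto simp: ode_def)
  then obtain e where e: "e > 0" and
    f1: "\<And>x. x \<in> ball 0 e \<Longrightarrow> (f has_field_derivative f1 x) (at x)" and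
    f2: "\<And>x. x \<in> ball 0 e \<Longrightarrow> (f1 has_field_derivative f2 x) (at x)" and
    eq: "\<And>x. x \<in> ball 0 e \<Longrightarrow> x * poly a x * f2 x + poly b x * f1 x + poly c x * f x = 0"
    by (auto simp: eventually_nhds_metric dist_commute)
  have hol: "f holomorphic_on ball 0 e" unfolding holomorphic_on_open[OF open_ball] using f1 by blast
  show ?thesis
  proof (cases "f constant_on ball 0 e")
    case True
    then obtain k where k: "\<And>x. x \<in> ball 0 e \<Longrightarrow> f x = k" unfolding constant_on_def by blast
    have "k = 0" using k[of 0] e \<open>f 0 = 0\<close> by simp
    thus ?thesis using k e by (auto simp: eventually_nhds_metric dist_commute)
  next
    case False
    have zero_in: "0 \<in> ball 0 e" using e by simp
    have "\<exists>g r n. 0 < n \<and> 0 < r \<and> ball (0::complex) r \<subseteq> ball 0 e \<and> g holomorphic_on ball 0 r \<and>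
        (\<forall>w\<in>ball 0 r. f w = w ^ n * g w) \<and> (\<forall>w\<in>ball 0 r. g w \<noteq> 0)"
    proof (rule holomorphic_factor_zero_nonconstant[OF hol open_ball connected_ball zero_in \<open>f 0 = 0\<close> False])
      fix g r and n :: nat
      assume "0 < n" "0 < r" "ball (0::complex) r \<subseteq> ball 0 e" "g holomorphic_on ball 0 r"
        "\<And>w. w \<in> ball 0 r \<Longrightarrow> f w = (w - 0) ^ n * g w" "\<And>w. w \<in> ball 0 r \<Longrightarrow> g w \<noteq> 0"
      thus ?thesis by (intro exI[of _ g] exI[of _ r] exI[of _ n] conjI ballI) simp_all
    qed
    then obtain g r and n :: nat where n: "0 < n" and r: "0 < r" "ball (0::complex) r \<subseteq> ball 0 e" and g: "g holomorphic_on ball 0 r"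
      and fg: "\<And>w. w \<in> ball 0 r \<Longrightarrow> f w = w ^ n * g w" and gnz: "\<And>w. w \<in> ball 0 r \<Longrightarrow> g w \<noteq> 0"
      by auto
    define k where "k x = of_nat n * g x + x * deriv g x" for x
    have hol_g': "deriv g holomorphic_on ball 0 r" by (intro holomorphic_deriv g open_ball)
    have hol_k: "k holomorphic_on ball 0 r" unfolding k_def by (intro holomorphic_intros g hol_g')
    have xn: "((\<lambda>x::complex. x ^ n) has_field_derivative of_nat n * x ^ (n - 1)) (at x)" for x
      by (auto intro!: derivative_eq_intros)
    have xn': "x * (of_nat n * x ^ (n - 1)) = of_nat n * x ^ n" for x :: complex
      using n power_eq_if[of x n] by simp
    have Leibniz: "x * D = x ^ n * (of_nat n * u x + x * deriv u x)"
      if u: "u holomorphic_on ball 0 r" and v: "\<And>x. x \<in> ball 0 r \<Longrightarrow> v x = x ^ n * u x"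
        and x: "x \<in> ball 0 r" and D: "(v has_field_derivative D) (at x)" for u v x D
    proof -
      have "((\<lambda>x. x ^ n * u x) has_field_derivative (of_nat n * x ^ (n - 1) * u x + deriv u x * x ^ n)) (at x)"
        by (intro DERIV_mult xn holomorphic_derivI[OF u open_ball x])
      moreover have "((\<lambda>x. x ^ n * u x) has_field_derivative D) (at x)"
        by (rule has_field_derivative_transform_within_open[OF D open_ball x]) (use v in auto)
      ultimately have D: "D = of_nat n * x ^ (n - 1) * u x + deriv u x * x ^ n" by (rule DERIV_unique[symmetric])
      have "x * D = (x * (of_nat n * x ^ (n - 1))) * u x + x * deriv u x * x ^ n"
        unfolding D by (simp add: algebra_simps)
      thus ?thesis unfolding xn' by (simp add: algebra_simps)
    qed
    have xf1: "x * f1 x = x ^ n * k x" if x: "x \<in> ball 0 r" for x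
      unfolding k_def by (rule Leibniz[OF g _ x f1]) (use fg x r in auto)
    have xf2: "x * (f1 x + x * f2 x) = x ^ n * (of_nat n * k x + x * deriv k x)" if x: "x \<in> ball 0 r" for x
    proof (rule Leibniz[OF hol_k _ x])
      show "((\<lambda>x. x * f1 x) has_field_derivative f1 x + x * f2 x) (at x)"
        using DERIV_mult[OF DERIV_ident f2, of x] x r by (auto simp: algebra_simps)
    qed (use xf1 in auto)
    define K where "K x = poly a x * (of_nat n * k x + x * deriv k x) + (poly b x - poly a x) * k x + poly c x * x * g x" for x
    have K0: "K x = 0" if "x \<in> ball 0 r - {0}" for x
    proof -
      have x: "x \<in> ball 0 r" "x \<noteq> 0" using that by auto
      have comb: "X * (A * N + (B - A) * k + C * x * g) = 0"
        if "x * A * f2 + B * f1 + C * f = 0" "f = X * g" "x * f1 = X * k" "x * (f1 + x * f2) = X * N"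
        for X A B C N k g f f1 f2 :: complex using that by algebra
      have "x * poly a x * f2 x + poly b x * f1 x + poly c x * f x = 0" using eq x r by auto
      from comb[OF this fg[OF x(1)] xf1[OF x(1)] xf2[OF x(1)]] have "x ^ n * K x = 0" unfolding K_def .
      thus ?thesis using x by simp
    qed
    have "K holomorphic_on ball 0 r"
      unfolding K_def by (intro holomorphic_intros hol_k g holomorphic_deriv open_ball)
    hence "isCont K 0"
      by (rule continuous_on_interior[OF holomorphic_on_imp_continuous_on]) (use r in auto)
    hence "(K \<longlongrightarrow> K 0) (at 0)" by (simp add: continuous_at)
    moreover have "eventually (\<lambda>x::complex. x \<in> ball 0 r - {0}) (at 0)"
      using r by (intro eventually_at_in_open) auto
    hence "eventually (\<lambda>x. K x = 0) (at 0)" by eventually_elim (rule K0)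
    ultimately have "K 0 = 0" by (metis tendsto_eventually tendsto_unique at_neq_bot)
    moreover have "K 0 = poly a 0 * of_nat n ^ 2 * g 0" using ab(1) by (simp add: K_def k_def power2_eq_square)
    ultimately have False using ab(2) n gnz[of 0] r by simp
    thus ?thesis ..
  qed
qed

lemma ode_unique:
  assumes "ode a b c f" "ode a b c g" "f 0 = g 0" "poly a 0 = poly b 0" "poly a 0 \<noteq> 0"
  shows "\<forall>\<^sub>F x in nhds 0. f x = g x"
  using ode_zero[OF ode_diff[OF assms(1,2)] _ assms(4,5)] assms(3) by simp

section \<open>Pullback of differential equations\<close>

definition hom_poly :: "nat \<Rightarrow> complex poly \<Rightarrow> complex poly \<Rightarrow> complex poly \<Rightarrow> complex poly" where
  "hom_poly k a n s = (\<Sum>i\<le>k. smult (coeff a i) (n ^ i * s ^ (k - i)))"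

lemma poly_hom_poly:
  assumes "degree a \<le> k" "poly s x \<noteq> 0"
  shows "poly (hom_poly k a n s) x = poly s x ^ k * poly a (poly n x / poly s x)"
proof -
  have 1: "poly a y = (\<Sum>i\<le>k. coeff a i * y ^ i)" for y
    unfolding poly_altdef using assms(1) by (intro sum.mono_neutral_left) (auto simp: coeff_eq_0)
  have 2: "coeff a i * (poly n x ^ i * poly s x ^ (k - i)) =
      poly s x ^ k * (coeff a i * (poly n x / poly s x) ^ i)" if "i \<le> k" for i
    using that assms(2) by (simp add: power_divide power_diff)
  show ?thesis unfolding hom_poly_def 1 poly_sum sum_distrib_left
    by (intro sum.cong refl) (simp only: poly_smult poly_mult poly_power 2 atMost_iff)
qed

text \<open>With \<open>r = n / s\<close> the derivatives are \<open>r' = p / s\<^sup>2\<close> and \<open>r'' = (p' s - 2 p s') / s\<^sup>3\<close>; the logarithmic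
  derivative of the prefactor is \<open>e s' / s\<close>. The three polynomial identities compare the coefficients of
  \<open>h''(r)\<close>, \<open>h'(r)\<close> and \<open>h(r)\<close>.\<close>

lemma ode_pullback:
  fixes a b c a' b' c' n s l p p' ds dds :: "complex poly" and e :: complex
  assumes h: "ode a b c h" and deg: "degree a \<le> k" "degree b \<le> k" "degree c \<le> k"
    and s0: "poly s 0 \<noteq> 0" and n0: "poly n 0 = 0"
    and ds: "pderiv s = ds" "pderiv ds = dds" and p: "pderiv n * s - n * ds = p" "pderiv p = p'"
    and eq1: "[:0, 1:] * a' * (p * p) = l * (n * hom_poly k a n s)"
    and eq2: "[:0, 1:] * a' * (smult (2 * e - 2) (ds * p) + p' * s) + b' * p * s = l * hom_poly k b n s"
    and eq3: "[:0, 1:] * a' * s * (smult e (dds * s) + smult (e * e - e) (ds * ds)) + smult e (b' * ds * (s * s)) + c' * (s * (s * s))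
        = l * hom_poly k c n s"
  shows "ode a' b' c' (\<lambda>x. (poly s x / poly s 0) powr e * h (poly n x / poly s x))"
proof -
  obtain h1 h2 where h: "\<forall>\<^sub>F y in nhds 0. (h has_field_derivative h1 y) (at y) \<and> (h1 has_field_derivative h2 y) (at y) \<and>
     y * poly a y * h2 y + poly b y * h1 y + poly c y * h y = 0" using h by (auto simp: ode_def)
  define r where "r x = poly n x / poly s x" for x
  define r1 where "r1 x = poly p x / poly s x ^ 2" for x
  define r2 where "r2 x = (poly p' x * poly s x - 2 * poly p x * poly ds x) / poly s x ^ 3" for x
  define A where "A x = (poly s x / poly s 0) powr e" for x
  define al where "al x = e * poly ds x / poly s x" for x
  define al1 where "al1 x = e * (poly dds x * poly s x - poly ds x ^ 2) / poly s x ^ 2" for x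
  define f1 where "f1 x = A x * (al x * h (r x) + r1 x * h1 (r x))" for x
  define f2 where "f2 x = A x * ((al1 x + al x ^ 2) * h (r x) + (2 * al x * r1 x + r2 x) * h1 (r x) + r1 x ^ 2 * h2 (r x))" for x
  have "isCont r 0" unfolding r_def using s0 by (intro continuous_intros) auto
  hence "filterlim r (nhds 0) (nhds 0)"
    using n0 by (simp add: continuous_at tendsto_nhds_iff r_def)
  from eventually_compose_filterlim[OF h this]
  have H: "\<forall>\<^sub>F x in nhds 0. (h has_field_derivative h1 (r x)) (at (r x)) \<and> (h1 has_field_derivative h2 (r x)) (at (r x)) \<and>
     r x * poly a (r x) * h2 (r x) + poly b (r x) * h1 (r x) + poly c (r x) * h (r x) = 0" .
  have "isCont (\<lambda>x. poly s x / poly s 0) 0" using s0 by (intro continuous_intros) auto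
  hence "((\<lambda>x. poly s x / poly s 0) \<longlongrightarrow> 1) (nhds 0)"
    using s0 by (simp add: continuous_at tendsto_nhds_iff)
  \<comment> \<open>A positive real part keeps the base of the power away from the cut, so the
    principal branch is differentiable.\<close>
  from tendsto_Re[OF this] have "((\<lambda>x. Re (poly s x / poly s 0)) \<longlongrightarrow> 1) (nhds 0)" by simp
  hence "\<forall>\<^sub>F x in nhds 0. Re (poly s x / poly s 0) > 0" by (rule order_tendstoD) simp
  with H have "\<forall>\<^sub>F x in nhds 0. ((\<lambda>x. A x * h (r x)) has_field_derivative f1 x) (at x) \<and> (f1 has_field_derivative f2 x) (at x) \<and>
     x * poly a' x * f2 x + poly b' x * f1 x + poly c' x * (A x * h (r x)) = 0"
  proof eventually_elim
    case (elim x)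
    define i where "i = 1 / poly s x"
    have sx: "poly s x \<noteq> 0" using elim by auto
    have si: "poly s x * i = 1" using sx by (simp add: i_def)
    have pd: "(poly u has_field_derivative poly (pderiv u) x) (at x)" for u by (rule poly_DERIV)
    have dS: "(poly s has_field_derivative poly ds x) (at x)" using pd[of s] ds by simp
    have ddS: "(poly ds has_field_derivative poly dds x) (at x)" using pd[of ds] ds by simp
    have dP: "(poly p has_field_derivative poly p' x) (at x)" using pd[of p] p by simp
    have px: "poly p x = poly (pderiv n) x * poly s x - poly n x * poly ds x" using p(1) by (metis poly_diff poly_mult)
    have dr: "(r has_field_derivative r1 x) (at x)"
      unfolding r_def[abs_def] r1_def px
      by (rule DERIV_cong[OF DERIV_divide[OF pd dS sx]]) (simp add: power2_eq_square)
    have dr1: "(r1 has_field_derivative r2 x) (at x)"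
      unfolding r1_def[abs_def] r2_def
      by (rule DERIV_cong[OF DERIV_divide[OF dP DERIV_power[OF dS, of 2]]])
        (use sx in \<open>simp_all add: field_simps eval_nat_numeral\<close>)
    have dal: "(al has_field_derivative al1 x) (at x)"
      unfolding al_def[abs_def] al1_def
      by (rule DERIV_cong[OF DERIV_divide[OF DERIV_cmult[OF ddS] dS sx]]) (simp add: algebra_simps power2_eq_square)
    have dA: "(A has_field_derivative al x * A x) (at x)"
    proof -
      define y where "y = poly s x / poly s 0"
      have y: "y \<notin> \<real>\<^sub>\<le>\<^sub>0" "y \<noteq> 0" using elim(2) by (auto simp: y_def complex_nonpos_Reals_iff)
      have "((\<lambda>x. poly s x / poly s 0) has_field_derivative poly ds x / poly s 0) (at x)"
        by (rule DERIV_cdivide[OF dS])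
      from DERIV_chain2[OF has_field_derivative_powr[OF y(1)[unfolded y_def], of e] this]
      have "(A has_field_derivative e * y powr (e - 1) * (poly ds x / poly s 0)) (at x)"
        by (simp add: A_def[abs_def] y_def)
      moreover have "e * y powr (e - 1) * (poly ds x / poly s 0) = al x * A x"
        using y(2) s0 sx by (simp add: powr_diff al_def A_def y_def field_simps)
      ultimately show ?thesis by simp
    qed
    have H: "(h has_field_derivative h1 (r x)) (at (r x))" "(h1 has_field_derivative h2 (r x)) (at (r x))"
      and Heq: "r x * poly a (r x) * h2 (r x) + poly b (r x) * h1 (r x) + poly c (r x) * h (r x) = 0"
      using elim by auto
    note dh = DERIV_chain2[OF H(1) dr] and dh1 = DERIV_chain2[OF H(2) dr]
    have 1: "((\<lambda>x. A x * h (r x)) has_field_derivative f1 x) (at x)"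
      by (rule DERIV_cong[OF DERIV_mult[OF dA dh]]) (simp add: f1_def algebra_simps)
    have 2: "(f1 has_field_derivative f2 x) (at x)"
      unfolding f1_def[abs_def]
      by (rule DERIV_cong[OF DERIV_mult[OF dA DERIV_add[OF DERIV_mult[OF dal dh] DERIV_mult[OF dr1 dh1]]]])
        (simp add: f2_def algebra_simps power2_eq_square)
    define sk where "sk = poly s x ^ k"
    \<comment> \<open>Divide the first identity by s^4 and the other two by s^3: the new operator
      applied to A (h o r) is then A \<open>lam\<close> times the old one at r(x).\<close>
    define lam where "lam = poly l x * sk * i ^ 3"
    have ri: "r x = poly n x * i" "r1 x = poly p x * i ^ 2" "al x = e * poly ds x * i"
      "r2 x = (poly p' x * poly s x - 2 * poly p x * poly ds x) * i ^ 3"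
      "al1 x = e * (poly dds x * poly s x - poly ds x ^ 2) * i ^ 2"
      by (simp_all add: r_def r1_def r2_def al_def al1_def i_def power_divide)
    note hom = poly_hom_poly[OF deg(1) sx, of n] poly_hom_poly[OF deg(2) sx, of n] poly_hom_poly[OF deg(3) sx, of n]
    have "x * poly a' x * poly p x ^ 2 = poly l x * (poly n x * (sk * poly a (r x)))"
      using arg_cong[OF eq1, of "\<lambda>u. poly u x"] hom by (simp add: r_def power2_eq_square sk_def mult.assoc)
    hence e1: "x * poly a' x * r1 x ^ 2 = lam * (r x * poly a (r x))"
      unfolding lam_def ri by algebra
    have "x * poly a' x * ((2 * e - 2) * (poly ds x * poly p x) + poly p' x * poly s x) + poly b' x * poly p x * poly s x =
        poly l x * (sk * poly b (r x))"
      using arg_cong[OF eq2, of "\<lambda>u. poly u x"] hom by (simp add: r_def sk_def mult.assoc)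
    hence e2: "x * poly a' x * (2 * al x * r1 x + r2 x) + poly b' x * r1 x = lam * poly b (r x)"
      unfolding lam_def ri using si by algebra
    have "x * poly a' x * poly s x * (e * (poly dds x * poly s x) + (e * e - e) * (poly ds x * poly ds x)) +
        e * (poly b' x * poly ds x * (poly s x * poly s x)) + poly c' x * (poly s x * (poly s x * poly s x)) =
        poly l x * (sk * poly c (r x))"
      using arg_cong[OF eq3, of "\<lambda>u. poly u x"] hom by (simp add: r_def sk_def mult.assoc)
    hence e3: "x * poly a' x * (al1 x + al x ^ 2) + poly b' x * al x + poly c' x = lam * poly c (r x)"
      unfolding lam_def ri using si by algebra
    have "x * poly a' x * f2 x + poly b' x * f1 x + poly c' x * (A x * h (r x)) =
      A x * ((x * poly a' x * r1 x ^ 2) * h2 (r x) + (x * poly a' x * (2 * al x * r1 x + r2 x) + poly b' x * r1 x) * h1 (r x) +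
        (x * poly a' x * (al1 x + al x ^ 2) + poly b' x * al x + poly c' x) * h (r x))"
      unfolding f1_def f2_def by algebra
    also have "\<dots> = A x * lam * (r x * poly a (r x) * h2 (r x) + poly b (r x) * h1 (r x) + poly c (r x) * h (r x))"
      unfolding e1 e2 e3 by algebra
    also have "\<dots> = 0" unfolding Heq by simp
    finally show ?case using 1 2 by blast
  qed
  thus ?thesis unfolding ode_def A_def r_def by blast
qed

lemma ode_compose:
  fixes a b c a' b' c' n l p p' :: "complex poly"
  assumes h: "ode a b c h" and deg: "degree a \<le> k" "degree b \<le> k" "degree c \<le> k"
    and n0: "poly n 0 = 0" and p: "pderiv n = p" "pderiv p = p'"
    and eqs: "[:0, 1:] * a' * (p * p) = l * (n * hom_poly k a n 1)"
      "[:0, 1:] * a' * p' + b' * p = l * hom_poly k b n 1" "c' = l * hom_poly k c n 1"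
  shows "ode a' b' c' (\<lambda>x. h (poly n x))"
  using ode_pullback[OF h deg, of 1 n 0 0 p p' a' l 0 b' c'] n0 p eqs by simp

section \<open>The hypergeometric function\<close>

abbreviation hyp_F :: "complex \<Rightarrow> complex" where
  "hyp_F \<equiv> hyp2F1 (1 / 12) (5 / 12) 1"

lemma hyp_F_coeff_Suc:
  "fps_nth (fps_hypergeo [1 / 12, 5 / 12] [1] 1) (Suc n) = (1 / 12 + of_nat n) * (5 / 12 + of_nat n) /
     (of_nat (Suc n) * of_nat (Suc n)) * fps_nth (fps_hypergeo [1 / 12, 5 / 12] [1] (1 :: complex)) n"
  by (subst fps_hypergeo_rec) (simp add: add.commute)

text \<open>The ratio of consecutive coefficients is at most 1 in norm, so the coefficients are
  bounded by 1 and the series converges in the unit disc.\<close>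

lemma hyp_F_has_fps_expansion: "hyp_F has_fps_expansion fps_hypergeo [1 / 12, 5 / 12] [1] 1"
proof (rule has_fps_expansionI)
  define F :: "complex fps" where "F = fps_hypergeo [1 / 12, 5 / 12] [1] 1"
  have rec: "fps_nth F (Suc n) = (1 / 12 + of_nat n) * (5 / 12 + of_nat n) / (of_nat (Suc n) * of_nat (Suc n)) * fps_nth F n" for n
    unfolding F_def by (rule hyp_F_coeff_Suc)
  have le: "norm (fps_nth F n) \<le> 1" for n
  proof (induction n)
    case (Suc n)
    have "norm ((1 / 12 + of_nat n) * (5 / 12 + of_nat n) / (of_nat (Suc n) * of_nat (Suc n)) :: complex) \<le> 1"
    proof -
      have "(1 / 12 + of_nat n :: complex) = of_real (1 / 12 + real n)" "(5 / 12 + of_nat n :: complex) = of_real (5 / 12 + real n)"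
        by simp_all
      hence "norm ((1 / 12 + of_nat n) * (5 / 12 + of_nat n) :: complex) = (1 / 12 + real n) * (5 / 12 + real n)"
        by (simp only: norm_mult norm_of_real)
      also have "\<dots> \<le> real (Suc n) * real (Suc n)" by (intro mult_mono) auto
      finally show ?thesis by (simp add: norm_divide norm_mult divide_le_eq_1 del: of_nat_Suc)
    qed
    thus ?case unfolding rec norm_mult[of _ "fps_nth F n"] using Suc by (intro mult_le_one) auto
  qed (simp add: F_def)
  have s: "summable (\<lambda>n. fps_nth F n * u ^ n)" if "norm u < 1" for u
    by (rule summable_comparison_test'[of "\<lambda>n. norm u ^ n" 0])
      (use that le in \<open>auto simp: norm_mult norm_power intro!: mult_left_le_one_le\<close>)
  have "eventually (\<lambda>u::complex. u \<in> ball 0 1) (nhds 0)" by (intro eventually_nhds_in_open) auto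
  thus "\<forall>\<^sub>F u in nhds 0. (\<lambda>n. fps_nth (fps_hypergeo [1 / 12, 5 / 12] [1] 1) n * u ^ n) sums hyp_F u"
    by eventually_elim (use s in \<open>simp add: hyp2F1_def eval_fps_def F_def summable_sums\<close>)
qed

text \<open>The equation z (1 - z) F'' + (1 - 3/2 z) F' - 5/144 F = 0, multiplied by 144.\<close>

lemma ode_hyp_F: "ode [:144, - 144:] [:144, - 216:] [:- 5:] hyp_F"
proof -
  define F :: "complex fps" where "F = fps_hypergeo [1 / 12, 5 / 12] [1] 1"
  define F1 F2 where "F1 = fps_deriv F" and "F2 = fps_deriv F1"
  have rec: "of_nat (Suc n) * of_nat (Suc n) * fps_nth F (Suc n) = (1 / 12 + of_nat n) * (5 / 12 + of_nat n) * fps_nth F n" for n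
    unfolding F_def hyp_F_coeff_Suc by (simp del: of_nat_Suc fps_hypergeo_nth)
  have "fps_X * (fps_const 144 - fps_const 144 * fps_X) * F2 + (fps_const 144 - fps_const 216 * fps_X) * F1 - fps_const 5 * F = 0"
  proof (rule fps_ext)
    fix n
    have expand: "fps_X * (fps_const 144 - fps_const 144 * fps_X) * F2 + (fps_const 144 - fps_const 216 * fps_X) * F1 - fps_const 5 * F =
        fps_const 144 * (fps_X * F2) - fps_const 144 * (fps_X * (fps_X * F2)) + fps_const 144 * F1 - fps_const 216 * (fps_X * F1) - fps_const 5 * F"
      by (simp add: algebra_simps)
    show "fps_nth (fps_X * (fps_const 144 - fps_const 144 * fps_X) * F2 + (fps_const 144 - fps_const 216 * fps_X) * F1 - fps_const 5 * F) n = fps_nth 0 n"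
    proof (cases n)
      case 0
      thus ?thesis unfolding expand using rec[of 0] by (simp add: F1_def F2_def mult.commute)
    next
      case (Suc k)
      have "144 * (of_nat (Suc n) * of_nat (Suc n) * fps_nth F (Suc n)) =
          (144 * of_nat n * (of_nat n - 1) + 216 * of_nat n + 5) * fps_nth F n"
        unfolding rec by (simp add: algebra_simps)
      thus ?thesis unfolding expand using Suc by (cases k) (simp_all add: F1_def F2_def algebra_simps)
    qed
  qed
  moreover have F: "hyp_F has_fps_expansion F" unfolding F_def by (rule hyp_F_has_fps_expansion)
  have F1: "eval_fps F1 has_fps_expansion F1" and F2: "eval_fps F2 has_fps_expansion F2"
    using F by (auto simp: has_fps_expansion_def F1_def F2_def intro: less_le_trans[OF _ fps_conv_radius_deriv])
  have "(\<lambda>x. x * (144 - 144 * x) * eval_fps F2 x + (144 - 216 * x) * eval_fps F1 x - 5 * hyp_F x) has_fps_expansion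
      (fps_X * (fps_const 144 - fps_const 144 * fps_X) * F2 + (fps_const 144 - fps_const 216 * fps_X) * F1 - fps_const 5 * F)"
    by (intro fps_expansion_intros F F1 F2)
  ultimately have "(\<lambda>x. x * (144 - 144 * x) * eval_fps F2 x + (144 - 216 * x) * eval_fps F1 x - 5 * hyp_F x) has_fps_expansion 0"
    by simp
  hence eq: "\<forall>\<^sub>F x in nhds 0. x * (144 - 144 * x) * eval_fps F2 x + (144 - 216 * x) * eval_fps F1 x - 5 * hyp_F x = 0"
    by (simp only: has_fps_expansion_0_iff)
  have "fps_conv_radius F > 0" "fps_conv_radius F1 > 0" using F F1 by (auto simp: has_fps_expansion_def)
  hence "\<forall>\<^sub>F x in nhds 0. x \<in> eball 0 (fps_conv_radius F)" "\<forall>\<^sub>F x in nhds 0. x \<in> eball 0 (fps_conv_radius F1)"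
    by (intro eventually_nhds_in_open open_eball; simp add: zero_ereal_def)+
  hence "\<forall>\<^sub>F x in nhds 0. (hyp_F has_field_derivative eval_fps F1 x) (at x) \<and> (eval_fps F1 has_field_derivative eval_fps F2 x) (at x) \<and>
      x * poly [:144, - 144:] x * eval_fps F2 x + poly [:144, - 216:] x * eval_fps F1 x + poly [:- 5:] x * hyp_F x = 0"
    using eq
  proof eventually_elim
    case (elim x)
    have "hyp_F = eval_fps F" by (simp add: fun_eq_iff hyp2F1_def F_def)
    thus ?case
      using elim has_field_derivative_eval_fps[of x F UNIV] has_field_derivative_eval_fps[of x F1 UNIV]
      by (auto simp: F1_def F2_def in_eball_iff algebra_simps)
  qed
  thus ?thesis unfolding ode_def by blast
qed

section \<open>Differential equations at levels 2, 3, 5 and 4\<close>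

text \<open>P - 1728 Q = (x + 64) (x - 8)^2: only the simple root - 64 stays singular beside 0. The
  triple root - 16 of P is removed by the prefactor of exponent - 1/12; the common factor
  \<open>l\<close> is 768 (x + 16)^4.\<close>

lemma ode_h_fun_2: "ode [:1024, 16:] [:1024, 24:] [:1:] (h_fun 2)"
proof -
  have P: "j_num 2 = [:4096, 768, 48, 1:]"
    using j_fraction_eqI(1)[OF _ is_j_fraction_base(1)] by (simp add: power3_eq_cube)
  have Q: "j_den 2 = [:0, 1:]"
    using j_fraction_eqI(2)[OF _ is_j_fraction_base(1)] by simp
  have "ode [:1024, 16:] [:1024, 24:] [:1:]
      (\<lambda>x. (poly [:4096, 768, 48, 1:] x / poly [:4096, 768, 48, 1:] 0) powr (- (1 / 12)) * hyp_F (poly [:0, 1728:] x / poly [:4096, 768, 48, 1:] x))"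
    by (rule ode_pullback[OF ode_hyp_F, where k = 1 and ds = "[:768, 96, 3:]" and dds = "[:96, 6:]"
        and p = "[:7077888, 0, - 82944, - 3456:]" and p' = "[:0, - 165888, - 10368:]" and l = "[:50331648, 12582912, 1179648, 49152, 768:]"])
      (simp_all add: hom_poly_def pderiv_pCons)
  moreover have "h_fun 2 = (\<lambda>x. (poly [:4096, 768, 48, 1:] x / poly [:4096, 768, 48, 1:] 0) powr (- (1 / 12)) *
      hyp_F (poly [:0, 1728:] x / poly [:4096, 768, 48, 1:] x))"
    unfolding h_fun_def[abs_def] P Q by (simp add: mult.commute)
  ultimately show ?thesis by simp
qed

text \<open>Here P - 1728 Q = (x^2 + 18 x - 27)^2 contributes no singular point, whereas the simple
  root - 27 of P does. The common factor \<open>l\<close> is 972 (x + 3)^4 (x + 27).\<close>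

lemma ode_h_fun_3: "ode [:243, 9:] [:243, 15:] [:1:] (h_fun 3)"
proof -
  have P: "j_num 3 = [:729, 756, 270, 36, 1:]"
    using j_fraction_eqI(1)[OF _ is_j_fraction_base(2)] by (simp add: power3_eq_cube)
  have Q: "j_den 3 = [:0, 1:]"
    using j_fraction_eqI(2)[OF _ is_j_fraction_base(2)] by simp
  have "ode [:243, 9:] [:243, 15:] [:1:]
      (\<lambda>x. (poly [:729, 756, 270, 36, 1:] x / poly [:729, 756, 270, 36, 1:] 0) powr (- (1 / 12)) * hyp_F (poly [:0, 1728:] x / poly [:729, 756, 270, 36, 1:] x))"
    by (rule ode_pullback[OF ode_hyp_F, where k = 1 and ds = "[:756, 540, 108, 4:]" and dds = "[:540, 216, 12:]"
        and p = "[:1259712, 0, - 466560, - 124416, - 5184:]" and p' = "[:0, - 933120, - 373248, - 20736:]" and l = "[:2125764, 2913084, 1522152, 367416, 37908, 972:]"])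
      (simp_all add: hom_poly_def pderiv_pCons)
  moreover have "h_fun 3 = (\<lambda>x. (poly [:729, 756, 270, 36, 1:] x / poly [:729, 756, 270, 36, 1:] 0) powr (- (1 / 12)) *
      hyp_F (poly [:0, 1728:] x / poly [:729, 756, 270, 36, 1:] x))"
    unfolding h_fun_def[abs_def] P Q by (simp add: mult.commute)
  ultimately show ?thesis by simp
qed

text \<open>P - 1728 Q = (x^2 + 22 x + 125) (x^2 + 4 x - 1)^2, and the simple quadratic factor
  supplies the singular points. The common factor \<open>l\<close> is 1200 (x^2 + 10 x +
  5)^4.\<close>

lemma ode_h_fun_5: "ode [:500, 88, 4:] [:500, 132, 8:] [:10, 1:] (h_fun 5)"
proof -
  have P: "j_num 5 = [:125, 750, 1575, 1300, 315, 30, 1:]"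
    using j_fraction_eqI(1)[OF _ is_j_fraction_base(3)] by (simp add: power3_eq_cube)
  have Q: "j_den 5 = [:0, 1:]"
    using j_fraction_eqI(2)[OF _ is_j_fraction_base(3)] by simp
  have "ode [:500, 88, 4:] [:500, 132, 8:] [:10, 1:]
      (\<lambda>x. (poly [:125, 750, 1575, 1300, 315, 30, 1:] x / poly [:125, 750, 1575, 1300, 315, 30, 1:] 0) powr (- (1 / 12)) * hyp_F (poly [:0, 1728:] x / poly [:125, 750, 1575, 1300, 315, 30, 1:] x))"
    by (rule ode_pullback[OF ode_hyp_F, where k = 1 and ds = "[:750, 3150, 3900, 1260, 150, 6:]" and dds = "[:3150, 7800, 3780, 600, 30:]"
        and p = "[:216000, 0, - 2721600, - 4492800, - 1632960, - 207360, - 8640:]" and p' = "[:0, - 5443200, - 13478400, - 6531840, - 1036800, - 51840:]" and l = "[:750000, 6000000, 18600000, 27600000, 19380000, 5520000, 744000, 48000, 1200:]"])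
      (simp_all add: hom_poly_def pderiv_pCons)
  moreover have "h_fun 5 = (\<lambda>x. (poly [:125, 750, 1575, 1300, 315, 30, 1:] x / poly [:125, 750, 1575, 1300, 315, 30, 1:] 0) powr (- (1 / 12)) *
      hyp_F (poly [:0, 1728:] x / poly [:125, 750, 1575, 1300, 315, 30, 1:] x))"
    unfolding h_fun_def[abs_def] P Q by (simp add: mult.commute)
  ultimately show ?thesis by simp
qed

text \<open>Substituting x (x + 16) turns the singular factor x_2 + 64 into the square (x + 8)^2, so
  only the two preimages 0 and - 16 of 0 stay singular.\<close>

lemma ode_h_fun_4: "ode [:64, 4:] [:64, 8:] [:1:] (h_fun 4)"
proof -
  have "ode [:64, 4:] [:64, 8:] [:1:] (\<lambda>x. h_fun 2 (poly [:0, 16, 1:] x))"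
    by (rule ode_compose[OF ode_h_fun_2, where k = 1 and p = "[:16, 2:]" and p' = "[:2:]" and l = "[:1:]"])
      (simp_all add: hom_poly_def pderiv_pCons)
  moreover have "h_fun 4 = (\<lambda>x. h_fun 2 (poly [:0, 16, 1:] x))"
    using h_fun_square_level[of 2] by (simp add: fun_eq_iff R_poly_def)
  ultimately show ?thesis by simp
qed

section \<open>The transformation formulas, level by level\<close>

text \<open>Both sides satisfy the equation of \<open>h_fun 4\<close>: adding 64 to either argument
  gives a square up to the factor x + 16, namely (x + 8)^2 and (x + 32)^2 / (x + 16).\<close>

lemma h_fun_transformation_2:
  "\<forall>\<^sub>F x in nhds 0. h_fun 2 (poly [:0, 16, 1:] x) =
     (poly [:16, 1:] x / poly [:16, 1:] 0) powr (- (1 / 4)) * h_fun 2 (poly [:0, 0, 1:] x / poly [:16, 1:] x)"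
proof -
  have "ode [:64, 4:] [:64, 8:] [:1:] (\<lambda>x. h_fun 2 (poly [:0, 16, 1:] x))"
    by (rule ode_compose[OF ode_h_fun_2, where k = 1 and p = "[:16, 2:]" and p' = "[:2:]" and l = "[:1:]"])
      (simp_all add: hom_poly_def pderiv_pCons)
  moreover have "ode [:64, 4:] [:64, 8:] [:1:]
      (\<lambda>x. (poly [:16, 1:] x / poly [:16, 1:] 0) powr (- (1 / 4)) * h_fun 2 (poly [:0, 0, 1:] x / poly [:16, 1:] x))"
    by (rule ode_pullback[OF ode_h_fun_2, where k = 1 and ds = "[:1:]" and dds = "0"
        and p = "[:0, 32, 1:]" and p' = "[:32, 2:]" and l = "[:0, 4, 1 / 4:]"])
      (simp_all add: hom_poly_def pderiv_pCons)
  ultimately show ?thesis by (rule ode_unique) simp_all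
qed

text \<open>R(x) + 27 = (x + 3)^3, so the singularity at - 27, of exponent difference 1/3,
  disappears and only the roots of x S' stay singular.\<close>

lemma h_fun_transformation_3:
  "\<forall>\<^sub>F x in nhds 0. h_fun 3 (poly [:0, 27, 9, 1:] x) =
     (poly [:27, 9, 1:] x / poly [:27, 9, 1:] 0) powr (- (1 / 3)) * h_fun 3 (poly [:0, 0, 0, 1:] x / poly [:27, 9, 1:] x)"
proof -
  have "ode [:27, 9, 1:] [:27, 18, 3:] [:3, 1:] (\<lambda>x. h_fun 3 (poly [:0, 27, 9, 1:] x))"
    by (rule ode_compose[OF ode_h_fun_3, where k = 1 and p = "[:27, 18, 3:]" and p' = "[:18, 6:]" and l = "[:3, 1:]"])
      (simp_all add: hom_poly_def pderiv_pCons)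
  moreover have "ode [:27, 9, 1:] [:27, 18, 3:] [:3, 1:]
      (\<lambda>x. (poly [:27, 9, 1:] x / poly [:27, 9, 1:] 0) powr (- (1 / 3)) * h_fun 3 (poly [:0, 0, 0, 1:] x / poly [:27, 9, 1:] x))"
    by (rule ode_pullback[OF ode_h_fun_3, where k = 1 and ds = "[:9, 2:]" and dds = "[:2:]"
        and p = "[:0, 0, 81, 18, 1:]" and p' = "[:0, 162, 54, 4:]" and l = "[:0, 0, 27, 12, 2, 1 / 9:]"])
      (simp_all add: hom_poly_def pderiv_pCons)
  ultimately show ?thesis by (rule ode_unique) simp_all
qed

text \<open>R(x) + 16 = (x + 2)^4. The singular points are 0, - 4, - 2 and the roots of x^2 + 4 x +
  8, the finite cusps of level 16.\<close>

lemma h_fun_transformation_4: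
  "\<forall>\<^sub>F x in nhds 0. h_fun 4 (poly [:0, 32, 24, 8, 1:] x) =
     (poly [:16, 16, 6, 1:] x / poly [:16, 16, 6, 1:] 0) powr (- (1 / 2)) * h_fun 4 (poly [:0, 0, 0, 0, 1:] x / poly [:16, 16, 6, 1:] x)"
proof -
  have "ode [:64, 80, 40, 10, 1:] [:64, 160, 120, 40, 5:] [:32, 48, 24, 4:] (\<lambda>x. h_fun 4 (poly [:0, 32, 24, 8, 1:] x))"
    by (rule ode_compose[OF ode_h_fun_4, where k = 1 and p = "[:32, 48, 24, 4:]" and p' = "[:48, 48, 12:]" and l = "[:32, 48, 24, 4:]"])
      (simp_all add: hom_poly_def pderiv_pCons)
  moreover have "ode [:64, 80, 40, 10, 1:] [:64, 160, 120, 40, 5:] [:32, 48, 24, 4:]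
      (\<lambda>x. (poly [:16, 16, 6, 1:] x / poly [:16, 16, 6, 1:] 0) powr (- (1 / 2)) * h_fun 4 (poly [:0, 0, 0, 0, 1:] x / poly [:16, 16, 6, 1:] x))"
    by (rule ode_pullback[OF ode_h_fun_4, where k = 1 and ds = "[:16, 12, 3:]" and dds = "[:12, 6:]"
        and p = "[:0, 0, 0, 64, 48, 12, 1:]" and p' = "[:0, 0, 192, 192, 60, 6:]" and l = "[:0, 0, 0, 256, 448, 336, 140, 34, 9 / 2, 1 / 4:]"])
      (simp_all add: hom_poly_def pderiv_pCons)
  ultimately show ?thesis by (rule ode_unique) simp_all
qed

text \<open>R^2 + 22 R + 125 is (x^2 + 2 x + 5) times a square, so the quadratic factor x^2 + 2 x +
  5 stays singular together with x S'. The homogenisation degree is 2 because the equation at level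
  5 has quadratic coefficients.\<close>

lemma h_fun_transformation_5:
  "\<forall>\<^sub>F x in nhds 0. h_fun 5 (poly [:0, 25, 25, 15, 5, 1:] x) =
     (poly [:25, 25, 15, 5, 1:] x / poly [:25, 25, 15, 5, 1:] 0) powr (- (1 / 2)) * h_fun 5 (poly [:0, 0, 0, 0, 0, 1:] x / poly [:25, 25, 15, 5, 1:] x)"
proof -
  have "ode [:500, 700, 600, 320, 120, 28, 4:] [:500, 1300, 1600, 1120, 520, 144, 24:] [:250, 625, 625, 375, 125, 25:] (\<lambda>x. h_fun 5 (poly [:0, 25, 25, 15, 5, 1:] x))"
    by (rule ode_compose[OF ode_h_fun_5, where k = 2 and p = "[:25, 50, 45, 20, 5:]" and p' = "[:50, 90, 60, 20:]" and l = "[:25:]"])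
      (simp_all add: hom_poly_def pderiv_pCons numeral_2_eq_2)
  moreover have "ode [:500, 700, 600, 320, 120, 28, 4:] [:500, 1300, 1600, 1120, 520, 144, 24:] [:250, 625, 625, 375, 125, 25:]
      (\<lambda>x. (poly [:25, 25, 15, 5, 1:] x / poly [:25, 25, 15, 5, 1:] 0) powr (- (1 / 2)) * h_fun 5 (poly [:0, 0, 0, 0, 0, 1:] x / poly [:25, 25, 15, 5, 1:] x))"
    by (rule ode_pullback[OF ode_h_fun_5, where k = 2 and ds = "[:25, 30, 15, 4:]" and dds = "[:30, 30, 12:]"
        and p = "[:0, 0, 0, 0, 125, 100, 45, 10, 1:]" and p' = "[:0, 0, 0, 500, 500, 270, 70, 8:]" and l = "[:0, 0, 0, 0, 25, 25, 15, 5, 1:]"])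
      (simp_all add: hom_poly_def pderiv_pCons numeral_2_eq_2)
  ultimately show ?thesis by (rule ode_unique) simp_all
qed

section \<open>The exponents and the conclusion\<close>

lemma dedekind_psi_values:
  "dedekind_psi 2 = 3" "dedekind_psi 3 = 4" "dedekind_psi 4 = 6" "dedekind_psi 5 = 6"
proof -
  have p: "prime (2::nat)" "prime (3::nat)" "prime (5::nat)" by simp_all
  have "prime_factors (4 :: nat) = {2}"
  proof -
    have "q = 2" if "prime q" "q dvd 4" for q :: nat
    proof -
      have "q dvd 2 ^ 2" using that(2) by simp
      hence "q dvd 2" using that(1) prime_dvd_power by blast
      thus ?thesis using that(1) p(1) primes_dvd_imp_eq by blast
    qed
    thus ?thesis by (auto simp: prime_factors_dvd)
  qed
  thus "dedekind_psi 2 = 3" "dedekind_psi 3 = 4" "dedekind_psi 4 = 6" "dedekind_psi 5 = 6"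
    using p by (simp_all add: dedekind_psi_def prime_prime_factors)
qed

theorem theorem5p1:
  fixes N :: nat
  assumes "N \<in> {2, 3, 4, 5}"
  shows "\<forall>\<^sub>F x in nhds (0::complex).
           h_fun (N\<^sup>2) x = h_fun N (poly (R_poly N) x) \<and>
           h_fun N (poly (R_poly N) x) =
             (poly (S'_poly N) x / poly (S'_poly N) 0) powr (- of_real (dedekind_psi N) / 12) *
             h_fun N (x ^ N / poly (S'_poly N) x)"
proof -
  have "\<forall>\<^sub>F x in nhds 0. h_fun N (poly (R_poly N) x) =
      (poly (S'_poly N) x / poly (S'_poly N) 0) powr (- of_real (dedekind_psi N) / 12) * h_fun N (x ^ N / poly (S'_poly N) x)"
    (is "?P N")
  proof -
    have R: "R_poly 2 = [:0, 16, 1:]" "R_poly 3 = [:0, 27, 9, 1:]" "R_poly 4 = [:0, 32, 24, 8, 1:]" "R_poly 5 = [:0, 25, 25, 15, 5, 1:]"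
      and S: "S'_poly 2 = [:16, 1:]" "S'_poly 3 = [:27, 9, 1:]" "S'_poly 4 = [:16, 16, 6, 1:]" "S'_poly 5 = [:25, 25, 15, 5, 1:]"
      by (simp_all add: R_poly_def S'_poly_def)
    have pow: "poly [:0, 0, 1:] x = x ^ 2" "poly [:0, 0, 0, 1:] x = x ^ 3" "poly [:0, 0, 0, 0, 1:] x = x ^ 4" "poly [:0, 0, 0, 0, 0, 1:] x = x ^ 5" for x :: complex
      by (simp_all add: eval_nat_numeral)
    have exps: "- complex_of_real (dedekind_psi 2) / 12 = - (1 / 4)" "- complex_of_real (dedekind_psi 3) / 12 = - (1 / 3)"
      "- complex_of_real (dedekind_psi 4) / 12 = - (1 / 2)" "- complex_of_real (dedekind_psi 5) / 12 = - (1 / 2)"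
      by (simp_all add: dedekind_psi_values)
    have "?P 2" unfolding R S exps by (rule h_fun_transformation_2[unfolded pow])
    moreover have "?P 3" unfolding R S exps by (rule h_fun_transformation_3[unfolded pow])
    moreover have "?P 4" unfolding R S exps by (rule h_fun_transformation_4[unfolded pow])
    moreover have "?P 5" unfolding R S exps by (rule h_fun_transformation_5[unfolded pow])
    ultimately show ?thesis using assms by auto
  qed
  thus ?thesis using h_fun_square_level[OF assms] by simp
qed

end
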